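(* Consider the $\mathrm{ATLAS}_\infty$ evolution started at a $\mathrm{PPP}_+(\lambda)$ distributed $\underline X(0)$, for some $\lambda>0$. For $t>0$ and $q\ge0$ let $y_\star(t,q):=[Q_\star(t,\cdot)]^{-1}(q\sqrt t)$, where $Q_\star(t,\cdot)$ is the measure with density $u_\star(t,\cdot)$. That is, $y_\star(t,q)=y_\star(1,q)\sqrt t$, and $$q=\int_\kappa^{y_\star(1,q)}u_\star(1,r)\,dr.$$ Then, for any fixed $q>0$ and $\delta>0$, $$\frac{Y_{\lfloor q\sqrt s\rfloor}(s)}{\sqrt s}\to y_\star(1,q)\quad\text{in probability, as } s\to\infty,$$ $$\lim_{\epsilon\to0}\limsup_{s\to\infty}\mathbb P\Big[\Big|\frac{1}{2\epsilon\sqrt s}\sum_{(q-\epsilon)\sqrt s\le i\le(q+\epsilon)\sqrt s}Z_i(s)-\frac{1}{u_\star(1,y_\star(1,q))}\Big|\ge\delta\Big]=0,$$ where the sum is over integers $i$ and the value $u_\star(1,y_\star(1,q))$ is given by the formula $c_1+c_2\Phi(y_\star(1,q))$.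
   Context: $\mathrm{PPP}_+(\lambda)$: the law of the points, listed in increasing order $X_1(0)\le X_2(0)\le\dots$, of a Poisson point process on $\mathbb R_+=[0,\infty)$ of constant intensity $\lambda$. $\mathrm{ATLAS}_\infty$: the infinite particle system $\underline X(t)=(X_i(t))_{i\ge1}$ given by the (unique in law) weak solution of $$dX_i(t)=\mathbf 1_{\{X_i(t)=X_{(1)}(t)\}}\,dt+dW_i(t),\qquad i\in\mathbb N,$$ with $(W_i)_{i\ge1}$ independent standard Brownian motions, independent of $\underline X(0)$; a.s. the configuration can be ranked at all times, $X_{(1)}(t)\le X_{(2)}(t)\le\dots$, with ties broken in lexicographic order (so the unit drift is given only to the currently left-most particle). Weak existence and uniqueness in law hold since a.s. $\sum_i e^{-\alpha X_i(0)^2}<\infty$ for all $\alpha>0$. Ranked particles: $Y_k(t)=X_{(k)}(t)$. Spacings: $Z_k(t)=Y_{k+1}(t)-Y_k(t)$, $k\ge1$. $\Phi$ is the standard normal cumulative distribution function; $\kappa\in\mathbb R$ is the unique solution of $\kappa(1-\Phi(\kappa))/\Phi'(\kappa)=1-\lambda/2$; $c_1=\frac{2-\lambda\Phi(\kappa)}{1-\Phi(\kappa)}$, $c_2=\frac{\lambda-2}{1-\Phi(\kappa)}$; and for $t>0$, $u_\star(t,x)=[c_1+c_2\Phi(x/\sqrt t)]\mathbf 1_{\{x>\kappa\sqrt t\}}$. Quantile: for a measure $\mu$ on $\mathbb R$ finite on half-lines $(-\infty,r]$ and $q\ge0$, $\mu^{-1}(q)=\inf\{r:\mu((-\infty,r])>q\}$.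 *)

theory Defs
  imports "HOL-Probability.Probability"
begin

text \<open>Particles are labelled by \<open>0, 1, 2, \<dots>\<close>; ranks (and hence spacings) are
  numbered from 1. Time is a real number, and only times \<open>t \<ge> 0\<close> matter.\<close>

section \<open>Brownian motion\<close>

locale standard_brownian_motion = prob_space M for M :: "'a measure" +
  fixes B :: "real \<Rightarrow> 'a \<Rightarrow> real"
  assumes random_variable: "0 \<le> t \<Longrightarrow> B t \<in> borel_measurable M"
    and start: "AE \<omega> in M. B 0 \<omega> = 0"
    and continuous_paths: "AE \<omega> in M. continuous_on {0..} (\<lambda>t. B t \<omega>)"
    and gaussian_increments:
      "0 \<le> s \<Longrightarrow> s < t \<Longrightarrow>
        distributed M lborel (\<lambda>\<omega>. B t \<omega> - B s \<omega>) (\<lambda>x. ennreal (normal_density 0 (sqrt (t - s)) x))"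
    and independent_increments:
      "0 \<le> \<tau> 0 \<Longrightarrow> incseq \<tau> \<Longrightarrow>
        indep_vars (\<lambda>_. borel) (\<lambda>(k::nat) \<omega>. B (\<tau> (Suc k)) \<omega> - B (\<tau> k) \<omega>) UNIV"

section \<open>Ranking\<close>

text \<open>Strict lexicographic order of the pairs (position, label).\<close>

definition ranked_before :: "(nat \<Rightarrow> real) \<Rightarrow> nat \<Rightarrow> nat \<Rightarrow> bool" where
  "ranked_before x j i \<longleftrightarrow> x j < x i \<or> (x j = x i \<and> j < i)"

definition has_rank :: "(nat \<Rightarrow> real) \<Rightarrow> nat \<Rightarrow> nat \<Rightarrow> bool" where
  "has_rank x i k \<longleftrightarrow> finite {j. ranked_before x j i} \<and> Suc (card {j. ranked_before x j i}) = k"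

definition ranked_value :: "(nat \<Rightarrow> real) \<Rightarrow> nat \<Rightarrow> real" where
  "ranked_value x k = x (THE i. has_rank x i k)"

definition spacing :: "(nat \<Rightarrow> real) \<Rightarrow> nat \<Rightarrow> real" where
  "spacing x k = ranked_value x (Suc k) - ranked_value x k"

section \<open>The infinite Atlas system\<close>

text \<open>A weak solution: a filtered probability space carrying independent Brownian motions
  relative to the filtration, and a continuous adapted process solving the equation in integrated
  form. By the tie-breaking rule the unit drift goes to the single particle of rank 1. Taking
  \<open>s = 0\<close> in \<open>future_indep\<close> gives in particular the independence of the Brownian
  motions from the initial configuration.\<close>

locale atlas_infinity = prob_space M + filtration "space M" F
  for M :: "'a measure" and F :: "real \<Rightarrow> 'a measure" +
  fixes W X :: "nat \<Rightarrow> real \<Rightarrow> 'a \<Rightarrow> real"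
  assumes subalgebra_F: "subalgebra M (F t)"
    and brownian: "standard_brownian_motion M (W i)"
    and W_indep: "indep_vars (\<lambda>_. \<Pi>\<^sub>M t\<in>{0..}. borel) (\<lambda>i \<omega>. \<lambda>t\<in>{0..}. W i t \<omega>) UNIV"
    and W_adapted: "0 \<le> t \<Longrightarrow> W i t \<in> borel_measurable (F t)"
    and future_indep:
      "0 \<le> s \<Longrightarrow> indep_set (sets (F s))
        (sets (vimage_algebra (space M)
          (\<lambda>\<omega>. \<lambda>(i, t)\<in>UNIV \<times> {s..}. W i t \<omega> - W i s \<omega>)
          (\<Pi>\<^sub>M p\<in>(UNIV :: nat set) \<times> {s..}. borel)))"
    and X_adapted: "0 \<le> t \<Longrightarrow> X i t \<in> borel_measurable (F t)"
    and X_continuous: "AE \<omega> in M. \<forall>i. continuous_on {0..} (\<lambda>t. X i t \<omega>)"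
    and sde:
      "AE \<omega> in M. \<forall>i. \<forall>t\<ge>0.
        X i t \<omega> = X i 0 \<omega>
          + (LBINT u=0..t. (if has_rank (\<lambda>j. X j u \<omega>) i 1 then 1 else 0))
          + W i t \<omega>"

section \<open>Poisson point processes\<close>

text \<open>The random points \<open>X 0, X 1, \<dots>\<close>, counted with multiplicity, form a Poisson
  point process with intensity measure \<open>\<mu>\<close>. The finiteness clause is needed because
  \<open>card\<close> of an infinite set is 0. The Poisson probabilities are written out since
  \<open>poisson_pmf\<close> is only specified for a positive rate; rate 0 means that there are
  almost surely no points, as \<open>0 ^ 0 = 1\<close>.\<close>

definition poisson_points :: "'a measure \<Rightarrow> real measure \<Rightarrow> (nat \<Rightarrow> 'a \<Rightarrow> real) \<Rightarrow> bool" where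
  "poisson_points M \<mu> X \<longleftrightarrow>
    (\<forall>i. X i \<in> borel_measurable M) \<and>
    (\<forall>A\<in>sets borel. emeasure \<mu> A < \<infinity> \<longrightarrow>
      (AE \<omega> in M. finite {i. X i \<omega> \<in> A}) \<and>
      (\<forall>n. measure M {\<omega> \<in> space M. card {i. X i \<omega> \<in> A} = n}
            = measure \<mu> A ^ n / fact n * exp (- measure \<mu> A))) \<and>
    (\<forall>n (A :: nat \<Rightarrow> real set).
      disjoint_family_on A {..<n} \<and> (\<forall>k<n. A k \<in> sets borel \<and> emeasure \<mu> (A k) < \<infinity>) \<longrightarrow>
      prob_space.indep_vars M (\<lambda>_. count_space UNIV) (\<lambda>k \<omega>. card {i. X i \<omega> \<in> A k}) {..<n})"

definition PPP_plus :: "'a measure \<Rightarrow> real \<Rightarrow> (nat \<Rightarrow> 'a \<Rightarrow> real) \<Rightarrow> bool" where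
  "PPP_plus M lam X \<longleftrightarrow>
    poisson_points M (density lborel (\<lambda>x. ennreal (lam * indicator {0..} x))) X \<and>
    (AE \<omega> in M. \<forall>i. X i \<omega> \<le> X (Suc i) \<omega>)"

section \<open>The limiting profile\<close>

definition Phi :: "real \<Rightarrow> real" where
  "Phi = cdf std_normal_distribution"

definition kappa :: "real \<Rightarrow> real" where
  "kappa lam = (THE k. k * (1 - Phi k) / deriv Phi k = 1 - lam / 2)"

definition c1 :: "real \<Rightarrow> real" where
  "c1 lam = (2 - lam * Phi (kappa lam)) / (1 - Phi (kappa lam))"

definition c2 :: "real \<Rightarrow> real" where
  "c2 lam = (lam - 2) / (1 - Phi (kappa lam))"

definition u_star :: "real \<Rightarrow> real \<Rightarrow> real \<Rightarrow> real" where
  "u_star lam t x = (c1 lam + c2 lam * Phi (x / sqrt t)) * indicator {kappa lam * sqrt t <..} x"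

definition Q_star :: "real \<Rightarrow> real \<Rightarrow> real measure" where
  "Q_star lam t = density lborel (\<lambda>x. ennreal (u_star lam t x))"

definition quantile :: "real measure \<Rightarrow> real \<Rightarrow> real" where
  "quantile \<mu> q = Inf {r. emeasure \<mu> {..r} > ennreal q}"

definition y_star :: "real \<Rightarrow> real \<Rightarrow> real \<Rightarrow> real" where
  "y_star lam t q = quantile (Q_star lam t) (q * sqrt t)"

section \<open>Convergence in probability\<close>

definition tendsto_in_probability ::
    "'a measure \<Rightarrow> (real \<Rightarrow> 'a \<Rightarrow> real) \<Rightarrow> real \<Rightarrow> real filter \<Rightarrow> bool" where
  "tendsto_in_probability M V l G \<longleftrightarrow>
    (\<forall>\<eta>>0. ((\<lambda>s. measure M {\<omega> \<in> space M. \<bar>V s \<omega> - l\<bar> > \<eta>}) \<longlongrightarrow> 0) G)"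

end

theory Submission
  imports Defs "HOL-Real_Asymp.Real_Asymp"
begin

text \<open>Put \<open>A(t, z) = b\<^sup>-\<^sup>1 \<Sum>\<^sub>i (z - x\<^sub>i(t))\<^sup>+\<close> for the diffusively rescaled particles
  \<open>x\<^sub>i(t) = X\<^sub>i(b\<^sup>2 t) / b\<close>, \<open>b = sqrt s\<close>. Since only the left-most particle drifts, \<open>A\<close> is a noisy
  solution of the parabolic obstacle problem \<open>A\<^sub>t = A\<^sub>z\<^sub>z / 2 - 1{A > 0}\<close>. With \<open>P\<close> the heat
  operator of a time step \<open>h\<close>, one step satisfies, up to errors that are \<open>o(h)\<close> in expectation,
  \<open>max (P A - h) 0 \<le> A(t + h) \<le> max (P A - h) \<epsilon>\<close>: the total drift is at most \<open>h\<close>, and where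
  \<open>P A \<ge> \<epsilon>\<close> the left-most particle stays strictly to the left of \<open>z\<close> for most of the step, so that
  almost all of the drift counts. The second integral \<open>Astar\<close> of \<open>u_star\<close> satisfies
  the same two bounds, and these bounds are monotone and contractive, so \<open>A\<close> and \<open>Astar\<close> stay close.
  The noise is controlled by orthogonality of the independent Brownian increments, in a norm weighted
  by \<open>1 + exp z\<close>, which the heat operator essentially preserves. As \<open>A\<close> is convex in \<open>z\<close>,
  its convergence gives that of its slopes, the rescaled counting functions, hence of the ranked
  particles; the sum of spacings telescopes.\<close>

section \<open>Gaussian measures and the heat operator\<close>

text \<open>The profiles only have to satisfy pointwise one-step inequalities, so neither
  compactness nor a martingale problem enters. The obstacle is the number of steps: with n steps of
  length h = 1/n, an error of order h in each of them would sum to order 1. Hence the deterministic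
  errors must sum to o(1); the first step, from time 0, may cost order h since it occurs once. The
  noise of a step is of order 1/sqrt b, which is harmless because n stays fixed while b tends to
  infinity. Deviations are measured by the expected excess over a threshold e. Positive parts
  survive averaging by the heat operator, and the threshold absorbs the regions without control:
  where the heated profile is below e the drift may be lost, and near the front \<open>Astar\<close>
  is small. In the weight, exp z matches the moment that is available uniformly in time, that of the
  sum of exp(-x_i), and the constant 1 takes the errors that do not decay to the left. A second
  length a, finally the fourth root of h, is much longer than the diffusion length sqrt h of a step
  but still tends to 0.\<close>

definition gauss :: "real \<Rightarrow> real measure" where
  "gauss h = density lborel (\<lambda>x. ennreal (normal_density 0 (sqrt h) x))"

lemma space_gauss [simp]: "space (gauss h) = UNIV"
  and sets_gauss [simp, measurable_cong]: "sets (gauss h) = sets borel"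
  by (simp_all add: gauss_def)

lemma prob_space_gauss: "0 < h \<Longrightarrow> prob_space (gauss h)"
  unfolding gauss_def by (rule prob_space_normal_density) simp

lemma measure_gauss_UNIV [simp]: "0 < h \<Longrightarrow> measure (gauss h) UNIV = 1"
  using prob_space.prob_space[OF prob_space_gauss] by simp

lemma integrable_gauss_iff:
  assumes [measurable]: "f \<in> borel_measurable borel"
  shows "integrable (gauss h) f \<longleftrightarrow> integrable lborel (\<lambda>x. normal_density 0 (sqrt h) x * (f x :: real))"
  unfolding gauss_def by (subst integrable_density) auto

lemma integral_gauss:
  assumes [measurable]: "f \<in> borel_measurable borel"
  shows "(\<integral>y. f y \<partial>gauss h) = (\<integral>x. normal_density 0 (sqrt h) x * (f x :: real) \<partial>lborel)"
  unfolding gauss_def by (subst integral_density) auto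

text \<open>Completing the square: tilting a centred Gaussian of variance h by exp(c y) moves the
  mean to c h and produces the factor exp(c^2 h / 2).\<close>

lemma normal_density_exp_shift:
  assumes "0 < h"
  shows "normal_density 0 (sqrt h) y * exp (c * y) = exp (c\<^sup>2 * h / 2) * normal_density (c * h) (sqrt h) y"
proof -
  have "- (y - c * h)\<^sup>2 / (2 * h) + c\<^sup>2 * h / 2 = - y\<^sup>2 / (2 * h) + c * y"
    using assms by (simp add: field_simps power2_eq_square)
  then show ?thesis
    using assms by (simp add: normal_density_def mult_exp_exp add.commute)
qed

lemma has_bochner_integral_gauss_exp:
  assumes "0 < h"
  shows "has_bochner_integral (gauss h) (\<lambda>y. exp (c * y)) (exp (c\<^sup>2 * h / 2))"
proof -
  have i: "integrable lborel (\<lambda>y. exp (c\<^sup>2 * h / 2) * normal_density (c * h) (sqrt h) y)"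
    using assms by (intro integrable_mult_right integrable_normal_density) simp
  have "integrable (gauss h) (\<lambda>y. exp (c * y))"
    using i assms by (subst integrable_gauss_iff) (auto simp: normal_density_exp_shift)
  moreover have "(\<integral>y. exp (c * y) \<partial>gauss h) = exp (c\<^sup>2 * h / 2)"
    using assms by (subst integral_gauss) (auto simp: normal_density_exp_shift)
  ultimately show ?thesis
    by (simp add: has_bochner_integral_iff)
qed

lemmas integrable_gauss_exp = has_bochner_integral_gauss_exp[THEN integrable.intros]
lemmas integral_gauss_exp = has_bochner_integral_gauss_exp[THEN has_bochner_integral_integral_eq]

lemma integrable_gauss_exp_abs:
  assumes "0 < h" shows "integrable (gauss h) (\<lambda>y. exp (c * \<bar>y\<bar>))"
proof (rule Bochner_Integration.integrable_bound)
  show "integrable (gauss h) (\<lambda>y. exp (c * y) + exp (- c * y))"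
    using integrable_gauss_exp[OF assms, of c] integrable_gauss_exp[OF assms, of "-c"] by simp
  show "AE y in gauss h. norm (exp (c * \<bar>y\<bar>)) \<le> norm (exp (c * y) + exp (- c * y))"
  proof (intro AE_I2)
    fix y
    have "exp (c * \<bar>y\<bar>) \<le> exp (c * y) + exp (- c * y)" by (cases "0 \<le> y") simp_all
    then show "norm (exp (c * \<bar>y\<bar>)) \<le> norm (exp (c * y) + exp (- c * y))" by simp
  qed
qed simp

lemma has_bochner_integral_gauss_even:
  assumes "0 < h"
  shows "has_bochner_integral (gauss h) (\<lambda>y. y ^ (2 * k)) (fact (2 * k) / ((2 / h) ^ k * fact k))"
proof -
  have "has_bochner_integral lborel (\<lambda>x. normal_density 0 (sqrt h) x * x ^ (2 * k)) (fact (2 * k) / ((2 / h) ^ k * fact k))"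
    using normal_moment_even[of "sqrt h" 0 k] assms by simp
  then show ?thesis
    by (simp add: has_bochner_integral_iff integrable_gauss_iff integral_gauss)
qed

lemma integrable_gauss_power:
  assumes "0 < h" shows "integrable (gauss h) (\<lambda>y. y ^ k)"
  using integrable_normal_moment[of "sqrt h" 0 k] assms by (simp add: integrable_gauss_iff)

lemma integrable_gauss_ident: "0 < h \<Longrightarrow> integrable (gauss h) (\<lambda>y. y)"
  using integrable_gauss_power[of h 1] by simp

lemma integral_gauss_ident:
  assumes "0 < h" shows "(\<integral>y. y \<partial>gauss h) = 0"
  using integral_normal_moment_nz_1[of "sqrt h" 0] assms by (simp add: integral_gauss)

lemma integral_gauss_square: "0 < h \<Longrightarrow> (\<integral>y. y\<^sup>2 \<partial>gauss h) = h"
  using has_bochner_integral_gauss_even[of h 1, THEN has_bochner_integral_integral_eq]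
  by (simp add: fact_numeral)

lemma integral_gauss_fourth: "0 < h \<Longrightarrow> (\<integral>y. y ^ 4 \<partial>gauss h) = 3 * h\<^sup>2"
  using has_bochner_integral_gauss_even[of h 2, THEN has_bochner_integral_integral_eq]
  by (simp add: fact_numeral field_simps power2_eq_square)

text \<open>Chebyshev's inequality. The polynomial rate suffices because in the end h / a^2 is sent
  to 0.\<close>

lemma gauss_tail:
  assumes "0 < h" "0 < a"
  shows "measure (gauss h) {a..} \<le> h / a\<^sup>2"
proof -
  interpret prob_space "gauss h" by (rule prob_space_gauss) fact
  have "measure (gauss h) {a..} = (\<integral>y. indicator {a..} y \<partial>gauss h)"
    by simp
  also have "\<dots> \<le> (\<integral>y. y\<^sup>2 / a\<^sup>2 \<partial>gauss h)"
    using assms by (intro integral_mono integrable_divide integrable_gauss_power integrable_real_indicator)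
      (auto simp: less_top[symmetric] indicator_def divide_simps intro!: power_mono)
  also have "\<dots> = h / a\<^sup>2"
    using assms by (simp add: integral_gauss_square)
  finally show ?thesis .
qed

lemma gauss_convolution:
  assumes "0 < s" "0 < t"
  shows "(gauss s \<star> gauss t) = gauss (s + t)"
proof -
  have f: "finite_measure (gauss s)" "finite_measure (gauss t)"
    using assms prob_space_gauss prob_space.finite_measure by blast+
  have "(gauss s \<star> gauss t) = density lborel (\<lambda>x. \<integral>\<^sup>+y. ennreal (normal_density 0 (sqrt s) (x - y)) * ennreal (normal_density 0 (sqrt t) y) \<partial>lborel)"
    unfolding gauss_def using f by (intro convolution_density) (auto simp: gauss_def)
  also have "(\<lambda>x. \<integral>\<^sup>+y. ennreal (normal_density 0 (sqrt s) (x - y)) * ennreal (normal_density 0 (sqrt t) y) \<partial>lborel)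
      = (\<lambda>x. ennreal (normal_density 0 (sqrt (s + t)) x))"
    using conv_normal_density_zero_mean[of "sqrt s" "sqrt t"] assms
    by (simp add: ennreal_mult' fun_eq_iff)
  finally show ?thesis by (simp add: gauss_def)
qed

text \<open>The semigroup law, stated for nonnegative integrals so that it applies before any
  integrability is known.\<close>

lemma nn_integral_gauss_gauss:
  assumes "0 < s" "0 < t" and [measurable]: "f \<in> borel_measurable borel"
  shows "(\<integral>\<^sup>+y. \<integral>\<^sup>+z. f (y + z) \<partial>gauss t \<partial>gauss s) = (\<integral>\<^sup>+y. f y \<partial>gauss (s + t))"
proof -
  have f: "finite_measure (gauss s)" "finite_measure (gauss t)"
    using assms prob_space_gauss prob_space.finite_measure by blast+
  show ?thesis
    using nn_integral_convolution[OF f, of f] assms by (simp add: gauss_convolution)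
qed

section \<open>The heat operator on positive parts\<close>

definition heat :: "real \<Rightarrow> (real \<Rightarrow> real) \<Rightarrow> real \<Rightarrow> real" where
  "heat h f x = (\<integral>y. f (x - y) \<partial>gauss h)"

definition pos_part :: "real \<Rightarrow> real" where
  "pos_part z = max 0 z"

lemma measurable_pos_part [measurable]: "pos_part \<in> borel_measurable borel"
  unfolding pos_part_def by measurable

lemma pos_part_nonneg [simp]: "0 \<le> pos_part z"
  and pos_part_ge: "z \<le> pos_part z"
  and pos_part_mono: "z \<le> z' \<Longrightarrow> pos_part z \<le> pos_part z'"
  by (auto simp: pos_part_def)

text \<open>Exponential majorants replace linear growth, so that summability of exp(-u_i) alone
  controls the sums of positive parts at every level z.\<close>

lemma pos_part_le_exp: "pos_part z \<le> exp z"
  using exp_ge_add_one_self[of z] exp_gt_zero[of z] by (simp add: pos_part_def del: exp_ge_add_one_self)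

lemma pos_part_square_le_exp: "(pos_part z)\<^sup>2 \<le> 2 * exp z"
proof (cases "0 \<le> z")
  case True
  have "1 + z + z\<^sup>2 / 2 \<le> exp z" by (rule exp_lower_Taylor_quadratic) fact
  then show ?thesis using True by (simp add: pos_part_def)
qed (simp add: pos_part_def)

lemma pos_part_Lipschitz: "\<bar>pos_part a - pos_part b\<bar> \<le> \<bar>a - b\<bar>"
  by (auto simp: pos_part_def)

lemma integrable_gauss_pos_part:
  assumes "0 < h" shows "integrable (gauss h) (\<lambda>y. pos_part (z - y))"
proof (rule Bochner_Integration.integrable_bound)
  show "integrable (gauss h) (\<lambda>y. exp z * exp (- 1 * y))"
    using integrable_gauss_exp[OF assms, of "-1"] by (intro integrable_mult_right)
  show "AE y in gauss h. norm (pos_part (z - y)) \<le> norm (exp z * exp (- 1 * y))"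
    using pos_part_le_exp by (auto simp: exp_add[symmetric])
qed simp

lemma heat_pos_part_le_exp:
  assumes "0 < h" shows "heat h pos_part z \<le> exp (h / 2) * exp z"
proof -
  have "heat h pos_part z \<le> (\<integral>y. exp z * exp (- 1 * y) \<partial>gauss h)"
    unfolding heat_def
    by (intro integral_mono integrable_mult_right integrable_gauss_pos_part[OF assms] integrable_gauss_exp[OF assms]) (simp_all add: exp_add[symmetric] pos_part_le_exp)
  also have "\<dots> = exp (h / 2) * exp z"
    using integral_gauss_exp[OF assms, of "-1"] by simp
  finally show ?thesis .
qed

lemma heat_pos_part_nonneg: "0 \<le> heat h pos_part z"
  unfolding heat_def by simp

text \<open>Jensen's inequality: z is the mean of z - y under the centred measure, and z - y lies
  below its positive part.\<close>

lemma heat_pos_part_ge: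
  assumes "0 < h" shows "pos_part z \<le> heat h pos_part z"
proof -
  interpret prob_space "gauss h" by (rule prob_space_gauss) fact
  have "z = (\<integral>y. z - y \<partial>gauss h)"
    using integrable_gauss_ident[OF assms] integral_gauss_ident[OF assms] by (simp add: assms)
  also have "\<dots> \<le> heat h pos_part z"
    unfolding heat_def using integrable_gauss_pos_part[OF assms] integrable_gauss_ident[OF assms]
    by (intro integral_mono) (auto intro: pos_part_ge)
  finally show ?thesis using heat_pos_part_nonneg by (simp add: pos_part_def)
qed

text \<open>The difference of the positive parts is at most |y| + a, and it is positive only where z
  - y > 0, that is where exp(z - y) exceeds 1; this inserts the exponential weight. The mean of |y|
  exp(-y) is then of order sqrt h.\<close>

lemma heat_pos_part_diff_le:
  assumes "0 < h" "0 \<le> a"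
  shows "heat h pos_part z - pos_part (z - a) \<le> (sqrt h * (1 + exp (2 * h)) / 2 + a * exp (h / 2)) * exp z"
proof -
  interpret prob_space "gauss h" by (rule prob_space_gauss) fact
  have sq: "sqrt h > 0" using assms by simp
  have bound: "pos_part (z - y) - pos_part (z - a) \<le> exp z * ((y\<^sup>2 / sqrt h + sqrt h * exp (- 2 * y)) / 2 + a * exp (- 1 * y))" for y
  proof -
    \<comment> \<open>A weighted AM-GM inequality; the weight sqrt h gives both terms a mean of
      order sqrt h.\<close>
    have amgm: "\<bar>y\<bar> * exp (- y) \<le> (y\<^sup>2 / sqrt h + sqrt h * exp (- 2 * y)) / 2"
    proof -
      have "0 \<le> (\<bar>y\<bar> - sqrt h * exp (- y))\<^sup>2 / sqrt h" using sq by simp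
      also have "\<dots> = y\<^sup>2 / sqrt h + sqrt h * exp (- 2 * y) - 2 * (\<bar>y\<bar> * exp (- y))"
        using sq assms by (simp add: power2_diff power_mult_distrib divide_simps exp_double[symmetric] power2_eq_square algebra_simps exp_add[symmetric])
      finally show ?thesis by simp
    qed
    have "pos_part (z - y) - pos_part (z - a) \<le> (\<bar>y\<bar> + a) * exp (z - y)"
    proof (cases "z - y \<le> 0")
      case True
      then have "pos_part (z - y) = 0" by (simp add: pos_part_def)
      moreover have "0 \<le> (\<bar>y\<bar> + a) * exp (z - y)" using assms by simp
      ultimately show ?thesis using pos_part_nonneg[of "z - a"] by linarith
    next
      case False
      then have "1 \<le> exp (z - y)" by simp
      then have "\<bar>y\<bar> + a \<le> (\<bar>y\<bar> + a) * exp (z - y)"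
        using assms by (metis add_nonneg_nonneg abs_ge_zero mult_le_cancel_left1 linorder_not_le order_less_le_trans)
      moreover have "pos_part (z - y) - pos_part (z - a) \<le> \<bar>y\<bar> + a"
        using pos_part_Lipschitz[of "z - y" "z - a"] assms by auto
      ultimately show ?thesis by linarith
    qed
    also have "\<dots> = exp z * (\<bar>y\<bar> * exp (- y) + a * exp (- 1 * y))"
      by (simp add: exp_diff exp_minus field_simps)
    also have "\<dots> \<le> exp z * ((y\<^sup>2 / sqrt h + sqrt h * exp (- 2 * y)) / 2 + a * exp (- 1 * y))"
      using amgm by (intro mult_left_mono add_right_mono) auto
    finally show ?thesis .
  qed
  note [simp] = integrable_gauss_exp[OF assms(1), of "-1", simplified] integrable_gauss_exp[OF assms(1), of "-2", simplified]
    integrable_gauss_power[OF assms(1)]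
  have "heat h pos_part z - pos_part (z - a) = (\<integral>y. pos_part (z - y) - pos_part (z - a) \<partial>gauss h)"
    unfolding heat_def using integrable_gauss_pos_part[OF assms(1)] by (simp add: assms)
  also have "\<dots> \<le> (\<integral>y. exp z * ((y\<^sup>2 / sqrt h + sqrt h * exp (- 2 * y)) / 2 + a * exp (- 1 * y)) \<partial>gauss h)"
    using integrable_gauss_pos_part[OF assms(1)] bound by (intro integral_mono) simp_all
  also have "\<dots> = exp z * ((h / sqrt h + sqrt h * exp (2 * h)) / 2 + a * exp (h / 2))"
    using integral_gauss_exp[OF assms(1), of "-1"] integral_gauss_exp[OF assms(1), of "-2"] 
    by (simp add: integral_gauss_square[OF assms(1)])
  also have "h / sqrt h = sqrt h" using assms by (simp add: real_div_sqrt)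
  finally show ?thesis by (simp add: algebra_simps)
qed

lemma heat_pos_part_mono: 
  assumes "0 < h" "z \<le> z'" shows "heat h pos_part z \<le> heat h pos_part z'"
  unfolding heat_def using assms integrable_gauss_pos_part[OF assms(1)]
  by (intro integral_mono) (auto intro: pos_part_mono)

lemma summable_pos_part:
  fixes u :: "nat \<Rightarrow> real"
  assumes "summable (\<lambda>i. exp (- u i))" shows "summable (\<lambda>i. pos_part (z - u i))"
proof (rule summable_comparison_test'[where g = "\<lambda>i. exp z * exp (- u i)"])
  show "summable (\<lambda>i. exp z * exp (- u i))" using assms by (rule summable_mult)
  show "norm (pos_part (z - u i)) \<le> exp z * exp (- u i)" for i
    using pos_part_le_exp[of "z - u i"] by (simp add: exp_add[symmetric])
qed

lemma summable_heat_pos_part: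
  fixes u :: "nat \<Rightarrow> real"
  assumes "0 < h" "summable (\<lambda>i. exp (- u i))" shows "summable (\<lambda>i. heat h pos_part (z - u i))"
proof (rule summable_comparison_test'[where g = "\<lambda>i. exp (h / 2) * (exp z * exp (- u i))"])
  show "summable (\<lambda>i. exp (h / 2) * (exp z * exp (- u i)))" using assms by (intro summable_mult)
  show "norm (heat h pos_part (z - u i)) \<le> exp (h / 2) * (exp z * exp (- u i))" for i
    using heat_pos_part_le_exp[OF assms(1), of "z - u i"] heat_pos_part_nonneg[of h "z - u i"]
    by (simp add: exp_add[symmetric])
qed

lemma measurable_heat_pos_part [measurable]: "heat h pos_part \<in> borel_measurable borel" if "0 < h"
  by (rule borel_measurable_mono) (auto simp: mono_def heat_pos_part_mono that)

section \<open>The normal distribution and the constant \<open>kappa\<close>\<close>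

abbreviation phi :: "real \<Rightarrow> real" where
  "phi \<equiv> std_normal_density"

lemma DERIV_phi: "DERIV phi x :> - x * phi x"
  unfolding std_normal_density_def by (auto intro!: derivative_eq_intros simp: divide_simps)

lemma phi_pos [simp]: "0 < phi x"
  by (simp add: normal_density_pos)

lemma phi_le_1: "phi x \<le> 1"
proof -
  have "1 \<le> sqrt (2 * pi)" using pi_gt3 by simp
  then have "1 / sqrt (2 * pi) * exp (- x\<^sup>2 / 2) \<le> 1 * 1"
    by (intro mult_mono) auto
  then show ?thesis by (simp add: std_normal_density_def)
qed

lemma continuous_phi: "isCont phi x"
  using DERIV_phi DERIV_isCont by blast

interpretation std_normal: real_distribution std_normal_distribution
  by (rule real_dist_normal_dist)

lemma Phi_diff:
  assumes "a \<le> u" shows "Phi u - Phi a = (LBINT y=a..u. phi y)"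
proof (cases "a = u")
  case False
  with assms have "a < u" by simp
  have "Phi u - Phi a = measure std_normal_distribution {a<..u}"
    unfolding Phi_def using \<open>a < u\<close> by (rule std_normal.cdf_diff_eq)
  also have "\<dots> = (\<integral>y. indicator {a<..u} y \<partial>std_normal_distribution)"
    by simp
  also have "\<dots> = (\<integral>y. phi y * indicator {a<..u} y \<partial>lborel)"
    by (subst integral_density) auto
  also have "\<dots> = (LBINT y=a..u. phi y)"
    using \<open>a < u\<close> by (subst interval_integral_Ioc) (auto simp: set_lebesgue_integral_def mult.commute)
  finally show ?thesis .
qed simp

text \<open>Around x, \<open>Phi\<close> is a constant plus the integral of the density, to which
  the fundamental theorem applies. The integral starts at x - 1 so that x is an interior
  point.\<close>

lemma DERIV_Phi: "DERIV Phi x :> phi x"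
proof -
  have "((\<lambda>u. LBINT y=x - 1..u. phi y) has_vector_derivative phi x) (at x within {x - 1..x + 1})"
    by (rule interval_integral_FTC2) (auto intro!: continuous_at_imp_continuous_on continuous_phi)
  then have "((\<lambda>u. Phi (x - 1) + (LBINT y=x - 1..u. phi y)) has_vector_derivative 0 + phi x) (at x within {x - 1..x + 1})"
    by (intro has_vector_derivative_add has_vector_derivative_const)
  then have "(Phi has_vector_derivative 0 + phi x) (at x within {x - 1..x + 1})"
    by (rule has_vector_derivative_transform[rotated 2]) (auto simp: Phi_diff[symmetric])
  then have "(Phi has_vector_derivative phi x) (at x within {x - 1<..<x + 1})"
    by (auto intro: has_vector_derivative_within_subset)
  then show ?thesis
    by (subst (asm) has_vector_derivative_within_open) (auto simp: has_real_derivative_iff_has_vector_derivative)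
qed

lemma deriv_Phi: "deriv Phi x = phi x"
  by (rule DERIV_imp_deriv) (rule DERIV_Phi)

lemma Phi_strict_mono: "x < y \<Longrightarrow> Phi x < Phi y"
  by (rule DERIV_pos_imp_increasing) (auto intro!: exI DERIV_Phi)

lemma Phi_mono: "x \<le> y \<Longrightarrow> Phi x \<le> Phi y"
  using Phi_strict_mono[of x y] by (cases "x = y") auto

lemma Phi_at_top: "(Phi \<longlongrightarrow> 1) at_top"
  unfolding Phi_def by (rule std_normal.cdf_lim_at_top_prob)

lemma Phi_at_bot: "(Phi \<longlongrightarrow> 0) at_bot"
  unfolding Phi_def by (rule std_normal.cdf_lim_at_bot)

lemma Phi_less_1: "Phi x < 1"
  using Phi_strict_mono[of x "x + 1"] std_normal.cdf_bounded_prob[of "x + 1"] by (simp add: Phi_def)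

lemma Phi_pos: "0 < Phi x"
  using Phi_strict_mono[of "x - 1" x] std_normal.cdf_nonneg[of "x - 1"] by (simp add: Phi_def)

lemma measurable_Phi [measurable]: "Phi \<in> borel_measurable borel"
  by (rule borel_measurable_mono) (simp add: mono_def Phi_mono)

text \<open>The difference r of the two sides has derivative -2 phi / (1 + k^2)^2 < 0 and tends to 0
  at infinity, so it is positive everywhere. The inequality expresses that k (1 - Phi k) / phi k has
  positive derivative, which makes \<open>kappa\<close> unique.\<close>

lemma mills_ratio_bound: "k * phi k / (1 + k\<^sup>2) < 1 - Phi k"
proof -
  define r where "r k = 1 - Phi k - k * phi k / (1 + k\<^sup>2)" for k
  have nz: "1 + z\<^sup>2 \<noteq> (0::real)" for z
    using zero_le_power2[of z] by linarith
  have D: "DERIV r z :> - 2 * phi z / (1 + z\<^sup>2)\<^sup>2" for z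
  proof -
    have "DERIV r z :> - phi z - ((phi z + z * (- z * phi z)) * (1 + z\<^sup>2) - z * phi z * (2 * z)) / ((1 + z\<^sup>2) * (1 + z\<^sup>2))" (is "DERIV r z :> ?d")
      unfolding r_def using nz[of z] by (auto intro!: derivative_eq_intros DERIV_phi DERIV_Phi)
    moreover have "?d = - 2 * phi z / (1 + z\<^sup>2)\<^sup>2"
      using nz[of z] by (simp add: divide_simps) (simp add: algebra_simps power2_eq_square)
    ultimately show ?thesis by simp
  qed
  have neg: "- 2 * phi z / (1 + z\<^sup>2)\<^sup>2 < 0" for z
    using phi_pos[of z] nz[of z] by (simp add: divide_neg_pos del: phi_pos)
  have dec: "r y < r x" if "x < y" for x y
    by (rule DERIV_neg_imp_decreasing[OF that]) (use D neg in blast)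
  have "(r \<longlongrightarrow> 1 - 1 - 0) at_top"
    unfolding r_def
  proof (intro tendsto_diff tendsto_const Phi_at_top)
    show "((\<lambda>k. k * phi k / (1 + k\<^sup>2)) \<longlongrightarrow> 0) at_top"
      unfolding std_normal_density_def by real_asymp
  qed
  then have "0 \<le> r (k + 1)"
    using dec by (intro tendsto_upperbound[of r 0 at_top]) (auto intro!: eventually_at_top_linorderI[of "k + 1"] simp: le_less)
  then show ?thesis
    using dec[of k "k + 1"] by (simp add: r_def)
qed

text \<open>The left-hand side is strictly increasing by \<open>mills_ratio_bound\<close>. The same
  bound shows that it exceeds u^2 / (1 + u^2), hence comes above every number less than 1; to the
  left it falls below any bound, so the intermediate value theorem applies.\<close>

lemma kappa_exists1:
  assumes "0 < lam"
  shows "\<exists>!k. k * (1 - Phi k) / deriv Phi k = 1 - lam / 2"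
proof -
  define f where "f k = k * (1 - Phi k) / phi k" for k
  have pn: "phi k \<noteq> 0" for k using phi_pos[of k] by (metis less_irrefl)
  have D: "DERIV f k :> ((1 + k\<^sup>2) * (1 - Phi k) - k * phi k) / phi k" for k
  proof -
    have "DERIV f k :> ((1 - Phi k + k * (- phi k)) * phi k - k * (1 - Phi k) * (- k * phi k)) / (phi k * phi k)" (is "DERIV f k :> ?d")
      unfolding f_def using pn by (auto intro!: derivative_eq_intros DERIV_phi DERIV_Phi)
    moreover have "?d = ((1 + k\<^sup>2) * (1 - Phi k) - k * phi k) / phi k"
      using pn by (simp add: field_simps power2_eq_square)
    ultimately show ?thesis by simp
  qed
  have pos: "0 < ((1 + k\<^sup>2) * (1 - Phi k) - k * phi k) / phi k" for k
  proof -
    have "0 < 1 + k\<^sup>2" using zero_le_power2[of k] by linarith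
    then show ?thesis using mills_ratio_bound[of k] by (simp add: field_simps)
  qed
  have mono: "f x < f y" if "x < y" for x y
    by (rule DERIV_pos_imp_increasing[OF that]) (use D pos in blast)
  have ex: "\<exists>k. f k = 1 - lam / 2"
  proof -
    obtain u :: real where u: "0 < u" "1 - lam / 2 < u\<^sup>2 / (1 + u\<^sup>2)"
    proof -
      have "((\<lambda>u::real. u\<^sup>2 / (1 + u\<^sup>2)) \<longlongrightarrow> 1) at_top" by real_asymp
      then have "eventually (\<lambda>u. 1 - lam / 2 < u\<^sup>2 / (1 + u\<^sup>2)) at_top"
        by (rule order_tendstoD) (use assms in simp)
      from eventually_happens[OF eventually_conj[OF this eventually_gt_at_top[of 0]]] that show ?thesis
        by auto
    qed
    have "u\<^sup>2 / (1 + u\<^sup>2) < f u"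
    proof -
      have "u * (u * phi u / (1 + u\<^sup>2)) < u * (1 - Phi u)"
        using u mills_ratio_bound[of u] by (intro mult_strict_left_mono) auto
      then show ?thesis
        using u phi_pos[of u] by (simp add: f_def field_simps power2_eq_square del: phi_pos)
    qed
    with u have up: "1 - lam / 2 < f u" by simp
    \<comment> \<open>Chosen so that l (1 - Phi 0) = -(1 + lam), which lies below 1 - lam /
      2.\<close>
    define l where "l = - (1 + lam) / (1 - Phi 0)"
    have P0: "0 < 1 - Phi 0" using Phi_less_1[of 0] by simp
    then have "l < 0" using assms by (simp add: l_def divide_neg_pos)
    have "f l \<le> l * (1 - Phi 0)"
    proof -
      \<comment> \<open>For negative l the numerator only grows and the density is at most
        1.\<close>
      have "1 - Phi 0 \<le> (1 - Phi l) / phi l"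
      proof -
        have "(1 - Phi 0) * phi l \<le> (1 - Phi l) * 1"
          using \<open>l < 0\<close> P0 Phi_mono[of l 0] by (intro mult_mono phi_le_1) auto
        then show ?thesis using phi_pos[of l] by (simp add: field_simps del: phi_pos)
      qed
      then have "l * ((1 - Phi l) / phi l) \<le> l * (1 - Phi 0)"
        using \<open>l < 0\<close> by (intro mult_left_mono_neg) auto
      then show ?thesis by (simp add: f_def)
    qed
    also have "\<dots> = - (1 + lam)" using P0 by (simp add: l_def)
    finally have low: "f l \<le> 1 - lam / 2" using assms by simp
    have "\<exists>x\<ge>l. x \<le> u \<and> f x = 1 - lam / 2"
      using low up \<open>l < 0\<close> u D by (intro IVT) (auto intro: DERIV_isCont)
    then show ?thesis by blast
  qed
  have "\<exists>!k. f k = 1 - lam / 2"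
    using ex by (rule ex_ex1I) (metis mono linorder_less_linear less_irrefl)
  then show ?thesis by (simp add: f_def deriv_Phi)
qed

text \<open>One integration of a power bound from k. Iterating it gives the Taylor estimates at the
  free boundary; the factor 1 / (n + 1) is given away to keep the constant C.\<close>

lemma mvt_power_bound:
  fixes f f' :: "real \<Rightarrow> real"
  assumes "\<And>z. DERIV f z :> f' z" "\<And>z. \<bar>f' z\<bar> \<le> C * \<bar>z - k\<bar> ^ n" "f k = 0" "0 \<le> C"
  shows "\<bar>f z\<bar> \<le> C * \<bar>z - k\<bar> ^ Suc n"
proof (cases "z = k")
  case False
  obtain y where y: "\<bar>y - k\<bar> \<le> \<bar>z - k\<bar>" "f z - f k = (z - k) * f' y"
  proof (cases "k < z")
    case True
    from MVT2[OF this assms(1)] obtain y where "k < y" "y < z" "f z - f k = (z - k) * f' y" by blast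
    then show ?thesis by (intro that[of y]) auto
  next
    case False
    with \<open>z \<noteq> k\<close> have "z < k" by simp
    from MVT2[OF this assms(1)] obtain y where "z < y" "y < k" "f k - f z = (k - z) * f' y" by blast
    then show ?thesis by (intro that[of y]) (auto simp: algebra_simps)
  qed
  have "\<bar>f z\<bar> = \<bar>z - k\<bar> * \<bar>f' y\<bar>" using y assms by (simp add: abs_mult)
  also have "\<dots> \<le> \<bar>z - k\<bar> * (C * \<bar>z - k\<bar> ^ n)"
    using assms(2)[of y] y(1) assms(4) by (intro mult_left_mono order_trans[OF assms(2)] power_mono) auto
  finally show ?thesis by (simp add: ac_simps)
qed (use assms in simp)

lemma less_div_sqrt_iff: "0 < t \<Longrightarrow> k < x / sqrt t \<longleftrightarrow> k * sqrt t < x"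
  by (simp add: pos_less_divide_eq)

lemma square_div_sqrt: "0 < t \<Longrightarrow> t * (x / sqrt t - k)\<^sup>2 = (x - k * sqrt t)\<^sup>2"
proof -
  assume t: "0 < t"
  have "x / sqrt t - k = (x - k * sqrt t) / sqrt t" using t by (simp add: field_simps)
  then show ?thesis using t by (simp add: power_divide)
qed

section \<open>The self-similar density and its first two integrals\<close>

locale profile =
  fixes lam :: real
  assumes lam_pos: "0 < lam"
begin

abbreviation "\<kappa> \<equiv> kappa lam"
abbreviation "C1 \<equiv> c1 lam"
abbreviation "C2 \<equiv> c2 lam"

lemma kappa_eq: "\<kappa> * (1 - Phi \<kappa>) / phi \<kappa> = 1 - lam / 2"
  using theI'[OF kappa_exists1[OF lam_pos]] by (simp add: kappa_def deriv_Phi)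

lemma c1_mult: "C1 * (1 - Phi \<kappa>) = 2 - lam * Phi \<kappa>"
  and c2_mult: "C2 * (1 - Phi \<kappa>) = lam - 2"
  using Phi_less_1[of \<kappa>] by (simp_all add: c1_def c2_def)

text \<open>The density at the front is the value 2 for which half the second derivative of the
  profile equals the obstacle term 1. Multiplying by 1 - Phi(kappa) reduces the claim to the
  definitions of the two constants.\<close>

lemma density_at_kappa: "C1 + C2 * Phi \<kappa> = 2"
proof -
  have "(C1 + C2 * Phi \<kappa> - 2) * (1 - Phi \<kappa>) = 0"
    using c1_mult c2_mult by algebra
  then show ?thesis using Phi_less_1[of \<kappa>] by simp
qed

lemma density_at_infinity: "C1 + C2 = lam"
proof -
  have "(C1 + C2 - lam) * (1 - Phi \<kappa>) = 0"
    using c1_mult c2_mult by algebra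
  then show ?thesis using Phi_less_1[of \<kappa>] by simp
qed

text \<open>The defining equation of \<open>kappa\<close>, freed of its denominators. It says that
  the first integral \<open>mass\<close> vanishes at the front.\<close>

lemma flux_at_kappa: "2 * \<kappa> + C2 * phi \<kappa> = 0"
proof -
  have "2 * \<kappa> * (1 - Phi \<kappa>) = (2 - lam) * phi \<kappa>"
    using kappa_eq phi_pos[of \<kappa>] by (simp add: field_simps del: phi_pos)
  then have "(2 * \<kappa> + C2 * phi \<kappa>) * (1 - Phi \<kappa>) = 0"
    using c2_mult by algebra
  then show ?thesis using Phi_less_1[of \<kappa>] by simp
qed

definition dens :: "real \<Rightarrow> real" where
  "dens z = C1 + C2 * Phi z"

text \<open>The antiderivative of \<open>dens\<close> that vanishes at the front; z Phi z + phi z is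
  an antiderivative of \<open>Phi\<close>. The formula is used on both sides of the front.\<close>

definition mass :: "real \<Rightarrow> real" where
  "mass z = C1 * z + C2 * (z * Phi z + phi z)"

text \<open>The antiderivative of \<open>mass\<close>. The constant -1 makes it vanish at the front,
  and after scaling by t it becomes the term -t that accounts for the total drift.\<close>

definition area :: "real \<Rightarrow> real" where
  "area z = C1 * (z\<^sup>2 + 1) / 2 + C2 * ((z\<^sup>2 + 1) * Phi z + z * phi z) / 2 - 1"

definition dens_bound :: real where
  "dens_bound = \<bar>C1\<bar> + \<bar>C2\<bar>"

lemma mass_kappa: "mass \<kappa> = 0"
proof -
  have "mass \<kappa> = \<kappa> * (C1 + C2 * Phi \<kappa>) + C2 * phi \<kappa>"
    by (simp add: mass_def algebra_simps)
  then show ?thesis using flux_at_kappa by (simp add: density_at_kappa)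
qed

lemma area_kappa: "area \<kappa> = 0"
proof -
  have "area \<kappa> = (\<kappa>\<^sup>2 + 1) * (C1 + C2 * Phi \<kappa>) / 2 + \<kappa> * (C2 * phi \<kappa>) / 2 - 1"
    by (simp add: area_def field_simps)
  also have "C2 * phi \<kappa> = - 2 * \<kappa>" using flux_at_kappa by simp
  finally show ?thesis by (simp add: density_at_kappa power2_eq_square field_simps)
qed

lemma DERIV_mass: "DERIV mass z :> dens z"
  unfolding mass_def dens_def
  by (auto intro!: derivative_eq_intros DERIV_phi DERIV_Phi simp: algebra_simps)

lemma DERIV_area: "DERIV area z :> mass z"
  unfolding area_def mass_def
  by (rule derivative_eq_intros DERIV_phi DERIV_Phi refl | simp)+ (simp add: field_simps power2_eq_square)

lemma abs_dens_le: "\<bar>dens z\<bar> \<le> dens_bound"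
proof -
  have "\<bar>C2 * Phi z\<bar> \<le> \<bar>C2\<bar> * 1"
    unfolding abs_mult using Phi_pos[of z] Phi_less_1[of z] by (intro mult_left_mono) auto
  then show ?thesis unfolding dens_def dens_bound_def by linarith
qed

lemma dens_bound_nonneg: "0 \<le> dens_bound" by (simp add: dens_bound_def)

text \<open>The density is monotone, with value 2 at the front and limit lam at infinity.\<close>

lemma dens_ge: 
  assumes "\<kappa> \<le> z" shows "min 2 lam \<le> dens z"
proof (cases "0 \<le> C2")
  case True
  then have "C2 * Phi \<kappa> \<le> C2 * Phi z" using assms by (intro mult_left_mono Phi_mono)
  then show ?thesis using density_at_kappa by (simp add: dens_def)
next
  case False
  then have "C2 * 1 \<le> C2 * Phi z" using Phi_less_1[of z] by (intro mult_left_mono_neg) auto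
  then show ?thesis using density_at_infinity by (simp add: dens_def)
qed

lemma dens_pos: "\<kappa> \<le> z \<Longrightarrow> 0 < dens z"
  using dens_ge[of z] lam_pos by linarith

lemma abs_mass_le: "\<bar>mass z\<bar> \<le> dens_bound * \<bar>z - \<kappa>\<bar>"
  using mvt_power_bound[OF DERIV_mass, of dens_bound \<kappa> 0] abs_dens_le mass_kappa dens_bound_nonneg by simp

lemma abs_area_le: "\<bar>area z\<bar> \<le> dens_bound * (z - \<kappa>)\<^sup>2"
  using mvt_power_bound[OF DERIV_area, of dens_bound \<kappa> 1] abs_mass_le area_kappa dens_bound_nonneg
  by (simp add: numeral_2_eq_2)

text \<open>At the front the density is 2, so the area is (z - kappa)^2 up to a cubic error. The
  positive square beats the cubic error nearby, and completing the square leaves a fourth power.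
  Thus the continuation to the left of the front is negative only to fourth order, which a heat step
  of length h turns into order h^2.\<close>

lemma area_ge: "- (C2\<^sup>2 * (z - \<kappa>) ^ 4) \<le> area z"
proof -
  have 0: "\<bar>dens y - 2\<bar> \<le> \<bar>C2\<bar> * \<bar>y - \<kappa>\<bar> ^ 1" for y
  proof -
    have "\<bar>Phi y - Phi \<kappa>\<bar> \<le> 1 * \<bar>y - \<kappa>\<bar> ^ Suc 0"
    proof (rule mvt_power_bound)
      show "DERIV (\<lambda>z. Phi z - Phi \<kappa>) z :> phi z" for z
        by (auto intro!: derivative_eq_intros DERIV_Phi)
    qed (auto simp: phi_le_1)
    then have "\<bar>C2\<bar> * \<bar>Phi y - Phi \<kappa>\<bar> \<le> \<bar>C2\<bar> * \<bar>y - \<kappa>\<bar>" by (intro mult_left_mono) auto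
    moreover have "dens y - 2 = C2 * (Phi y - Phi \<kappa>)"
      using density_at_kappa by (simp add: dens_def algebra_simps)
    ultimately show ?thesis by (simp add: abs_mult)
  qed
  have 1: "\<bar>mass y - 2 * (y - \<kappa>)\<bar> \<le> \<bar>C2\<bar> * \<bar>y - \<kappa>\<bar> ^ 2" for y
  proof -
    have "\<bar>mass y - 2 * (y - \<kappa>)\<bar> \<le> \<bar>C2\<bar> * \<bar>y - \<kappa>\<bar> ^ Suc 1"
    proof (rule mvt_power_bound[OF _ 0])
      show "DERIV (\<lambda>y. mass y - 2 * (y - \<kappa>)) z :> dens z - 2" for z
        by (auto intro!: derivative_eq_intros DERIV_mass)
    qed (auto simp: mass_kappa)
    then show ?thesis by (simp add: numeral_2_eq_2)
  qed
  have "\<bar>area z - (z - \<kappa>)\<^sup>2\<bar> \<le> \<bar>C2\<bar> * \<bar>z - \<kappa>\<bar> ^ Suc 2"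
  proof (rule mvt_power_bound[OF _ 1])
    show "DERIV (\<lambda>y. area y - (y - \<kappa>)\<^sup>2) z :> mass z - 2 * (z - \<kappa>)" for z
      by (auto intro!: derivative_eq_intros DERIV_area)
  qed (auto simp: area_kappa)
  then have "(z - \<kappa>)\<^sup>2 - \<bar>C2\<bar> * \<bar>z - \<kappa>\<bar> ^ 3 \<le> area z" by (simp add: numeral_3_eq_3)
  moreover have "- (C2\<^sup>2 * (z - \<kappa>) ^ 4) \<le> (z - \<kappa>)\<^sup>2 - \<bar>C2\<bar> * \<bar>z - \<kappa>\<bar> ^ 3"
  proof -
    define y where "y = \<bar>z - \<kappa>\<bar>"
    define c where "c = \<bar>C2\<bar>"
    \<comment> \<open>The factor in brackets is 1 - c y + (c y)^2 with its square completed.\<close>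
    have "0 \<le> y\<^sup>2 * ((1 - c * y / 2)\<^sup>2 + 3 / 4 * (c * y)\<^sup>2)" by simp
    also have "\<dots> = y\<^sup>2 - c * y ^ 3 + c\<^sup>2 * y ^ 4"
      by (simp add: power2_eq_square power3_eq_cube power4_eq_xxxx field_simps)
    finally have "0 \<le> y\<^sup>2 - c * y ^ 3 + c\<^sup>2 * y ^ 4" .
    then show ?thesis by (simp add: y_def c_def power_even_abs)
  qed
  ultimately show ?thesis by linarith
qed

lemma mass_mono: "\<kappa> \<le> x \<Longrightarrow> x < y \<Longrightarrow> mass x < mass y"
  by (rule DERIV_pos_imp_increasing) (auto intro!: exI DERIV_mass dens_pos)

lemma mass_pos: "\<kappa> < z \<Longrightarrow> 0 < mass z"
  using mass_mono[of \<kappa> z] mass_kappa by simp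

lemma area_mono: 
  assumes "\<kappa> \<le> x" "x < y" shows "area x < area y"
proof -
  from MVT2[OF assms(2) DERIV_area] obtain z where "x < z" "z < y" "area y - area x = (y - x) * mass z" by blast
  moreover have "0 < (y - x) * mass z" using \<open>x < z\<close> assms by (intro mult_pos_pos mass_pos) auto
  ultimately show ?thesis by simp
qed

end

section \<open>The self-similar solution of the obstacle problem\<close>

lemma integrable_heat:
  assumes "0 < h" and [measurable]: "f \<in> borel_measurable borel" and f: "\<And>z. \<bar>f z\<bar> \<le> C * exp (c * \<bar>z\<bar>)" and "0 \<le> C" "0 \<le> c"
  shows "integrable (gauss h) (\<lambda>y. f (x - y) :: real)"
proof (rule Bochner_Integration.integrable_bound)
  show "integrable (gauss h) (\<lambda>y. C * exp (c * \<bar>x\<bar>) * exp (c * \<bar>y\<bar>))"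
    by (intro integrable_mult_right integrable_gauss_exp_abs assms)
  show "AE y in gauss h. norm (f (x - y)) \<le> norm (C * exp (c * \<bar>x\<bar>) * exp (c * \<bar>y\<bar>))"
  proof (intro AE_I2)
    fix y
    have "c * \<bar>x - y\<bar> \<le> c * (\<bar>x\<bar> + \<bar>y\<bar>)" using assms by (intro mult_left_mono) auto
    then have "exp (c * \<bar>x - y\<bar>) \<le> exp (c * \<bar>x\<bar>) * exp (c * \<bar>y\<bar>)"
      by (simp add: exp_add[symmetric] algebra_simps)
    then have "C * exp (c * \<bar>x - y\<bar>) \<le> C * (exp (c * \<bar>x\<bar>) * exp (c * \<bar>y\<bar>))"
      using assms by (intro mult_left_mono)
    then show "norm (f (x - y)) \<le> norm (C * exp (c * \<bar>x\<bar>) * exp (c * \<bar>y\<bar>))"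
      using order_trans[OF f[of "x - y"]] assms(4) by (simp add: abs_mult mult.assoc)
  qed
qed simp

lemma square_le_exp_abs: "z\<^sup>2 \<le> 2 * exp \<bar>z::real\<bar>"
  using exp_lower_Taylor_quadratic[of "\<bar>z\<bar>"] by simp

lemma integrable_heat_square: "0 < h \<Longrightarrow> integrable (gauss h) (\<lambda>y. (x - y)\<^sup>2)"
  using integrable_heat[of h "\<lambda>z. z\<^sup>2" 2 1 x] square_le_exp_abs by simp

lemma heat_square:
  assumes "0 < h" shows "heat h (\<lambda>z. z\<^sup>2) x = x\<^sup>2 + h"
proof -
  have "heat h (\<lambda>z. z\<^sup>2) x = (\<integral>y. x\<^sup>2 + y\<^sup>2 - 2 * x * y \<partial>gauss h)"
    by (simp add: heat_def power2_diff)
  then show ?thesis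
    using assms integrable_gauss_power[OF assms, of 2] integrable_gauss_ident[OF assms] 
      prob_space.finite_measure[OF prob_space_gauss[OF assms]]
    by (simp add: integral_gauss_ident integral_gauss_square finite_measure.integrable_const)
qed

section \<open>The initial profile under the heat operator, in closed form\<close>

definition half_square :: "real \<Rightarrow> real" where
  "half_square z = (pos_part z)\<^sup>2 / 2"

lemma measurable_half_square [measurable]: "half_square \<in> borel_measurable borel"
  unfolding half_square_def by measurable

lemma half_square_nonneg [simp]: "0 \<le> half_square z"
  by (simp add: half_square_def)

lemma half_square_le: "half_square z \<le> z\<^sup>2 / 2"
  by (simp add: half_square_def pos_part_def max_def)

lemma integrable_heat_half_square: "0 < h \<Longrightarrow> integrable (gauss h) (\<lambda>y. half_square (x - y))"
  by (rule Bochner_Integration.integrable_bound[OF integrable_heat_square[of h x]])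
    (auto intro!: order_trans[OF half_square_le])

text \<open>The integral runs over y < x, where the integrand is a polynomial times a Gaussian
  density with an explicit antiderivative.\<close>

lemma heat_half_square_eq:
  assumes "0 < t"
  shows "heat t half_square x = ((x\<^sup>2 + t) * Phi (x / sqrt t) + sqrt t * x * phi (x / sqrt t)) / 2"
proof -
  define r where "r = sqrt t"
  have r: "0 < r" "r\<^sup>2 = t" using assms by (auto simp: r_def)
  define p where "p y = phi (y / r) / r" for y
  have p: "normal_density 0 r y = p y" for y
    using r by (simp add: normal_density_def p_def real_sqrt_mult power_divide mult.commute r_def[symmetric])
  \<comment> \<open>The antiderivative of f, found by integrating by parts with p' = -(y / t) p. It
    vanishes at minus infinity and has the claimed value at y = x.\<close>
  define F where "F y = ((x\<^sup>2 + t) * Phi (y / r) + t * (2 * x - y) * p y) / 2" for y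
  define f where "f y = p y * (x - y)\<^sup>2 / 2" for y
  have D: "DERIV F y :> f y" for y
  proof -
    have d: "DERIV (\<lambda>y. y / r) y :> 1 / r"
      using r(1) by (auto intro!: derivative_eq_intros)
    have DPhi: "DERIV (\<lambda>y. Phi (y / r)) y :> p y"
      unfolding p_def using DERIV_chain2[OF DERIV_Phi d] by simp
    have "DERIV (\<lambda>y. phi (y / r)) y :> - (y / r) * phi (y / r) * (1 / r)"
      by (rule DERIV_chain2[OF DERIV_phi d])
    then have Dp: "DERIV p y :> - (y / t) * p y"
      unfolding p_def[abs_def] r(2)[symmetric]
      by (rule DERIV_cdivide[THEN DERIV_cong]) (simp add: power2_eq_square)
    have "DERIV F y :> ((x\<^sup>2 + t) * p y + (t * (- 1) * p y + t * (2 * x - y) * (- (y / t) * p y))) / 2" (is "DERIV F y :> ?d")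
      unfolding F_def by (rule derivative_eq_intros DPhi Dp refl | simp)+
    moreover have "?d = f y"
      using assms by (simp add: f_def) (simp add: algebra_simps power2_eq_square)
    ultimately show ?thesis by simp
  qed
  have cont: "isCont f y" for y
    unfolding f_def p_def by (intro continuous_intros isCont_o2[OF _ continuous_phi]) (use r in auto)
  have Fbot: "(F \<longlongrightarrow> ((x\<^sup>2 + t) * 0 + 0) / 2) at_bot"
    unfolding F_def
  proof (intro tendsto_intros)
    show "((\<lambda>y. Phi (y / r)) \<longlongrightarrow> 0) at_bot"
      by (rule filterlim_compose[OF Phi_at_bot]) (use r in real_asymp)
    show "((\<lambda>y. t * (2 * x - y) * p y) \<longlongrightarrow> 0) at_bot"
      unfolding p_def std_normal_density_def using r assms by real_asymp
  qed simp
  have A: "((F \<circ> real_of_ereal) \<longlongrightarrow> 0) (at_right (-\<infinity>))"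
    using Fbot by (simp add: ereal_tendsto_simps1)
  have B: "((F \<circ> real_of_ereal) \<longlongrightarrow> F x) (at_left (ereal x))"
    unfolding ereal_tendsto_simps1 using D[of x]
    by (meson DERIV_isCont isCont_def tendsto_within_subset subset_UNIV)
  note FTC = interval_integral_FTC_nonneg[of "-\<infinity>" "ereal x" F f, OF _ D cont _ A B]
  have "heat t half_square x = (\<integral>y. p y * half_square (x - y) \<partial>lborel)"
    unfolding heat_def by (subst integral_gauss) (simp_all add: p[symmetric] r_def)
  also have "\<dots> = (LBINT y=-\<infinity>..ereal x. f y)"
    by (subst interval_integral_to_infinity_eq interval_lebesgue_integral_le_eq, simp)
      (auto simp: set_lebesgue_integral_def einterval_iff f_def half_square_def pos_part_def indicator_def intro!: Bochner_Integration.integral_cong)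
  also have "\<dots> = F x"
    using r by (subst FTC(2)) (auto simp: f_def p_def zero_ereal_def[symmetric])
  also have "F x = ((x\<^sup>2 + t) * Phi (x / sqrt t) + sqrt t * x * phi (x / sqrt t)) / 2"
  proof -
    have "t / r = r" using r by (simp add: field_simps power2_eq_square)
    have "t * (2 * x - x) * p x = (t / r) * x * phi (x / r)"
      by (simp add: p_def)
    then show ?thesis by (simp add: F_def r_def[symmetric] \<open>t / r = r\<close>)
  qed
  finally show ?thesis .
qed

text \<open>Time 0 is a separate case because \<open>gauss 0\<close> is the zero measure and not the
  point mass at 0.\<close>

definition quad_heat :: "real \<Rightarrow> real \<Rightarrow> real" where
  "quad_heat t x = (if t = 0 then half_square x else heat t half_square x)"

lemma measurable_quad_heat [measurable]: "0 \<le> t \<Longrightarrow> quad_heat t \<in> borel_measurable borel"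
  by (cases "t = 0") (simp_all add: quad_heat_def[abs_def] heat_half_square_eq order.strict_iff_order)

lemma quad_heat_nonneg: "0 \<le> quad_heat t x"
  by (simp add: quad_heat_def heat_def)

lemma quad_heat_le:
  assumes "0 \<le> t" shows "quad_heat t x \<le> (x\<^sup>2 + t) / 2"
proof (cases "t = 0")
  case False
  with assms have t: "0 < t" by simp
  have "heat t half_square x \<le> (\<integral>y. (x - y)\<^sup>2 / 2 \<partial>gauss t)"
    unfolding heat_def using t 
    by (intro integral_mono integrable_heat_half_square half_square_le integrable_divide integrable_heat_square)
  also have "\<dots> = (x\<^sup>2 + t) / 2" using heat_square[OF t, of x] by (simp add: heat_def)
  finally show ?thesis using t by (simp add: quad_heat_def)
qed (use half_square_le[of x] in \<open>simp add: quad_heat_def\<close>)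

lemma integrable_heat_quad_heat: 
  assumes "0 < h" "0 \<le> t" shows "integrable (gauss h) (\<lambda>y. quad_heat t (x - y))"
proof (rule Bochner_Integration.integrable_bound)
  interpret prob_space "gauss h" by (rule prob_space_gauss) fact
  show "integrable (gauss h) (\<lambda>y. ((x - y)\<^sup>2 + t) / 2)"
    using assms by (auto intro!: integrable_heat_square)
  show "AE y in gauss h. norm (quad_heat t (x - y)) \<le> norm (((x - y)\<^sup>2 + t) / 2)"
    using quad_heat_nonneg quad_heat_le[OF assms(2)] assms by (intro AE_I2) (simp add: abs_of_nonneg)
qed (use assms in measurable)

text \<open>The semigroup law. Both sides are nonnegative, so the computation is carried out with
  nonnegative integrals and transferred back at the end.\<close>

lemma heat_quad_heat:
  assumes "0 < h" "0 \<le> t"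
  shows "heat h (quad_heat t) x = quad_heat (t + h) x"
proof (cases "t = 0")
  case True
  then show ?thesis using assms by (simp add: quad_heat_def[abs_def])
next
  case False
  with assms have t: "0 < t" by simp
  have q: "ennreal (quad_heat s u) = (\<integral>\<^sup>+z. ennreal (half_square (u - z)) \<partial>gauss s)" if "0 < s" for s u
    using that by (simp add: quad_heat_def heat_def nn_integral_eq_integral[OF integrable_heat_half_square[OF that]])
  have "ennreal (heat h (quad_heat t) x) = (\<integral>\<^sup>+y. ennreal (quad_heat t (x - y)) \<partial>gauss h)"
    unfolding heat_def by (rule nn_integral_eq_integral[symmetric]) (auto intro!: integrable_heat_quad_heat assms quad_heat_nonneg)
  also have "\<dots> = (\<integral>\<^sup>+y. \<integral>\<^sup>+z. ennreal (half_square (x - (y + z))) \<partial>gauss t \<partial>gauss h)"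
    by (simp add: q[OF t] diff_diff_eq)
  also have "\<dots> = (\<integral>\<^sup>+y. ennreal (half_square (x - y)) \<partial>gauss (h + t))"
    using assms t by (intro nn_integral_gauss_gauss) auto
  also have "\<dots> = ennreal (quad_heat (t + h) x)"
    using t assms by (simp add: q add.commute)
  finally show ?thesis
    by (rule ennreal_inj[THEN iffD1, rotated 2]) (auto simp: heat_def quad_heat_nonneg)
qed

context profile
begin

text \<open>The smooth continuation of the solution to the left of the free boundary, on which the heat
  operator acts exactly.\<close>

definition ext_area :: "real \<Rightarrow> real \<Rightarrow> real" where
  "ext_area t x = C1 * (x\<^sup>2 + t) / 2 + C2 * quad_heat t x - t"

text \<open>Brownian scaling: every estimate at a positive time reduces to one for the fixed
  function \<open>area\<close>.\<close>

lemma ext_area_eq: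
  assumes "0 < t" shows "ext_area t x = t * area (x / sqrt t)"
proof -
  define r where "r = sqrt t"
  have r: "0 < r" "t = r\<^sup>2" using assms by (auto simp: r_def)
  show ?thesis
    using assms r(1) unfolding ext_area_def quad_heat_def area_def
    by (simp add: heat_half_square_eq r_def[symmetric]) (simp add: r(2) field_simps power2_eq_square)
qed

lemma measurable_ext_area [measurable]: "0 \<le> t \<Longrightarrow> ext_area t \<in> borel_measurable borel"
  unfolding ext_area_def[abs_def] by measurable

lemma integrable_heat_ext_area:
  assumes "0 < h" "0 \<le> t" shows "integrable (gauss h) (\<lambda>y. ext_area t (x - y))"
proof -
  interpret prob_space "gauss h" by (rule prob_space_gauss) fact
  show ?thesis
    unfolding ext_area_def using integrable_heat_square[OF assms(1), of x] integrable_heat_quad_heat[OF assms, of x]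
    by simp
qed

text \<open>The terms with coefficients \<open>C1\<close> and \<open>C2\<close> solve the heat
  equation; the term -t does not see the heat operator, and its decrease by h is compensated by the
  summand h.\<close>

lemma heat_ext_area:
  assumes "0 < h" "0 \<le> t" shows "heat h (ext_area t) x = ext_area (t + h) x + h"
proof -
  interpret prob_space "gauss h" by (rule prob_space_gauss) fact
  have "heat h (ext_area t) x = C1 * (heat h (\<lambda>z. z\<^sup>2) x + t) / 2 + C2 * heat h (quad_heat t) x - t"
    unfolding heat_def ext_area_def using assms integrable_heat_square[OF assms(1), of x] integrable_heat_quad_heat[OF assms, of x]
    by simp
  then show ?thesis
    using assms by (simp add: heat_square heat_quad_heat ext_area_def algebra_simps)
qed

definition Astar :: "real \<Rightarrow> real \<Rightarrow> real" where
  "Astar t x = (if \<kappa> * sqrt t < x then ext_area t x else 0)"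

lemma measurable_Astar [measurable]: "0 \<le> t \<Longrightarrow> Astar t \<in> borel_measurable borel"
  unfolding Astar_def[abs_def] by measurable

lemma Astar_0: "Astar 0 x = lam * half_square x"
proof (cases "0 < x")
  case True
  have "C1 * x\<^sup>2 / 2 + C2 * (x\<^sup>2 / 2) = (C1 + C2) * (x\<^sup>2 / 2)" by algebra
  then show ?thesis
    using True by (simp add: density_at_infinity Astar_def ext_area_def quad_heat_def half_square_def pos_part_def)
qed (simp add: Astar_def half_square_def pos_part_def)

lemma Astar_nonneg: 
  assumes "0 \<le> t" shows "0 \<le> Astar t x"
proof (cases "t = 0")
  case True
  then show ?thesis using lam_pos by (simp add: Astar_0)
next
  case False
  with assms have t: "0 < t" by simp
  have "0 < area (x / sqrt t)" if "\<kappa> * sqrt t < x"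
    using area_mono[of \<kappa> "x / sqrt t"] area_kappa that t by (simp add: less_div_sqrt_iff)
  then show ?thesis using t by (auto simp: Astar_def ext_area_eq)
qed

lemma Astar_mono:
  assumes "0 \<le> t" "x \<le> y" shows "Astar t x \<le> Astar t y"
proof (cases "t = 0")
  case True
  then show ?thesis using lam_pos assms pos_part_mono[OF assms(2)] by (auto simp: Astar_0 half_square_def intro!: power_mono)
next
  case False
  with assms have t: "0 < t" by simp
  show ?thesis
  proof (cases "\<kappa> * sqrt t < x \<and> x < y")
    case True
    then have "\<kappa> \<le> x / sqrt t" "x / sqrt t < y / sqrt t"
      using t by (auto simp: divide_strict_right_mono pos_le_divide_eq)
    from area_mono[OF this] True t show ?thesis by (simp add: Astar_def ext_area_eq)
  next
    case False
    then show ?thesis using Astar_nonneg[OF assms(1), of y] assms(2) by (cases "x = y") (auto simp: Astar_def)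
  qed
qed

lemma abs_ext_area_le:
  assumes "0 < t" shows "\<bar>ext_area t x\<bar> \<le> dens_bound * (x - \<kappa> * sqrt t)\<^sup>2"
proof -
  have "\<bar>ext_area t x\<bar> \<le> t * (dens_bound * (x / sqrt t - \<kappa>)\<^sup>2)"
    using assms abs_area_le[of "x / sqrt t"] by (simp add: ext_area_eq abs_mult)
  also have "\<dots> = dens_bound * (t * (x / sqrt t - \<kappa>)\<^sup>2)" by simp
  finally show ?thesis unfolding square_div_sqrt[OF assms, of x \<kappa>] .
qed

lemma Astar_le:
  assumes "0 \<le> t" shows "Astar t x \<le> dens_bound * (pos_part (x - \<kappa> * sqrt t))\<^sup>2"
proof (cases "t = 0")
  case True
  have "lam / 2 \<le> dens_bound" using lam_pos density_at_infinity unfolding dens_bound_def by linarith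
  then have "lam / 2 * (pos_part x)\<^sup>2 \<le> dens_bound * (pos_part x)\<^sup>2" by (intro mult_right_mono) auto
  then show ?thesis using True by (simp add: Astar_0 half_square_def)
next
  case False
  with assms have t: "0 < t" by simp
  show ?thesis using abs_ext_area_le[OF t, of x] dens_bound_nonneg by (auto simp: Astar_def pos_part_def)
qed

lemma Astar_le_exp:
  assumes "0 \<le> t" "t \<le> 1" shows "Astar t x \<le> 2 * dens_bound * exp \<bar>\<kappa>\<bar> * exp x"
proof -
  have "\<bar>\<kappa>\<bar> * sqrt t \<le> \<bar>\<kappa>\<bar> * 1" using assms by (intro mult_left_mono) auto
  then have "- (\<kappa> * sqrt t) \<le> \<bar>\<kappa>\<bar>" using assms abs_ge_minus_self[of "\<kappa> * sqrt t"] by (simp add: abs_mult)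
  have "Astar t x \<le> dens_bound * (2 * exp (x - \<kappa> * sqrt t))"
    using Astar_le[OF assms(1), of x] pos_part_square_le_exp[of "x - \<kappa> * sqrt t"] dens_bound_nonneg
    by (meson mult_left_mono order_trans)
  also have "\<dots> \<le> dens_bound * (2 * exp (x + \<bar>\<kappa>\<bar>))"
    using \<open>- (\<kappa> * sqrt t) \<le> \<bar>\<kappa>\<bar>\<close> dens_bound_nonneg by (intro mult_left_mono) auto
  finally show ?thesis by (simp add: exp_add ac_simps)
qed

lemma integrable_heat_Astar:
  assumes "0 < h" "0 \<le> t" "t \<le> 1" shows "integrable (gauss h) (\<lambda>y. Astar t (x - y))"
proof (rule integrable_heat[where c = 1 and C = "2 * dens_bound * exp \<bar>\<kappa>\<bar>"])
  show "\<bar>Astar t z\<bar> \<le> 2 * dens_bound * exp \<bar>\<kappa>\<bar> * exp (1 * \<bar>z\<bar>)" for z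
  proof -
    have "2 * dens_bound * exp \<bar>\<kappa>\<bar> * exp z \<le> 2 * dens_bound * exp \<bar>\<kappa>\<bar> * exp \<bar>z\<bar>"
      using dens_bound_nonneg by (intro mult_left_mono) auto
    then show ?thesis using Astar_le_exp[OF assms(2,3), of z] Astar_nonneg[OF assms(2), of z] by simp
  qed
qed (use assms dens_bound_nonneg in auto)

lemma heat_Astar_mono:
  assumes "0 < h" "0 \<le> t" "t \<le> 1" "x \<le> y" shows "heat h (Astar t) x \<le> heat h (Astar t) y"
  unfolding heat_def by (intro integral_mono integrable_heat_Astar assms Astar_mono) (use assms in auto)

end

section \<open>One-step inequalities for the exact solution\<close>

lemma sqrt_add_diff_le:
  assumes "0 < t" "0 \<le> h" shows "sqrt (t + h) - sqrt t \<le> h / sqrt t"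
proof -
  have "(sqrt (t + h) - sqrt t) * sqrt t \<le> (sqrt (t + h) - sqrt t) * (sqrt (t + h) + sqrt t)"
    using assms by (intro mult_left_mono) auto
  also have "\<dots> = h" using assms by (simp add: algebra_simps)
  finally show ?thesis using assms by (simp add: pos_le_divide_eq)
qed

lemma sqrt_add_diff_le_sqrt: "0 \<le> t \<Longrightarrow> 0 \<le> h \<Longrightarrow> sqrt (t + h) - sqrt t \<le> sqrt h"
  using sqrt_add_le_add_sqrt[of t h] by simp

lemma power2_add_le: "(a + b)\<^sup>2 \<le> 2 * (a\<^sup>2 + b\<^sup>2 :: real)"
  using zero_le_power2[of "a - b"] by (simp add: power2_eq_square algebra_simps)

lemma power4_add_le: "(a + b) ^ 4 \<le> 8 * (a ^ 4 + b ^ 4 :: real)"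
proof -
  have "(a + b) ^ 4 = ((a + b)\<^sup>2)\<^sup>2" by simp
  also have "\<dots> \<le> (2 * (a\<^sup>2 + b\<^sup>2))\<^sup>2" by (intro power_mono power2_add_le) auto
  also have "\<dots> = 4 * (a\<^sup>2 + b\<^sup>2)\<^sup>2" by (simp only: power_mult_distrib) simp
  also have "\<dots> \<le> 4 * (2 * ((a\<^sup>2)\<^sup>2 + (b\<^sup>2)\<^sup>2))" by (intro mult_left_mono power2_add_le) auto
  finally show ?thesis by simp
qed

context profile
begin

lemma kappa_sqrt_diff:
  assumes "0 \<le> t" "0 \<le> h" "sqrt (t + h) - sqrt t \<le> d"
  shows "\<bar>\<kappa> * sqrt (t + h) - \<kappa> * sqrt t\<bar> \<le> \<bar>\<kappa>\<bar> * d"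
proof -
  have "\<bar>\<kappa> * (sqrt (t + h) - sqrt t)\<bar> \<le> \<bar>\<kappa>\<bar> * d"
    unfolding abs_mult using assms by (intro mult_left_mono) auto
  then show ?thesis by (simp add: right_diff_distrib)
qed

text \<open>The factor 8 comes from \<open>power4_add_le\<close>, 3 from the Gaussian fourth moment,
  and kappa^4 from the motion of the front during the step.\<close>

definition lower_const :: real where
  "lower_const = 8 * C2\<^sup>2 * (3 + \<kappa> ^ 4)"

text \<open>\<open>Astar\<close> exceeds its continuation \<open>ext_area\<close> only to the left
  of the front, and there by at most a fourth power (\<open>area_ge\<close>); on
  \<open>ext_area\<close> the heat operator acts exactly. The resulting error h^2 / t becomes a
  harmonic sum times h along the grid, which still tends to 0.\<close>

lemma Astar_step_lower:
  assumes "0 < h" "h \<le> t" "t \<le> 1"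
  shows "heat h (Astar t) x - h \<le> Astar (t + h) x + lower_const * h\<^sup>2 / t"
proof -
  interpret prob_space "gauss h" by (rule prob_space_gauss) fact
  have t: "0 < t" using assms by simp
  define e where "e = \<kappa> * sqrt t"
  \<comment> \<open>To the left of the new front the right-hand profile is 0 and the heated profile
    is increasing, so the estimate is only needed from the new front on.\<close>
  define x' where "x' = max x (\<kappa> * sqrt (t + h))"
  define d where "d = \<bar>\<kappa>\<bar> * (h / sqrt t)"
  have ed: "e - x' \<le> d"
    using kappa_sqrt_diff[of t h "h / sqrt t"] sqrt_add_diff_le[OF t, of h] assms
    unfolding e_def x'_def d_def by linarith
  have "d ^ 4 = \<kappa> ^ 4 * (h\<^sup>2 * (h\<^sup>2 / t\<^sup>2))"
  proof -
    have "sqrt t ^ 4 = t\<^sup>2" using t by (metis power_even_eq numeral_Bit0 mult_2 real_sqrt_pow2 less_imp_le power_add power2_eq_square)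
    then show ?thesis by (simp add: d_def power_mult_distrib power_divide power_even_abs power4_eq_xxxx power2_eq_square)
  qed
  \<comment> \<open>Here h \<le> t is used: it lets the displacement of the front be counted as a
    diffusive displacement.\<close>
  also have "\<dots> \<le> \<kappa> ^ 4 * (h\<^sup>2 * 1)"
    using assms t by (intro mult_left_mono) (auto simp: divide_le_eq_1 power_mono)
  finally have d4: "d ^ 4 \<le> \<kappa> ^ 4 * h\<^sup>2" by simp
  have pw: "Astar t (x' - y) \<le> ext_area t (x' - y) + C2\<^sup>2 / t * (8 * (y ^ 4 + d ^ 4))" for y
  proof (cases "e < x' - y")
    case True
    then show ?thesis using t by (simp add: Astar_def e_def)
  next
    case False
    let ?z = "x' - y"
    have "t * (C2\<^sup>2 * (?z / sqrt t - \<kappa>) ^ 4) = C2\<^sup>2 / t * (t * (?z / sqrt t - \<kappa>)\<^sup>2)\<^sup>2"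
      using t by (simp add: power2_eq_square power4_eq_xxxx)
    also have "\<dots> = C2\<^sup>2 / t * (e - ?z) ^ 4"
      unfolding square_div_sqrt[OF t] e_def[symmetric] power2_commute[of "x' - y" e] by simp
    also have "\<dots> \<le> C2\<^sup>2 / t * (8 * (y ^ 4 + d ^ 4))"
    proof (intro mult_left_mono)
      have "(e - ?z) ^ 4 \<le> (\<bar>y\<bar> + d) ^ 4"
        using False ed by (intro power_mono) (auto simp: abs_if)
      also have "\<dots> \<le> 8 * (y ^ 4 + d ^ 4)" using power4_add_le[of "\<bar>y\<bar>" d] by (simp add: power_even_abs)
      finally show "(e - ?z) ^ 4 \<le> 8 * (y ^ 4 + d ^ 4)" .
    qed (use t in auto)
    finally have "t * (C2\<^sup>2 * (?z / sqrt t - \<kappa>) ^ 4) \<le> C2\<^sup>2 / t * (8 * (y ^ 4 + d ^ 4))" .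
    moreover have "- (t * (C2\<^sup>2 * (?z / sqrt t - \<kappa>) ^ 4)) \<le> ext_area t ?z"
      using mult_left_mono[OF area_ge[of "?z / sqrt t"], of t] t by (simp add: ext_area_eq)
    moreover have "Astar t ?z = 0" using False by (simp add: Astar_def e_def)
    ultimately show ?thesis by linarith
  qed
  have "heat h (Astar t) x \<le> heat h (Astar t) x'"
    using assms by (intro heat_Astar_mono) (auto simp: x'_def)
  also have "\<dots> \<le> (\<integral>y. ext_area t (x' - y) + C2\<^sup>2 / t * (8 * (y ^ 4 + d ^ 4)) \<partial>gauss h)"
    unfolding heat_def using assms t integrable_gauss_power[OF assms(1), of 4]
    by (intro integral_mono integrable_heat_Astar pw integrable_heat_ext_area Bochner_Integration.integrable_add integrable_mult_right) auto
  also have "\<dots> = heat h (ext_area t) x' + C2\<^sup>2 / t * (8 * (3 * h\<^sup>2 + d ^ 4))"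
    using assms t integrable_gauss_power[OF assms(1), of 4] integrable_heat_ext_area[OF assms(1), of t x']
    by (simp add: heat_def integral_gauss_fourth)
  also have "\<dots> \<le> ext_area (t + h) x' + h + C2\<^sup>2 / t * (8 * (3 * h\<^sup>2 + \<kappa> ^ 4 * h\<^sup>2))"
  proof -
    have "C2\<^sup>2 / t * (8 * (3 * h\<^sup>2 + d ^ 4)) \<le> C2\<^sup>2 / t * (8 * (3 * h\<^sup>2 + \<kappa> ^ 4 * h\<^sup>2))"
      using d4 t by (intro mult_left_mono add_left_mono) auto
    then show ?thesis using assms t by (simp only: heat_ext_area less_imp_le)
  qed
  also have "C2\<^sup>2 / t * (8 * (3 * h\<^sup>2 + \<kappa> ^ 4 * h\<^sup>2)) = lower_const * h\<^sup>2 / t"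
    by (simp add: lower_const_def algebra_simps add_divide_distrib)
  also have "ext_area (t + h) x' \<le> Astar (t + h) x"
  proof (cases "\<kappa> * sqrt (t + h) < x")
    case True
    then show ?thesis by (simp add: Astar_def x'_def)
  next
    case False
    then have "x' = \<kappa> * sqrt (t + h)" by (simp add: x'_def)
    then have "ext_area (t + h) x' = 0" using t assms by (simp add: ext_area_eq area_kappa)
    then show ?thesis using Astar_nonneg[of "t + h"] t assms by simp
  qed
  finally show ?thesis by simp
qed

text \<open>Within distance a of the new front \<open>Astar\<close> is at most
  \<open>dens_bound\<close> times a^2, which is the second argument of the maximum. Farther to the
  right, \<open>ext_area\<close> exceeds \<open>Astar\<close> only for Gaussian displacements of at
  least a / 2. The condition on a keeps the motion of the front during the step below a / 2.\<close>

lemma Astar_step_upper: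
  assumes "0 < h" "h \<le> t" "t \<le> 1" "0 < a" "2 * \<bar>\<kappa>\<bar> * sqrt h \<le> a"
  shows "Astar (t + h) x \<le> max (heat h (Astar t) x - h) (dens_bound * a\<^sup>2) + 12 * dens_bound * h\<^sup>2 / a\<^sup>2"
proof (cases "x \<le> \<kappa> * sqrt (t + h) + a")
  case True
  have "Astar (t + h) x \<le> dens_bound * (pos_part (x - \<kappa> * sqrt (t + h)))\<^sup>2"
    using assms by (intro Astar_le) auto
  also have "\<dots> \<le> dens_bound * a\<^sup>2"
    using True assms dens_bound_nonneg by (intro mult_left_mono power_mono) (auto simp: pos_part_def)
  finally have "Astar (t + h) x \<le> dens_bound * a\<^sup>2" .
  moreover have "0 \<le> 12 * dens_bound * h\<^sup>2 / a\<^sup>2" using dens_bound_nonneg by simp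
  ultimately show ?thesis by linarith
next
  case False
  interpret prob_space "gauss h" by (rule prob_space_gauss) fact
  have t: "0 < t" using assms by simp
  define e where "e = \<kappa> * sqrt t"
  have xe: "a / 2 \<le> x - e"
    using kappa_sqrt_diff[of t h "sqrt h"] sqrt_add_diff_le_sqrt[of t h] assms False t
    unfolding e_def by linarith
  have pw: "ext_area t (x - y) \<le> Astar t (x - y) + 4 * dens_bound / a\<^sup>2 * y ^ 4" for y
  proof (cases "e < x - y")
    case True
    then show ?thesis using dens_bound_nonneg by (simp add: Astar_def e_def)
  next
    case F: False
    with xe have y: "a / 2 \<le> y" "e - (x - y) \<le> y" using assms by auto
    have "(a / 2)\<^sup>2 \<le> y\<^sup>2" using y assms by (intro power_mono) auto
    \<comment> \<open>This additional factor, at least 1, turns a second moment of order h into a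
      fourth moment of order h^2; with 3 h^2 for the fourth moment it yields the constant
      12.\<close>
    then have ay: "1 \<le> 4 * y\<^sup>2 / a\<^sup>2" using assms by (simp add: power_divide field_simps)
    have "ext_area t (x - y) \<le> dens_bound * (x - y - e)\<^sup>2"
      using abs_ext_area_le[OF t, of "x - y"] by (simp add: e_def)
    also have "\<dots> \<le> dens_bound * (y\<^sup>2 * (4 * y\<^sup>2 / a\<^sup>2))"
    proof (intro mult_left_mono dens_bound_nonneg)
      have "(x - y - e)\<^sup>2 \<le> y\<^sup>2"
        using F y power_mono[of "e - (x - y)" y 2] by (simp add: power2_commute[of "x - y"])
      also have "y\<^sup>2 * 1 \<le> y\<^sup>2 * (4 * y\<^sup>2 / a\<^sup>2)" using ay by (intro mult_left_mono) auto
      finally show "(x - y - e)\<^sup>2 \<le> y\<^sup>2 * (4 * y\<^sup>2 / a\<^sup>2)" by simp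
    qed
    also have "\<dots> = 4 * dens_bound / a\<^sup>2 * y ^ 4" by (simp add: power2_eq_square power4_eq_xxxx)
    finally show ?thesis using Astar_nonneg[of t "x - y"] t by simp
  qed
  have "0 < sqrt (t + h)" using t assms by simp
  have "Astar (t + h) x = heat h (ext_area t) x - h"
    using False assms t by (simp add: Astar_def heat_ext_area)
  also have "heat h (ext_area t) x \<le> (\<integral>y. Astar t (x - y) + 4 * dens_bound / a\<^sup>2 * y ^ 4 \<partial>gauss h)"
    unfolding heat_def using assms t integrable_gauss_power[OF assms(1), of 4]
    by (intro integral_mono integrable_heat_Astar pw integrable_heat_ext_area Bochner_Integration.integrable_add integrable_mult_right) auto
  also have "\<dots> = heat h (Astar t) x + 12 * dens_bound * h\<^sup>2 / a\<^sup>2"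
    using assms t integrable_gauss_power[OF assms(1), of 4] integrable_heat_Astar[OF assms(1), of t x]
    by (simp add: heat_def integral_gauss_fourth)
  finally show ?thesis by linarith
qed

definition init_const :: real where
  "init_const = (\<bar>C1\<bar> + lam) * (1 + \<kappa>\<^sup>2) + 1"

text \<open>The two preceding step estimates require h \<le> t and do not cover the start at time 0.
  Left of the front the heated quadratic is itself of order h. Right of it, the full quadratic minus
  the heated half quadratic is the heated half quadratic of the reflected argument, again of order
  h. An error of order h is affordable once.\<close>

lemma Astar_initial_step:
  assumes "0 < h"
  shows "\<bar>Astar h x - heat h (Astar 0) x\<bar> \<le> init_const * h"
proof -
  interpret prob_space "gauss h" by (rule prob_space_gauss) fact
  have q: "heat h (Astar 0) x = lam * quad_heat h x"
    using assms by (simp add: heat_def Astar_0[abs_def] quad_heat_def)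
  \<comment> \<open>The sign s treats both sides of the front: s = 1 on the left, and s = -1, the
    reflected half square, on the right.\<close>
  have bound: "(\<integral>y. half_square (s * (x - y)) \<partial>gauss h) \<le> (1 + \<kappa>\<^sup>2) * h"
    if "s * x \<le> \<bar>\<kappa>\<bar> * sqrt h" "\<bar>s\<bar> = 1" for s
  proof -
    have pw: "half_square (s * (x - y)) \<le> y\<^sup>2 + \<kappa>\<^sup>2 * h" for y
    proof -
      have "s * (x - y) \<le> \<bar>y\<bar> + \<bar>\<kappa>\<bar> * sqrt h"
        using that abs_ge_minus_self[of "s * y"] by (simp add: abs_mult right_diff_distrib)
      then have "pos_part (s * (x - y)) \<le> \<bar>y\<bar> + \<bar>\<kappa>\<bar> * sqrt h"
        using assms by (simp add: pos_part_def)
      then have "(pos_part (s * (x - y)))\<^sup>2 \<le> (\<bar>y\<bar> + \<bar>\<kappa>\<bar> * sqrt h)\<^sup>2"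
        by (intro power_mono) auto
      also have "\<dots> \<le> 2 * (y\<^sup>2 + \<kappa>\<^sup>2 * h)"
        using power2_add_le[of "\<bar>y\<bar>" "\<bar>\<kappa>\<bar> * sqrt h"] assms by (simp add: power_mult_distrib)
      finally show ?thesis by (simp add: half_square_def)
    qed
    have "(\<integral>y. half_square (s * (x - y)) \<partial>gauss h) \<le> (\<integral>y. y\<^sup>2 + \<kappa>\<^sup>2 * h \<partial>gauss h)"
    proof (rule integral_mono_AE')
      show "integrable (gauss h) (\<lambda>y. y\<^sup>2 + \<kappa>\<^sup>2 * h)"
        using integrable_gauss_power[OF assms] by simp
    qed (use pw assms in auto)
    also have "\<dots> = h + \<kappa>\<^sup>2 * h"
      using integrable_gauss_power[OF assms] assms by (simp add: integral_gauss_square)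
    finally show ?thesis by (simp add: algebra_simps)
  qed
  have K: "\<bar>\<kappa> * sqrt h\<bar> = \<bar>\<kappa>\<bar> * sqrt h" using assms by (simp add: abs_mult)
  show ?thesis
  proof (cases "\<kappa> * sqrt h < x")
    case True
    have "(\<integral>y. half_square (- 1 * (x - y)) \<partial>gauss h) \<le> (1 + \<kappa>\<^sup>2) * h"
      using True K by (intro bound) auto
    also have "(\<integral>y. half_square (- 1 * (x - y)) \<partial>gauss h) = (\<integral>y. (x - y)\<^sup>2 / 2 - half_square (x - y) \<partial>gauss h)"
      by (intro Bochner_Integration.integral_cong) (auto simp: half_square_def pos_part_def max_def power2_commute)
    also have "\<dots> = heat h (\<lambda>z. z\<^sup>2) x / 2 - quad_heat h x"
      using assms integrable_heat_square[OF assms, of x] integrable_heat_half_square[OF assms, of x]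
      by (simp add: heat_def quad_heat_def)
    finally have *: "(x\<^sup>2 + h) / 2 - quad_heat h x \<le> (1 + \<kappa>\<^sup>2) * h"
      using assms by (simp add: heat_square)
    have "Astar h x - heat h (Astar 0) x = C1 * ((x\<^sup>2 + h) / 2 - quad_heat h x) - h"
    proof -
      have "lam * quad_heat h x = C1 * quad_heat h x + C2 * quad_heat h x"
        by (simp only: distrib_right[symmetric] density_at_infinity)
      then show ?thesis using True by (simp add: q Astar_def ext_area_def right_diff_distrib)
    qed
    moreover have "\<bar>C1 * ((x\<^sup>2 + h) / 2 - quad_heat h x)\<bar> \<le> \<bar>C1\<bar> * ((1 + \<kappa>\<^sup>2) * h)"
      unfolding abs_mult using * quad_heat_le[of h x] assms by (intro mult_left_mono) auto
    moreover have "0 \<le> lam * ((1 + \<kappa>\<^sup>2) * h)" using lam_pos assms by simp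
    moreover have "init_const * h = \<bar>C1\<bar> * ((1 + \<kappa>\<^sup>2) * h) + lam * ((1 + \<kappa>\<^sup>2) * h) + h"
      unfolding init_const_def by algebra
    ultimately show ?thesis using assms by linarith
  next
    case False
    have "quad_heat h x \<le> (1 + \<kappa>\<^sup>2) * h"
      using bound[of 1] False K assms by (simp add: quad_heat_def heat_def)
    then have "lam * quad_heat h x \<le> lam * ((1 + \<kappa>\<^sup>2) * h)" using lam_pos by (intro mult_left_mono) auto
    moreover have "0 \<le> \<bar>C1\<bar> * ((1 + \<kappa>\<^sup>2) * h)" using assms by simp
    moreover have "0 \<le> lam * quad_heat h x" using lam_pos quad_heat_nonneg by simp
    moreover have "init_const * h = \<bar>C1\<bar> * ((1 + \<kappa>\<^sup>2) * h) + lam * ((1 + \<kappa>\<^sup>2) * h) + h"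
      unfolding init_const_def by algebra
    moreover have "Astar h x = 0" using False by (simp add: Astar_def)
    ultimately show ?thesis using assms unfolding q by linarith
  qed
qed

end

section \<open>Fluctuations of independent Gaussian displacements\<close>

text \<open>A variance is at most the second moment, and the squared positive part is at most twice
  an exponential, whose Gaussian mean is explicit.\<close>

lemma gauss_pos_part_second_moment:
  assumes "0 < h"
  shows "integrable (gauss h) (\<lambda>y. (pos_part (z - y) - heat h pos_part z)\<^sup>2)"
    and "(\<integral>y. (pos_part (z - y) - heat h pos_part z)\<^sup>2 \<partial>gauss h) \<le> 2 * exp (h / 2) * exp z"
proof -
  interpret prob_space "gauss h" by (rule prob_space_gauss) fact
  have i1: "integrable (gauss h) (\<lambda>y. pos_part (z - y))"
    by (rule integrable_gauss_pos_part) fact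
  have e: "integrable (gauss h) (\<lambda>y. 2 * exp z * exp (- 1 * y))"
    by (intro integrable_mult_right integrable_gauss_exp assms)
  have b: "(pos_part (z - y))\<^sup>2 \<le> 2 * exp z * exp (- 1 * y)" for y
    using pos_part_square_le_exp[of "z - y"] by (simp add: exp_add[symmetric] mult.assoc)
  have i2: "integrable (gauss h) (\<lambda>y. (pos_part (z - y))\<^sup>2)"
    by (rule Bochner_Integration.integrable_bound[OF e]) (use b in auto)
  have eq: "(pos_part (z - y) - heat h pos_part z)\<^sup>2 = (pos_part (z - y))\<^sup>2 - 2 * heat h pos_part z * pos_part (z - y) + (heat h pos_part z)\<^sup>2" for y
    by (simp add: power2_diff)
  show "integrable (gauss h) (\<lambda>y. (pos_part (z - y) - heat h pos_part z)\<^sup>2)"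
    unfolding eq using i1 i2 by simp
  have "(\<integral>y. (pos_part (z - y) - heat h pos_part z)\<^sup>2 \<partial>gauss h) = (\<integral>y. (pos_part (z - y))\<^sup>2 \<partial>gauss h) - (heat h pos_part z)\<^sup>2"
    unfolding eq using i1 i2 assms by (simp add: power2_eq_square heat_def[symmetric])
  also have "\<dots> \<le> (\<integral>y. (pos_part (z - y))\<^sup>2 \<partial>gauss h)" by simp
  also have "\<dots> \<le> (\<integral>y. 2 * exp z * exp (- 1 * y) \<partial>gauss h)"
    by (intro integral_mono i2 e b)
  also have "\<dots> = 2 * exp (h / 2) * exp z"
    using integral_gauss_exp[OF assms, of "-1"] by simp
  finally show "(\<integral>y. (pos_part (z - y) - heat h pos_part z)\<^sup>2 \<partial>gauss h) \<le> 2 * exp (h / 2) * exp z" .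
qed

lemma (in prob_space) expectation_abs_le_sqrt:
  fixes Y :: "'a \<Rightarrow> real"
  assumes [measurable]: "Y \<in> borel_measurable M" and i2: "integrable M (\<lambda>\<omega>. (Y \<omega>)\<^sup>2)"
    and "expectation (\<lambda>\<omega>. (Y \<omega>)\<^sup>2) \<le> C"
  shows "integrable M Y" "expectation (\<lambda>\<omega>. \<bar>Y \<omega>\<bar>) \<le> sqrt C"
proof -
  show i1: "integrable M Y"
  proof (rule Bochner_Integration.integrable_bound)
    show "integrable M (\<lambda>\<omega>. (Y \<omega>)\<^sup>2 + 1)" using i2 by simp
    show "AE \<omega> in M. norm (Y \<omega>) \<le> norm ((Y \<omega>)\<^sup>2 + 1)"
    proof (intro AE_I2)
      fix \<omega>
      have "0 \<le> (\<bar>Y \<omega>\<bar> - 1)\<^sup>2" by simp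
      then show "norm (Y \<omega>) \<le> norm ((Y \<omega>)\<^sup>2 + 1)" by (simp add: power2_diff) 
    qed
  qed simp
  have "(expectation (\<lambda>\<omega>. \<bar>Y \<omega>\<bar>))\<^sup>2 \<le> expectation (\<lambda>\<omega>. \<bar>Y \<omega>\<bar>\<^sup>2)"
    using variance_eq[of "\<lambda>\<omega>. \<bar>Y \<omega>\<bar>"] variance_positive[of "\<lambda>\<omega>. \<bar>Y \<omega>\<bar>"] i1 i2 by simp
  then have "(expectation (\<lambda>\<omega>. \<bar>Y \<omega>\<bar>))\<^sup>2 \<le> C" using assms(3) by simp
  then show "expectation (\<lambda>\<omega>. \<bar>Y \<omega>\<bar>) \<le> sqrt C"
    using real_le_rsqrt by blast
qed

lemma (in prob_space) expectation_square_sum_orthogonal: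
  fixes \<xi> :: "nat \<Rightarrow> 'a \<Rightarrow> real"
  assumes i: "\<And>i j. integrable M (\<lambda>\<omega>. \<xi> i \<omega> * \<xi> j \<omega>)"
    and o: "\<And>i j. i \<noteq> j \<Longrightarrow> expectation (\<lambda>\<omega>. \<xi> i \<omega> * \<xi> j \<omega>) = 0"
  shows "integrable M (\<lambda>\<omega>. (\<Sum>i<N. \<xi> i \<omega>)\<^sup>2)"
    and "expectation (\<lambda>\<omega>. (\<Sum>i<N. \<xi> i \<omega>)\<^sup>2) = (\<Sum>i<N. expectation (\<lambda>\<omega>. (\<xi> i \<omega>)\<^sup>2))"
proof -
  have eq: "(\<Sum>i<N. \<xi> i \<omega>)\<^sup>2 = (\<Sum>i<N. \<Sum>j<N. \<xi> i \<omega> * \<xi> j \<omega>)" for \<omega>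
    by (simp add: power2_eq_square sum_product)
  show "integrable M (\<lambda>\<omega>. (\<Sum>i<N. \<xi> i \<omega>)\<^sup>2)"
    unfolding eq by (intro Bochner_Integration.integrable_sum i)
  have "expectation (\<lambda>\<omega>. (\<Sum>i<N. \<xi> i \<omega>)\<^sup>2) = (\<Sum>i<N. \<Sum>j<N. expectation (\<lambda>\<omega>. \<xi> i \<omega> * \<xi> j \<omega>))"
    unfolding eq using i by (simp add: Bochner_Integration.integral_sum)
  also have "\<dots> = (\<Sum>i<N. \<Sum>j<N. if i = j then expectation (\<lambda>\<omega>. (\<xi> i \<omega>)\<^sup>2) else 0)"
    by (intro sum.cong refl) (auto simp: o power2_eq_square)
  also have "\<dots> = (\<Sum>i<N. expectation (\<lambda>\<omega>. (\<xi> i \<omega>)\<^sup>2))"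
    by (simp add: sum.delta)
  finally show "expectation (\<lambda>\<omega>. (\<Sum>i<N. \<xi> i \<omega>)\<^sup>2) = (\<Sum>i<N. expectation (\<lambda>\<omega>. (\<xi> i \<omega>)\<^sup>2))" .
qed

lemma (in prob_space) AE_summable_exp:
  fixes V :: "nat \<Rightarrow> 'a \<Rightarrow> real"
  assumes [measurable]: "\<And>i. V i \<in> borel_measurable M"
    and "(\<Sum>i. \<integral>\<^sup>+\<omega>. ennreal (exp (- V i \<omega>)) \<partial>M) \<le> ennreal C"
  shows "AE \<omega> in M. summable (\<lambda>i. exp (- V i \<omega>))"
proof -
  have "(\<integral>\<^sup>+\<omega>. (\<Sum>i. ennreal (exp (- V i \<omega>))) \<partial>M) \<le> ennreal C"
    using assms(2) by (subst nn_integral_suminf) auto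
  then have "AE \<omega> in M. (\<Sum>i. ennreal (exp (- V i \<omega>))) \<noteq> \<infinity>"
    by (intro nn_integral_PInf_AE) (auto simp: top_unique)
  then show ?thesis
    by eventually_elim (auto intro: summable_suminf_not_top)
qed

text \<open>One time step of driftless particles: current positions \<open>U\<close>, fresh Gaussian increments \<open>D\<close>.\<close>

locale gaussian_step = prob_space M for M :: "'a measure" +
  fixes U D :: "nat \<Rightarrow> 'a \<Rightarrow> real" and h S :: real
  assumes h_pos: "0 < h"
    and U_D_indep: "i \<noteq> j \<Longrightarrow> indep_var (borel \<Otimes>\<^sub>M borel) (\<lambda>\<omega>. (U i \<omega>, U j \<omega>)) (borel \<Otimes>\<^sub>M borel) (\<lambda>\<omega>. (D i \<omega>, D j \<omega>))"
    and D_indep: "i \<noteq> j \<Longrightarrow> indep_var borel (D i) borel (D j)"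
    and D_distr: "distr M borel (D i) = gauss h"
    and S_nonneg: "0 \<le> S"
    and exp_moment: "(\<Sum>i. \<integral>\<^sup>+\<omega>. ennreal (exp (- U i \<omega>)) \<partial>M) \<le> ennreal S"
begin

lemma U_D_indep1: "indep_var borel (U i) borel (D i)"
  using indep_var_compose[OF U_D_indep[of i "Suc i"] measurable_fst measurable_fst] by (simp add: comp_def)

lemma U_rv [measurable]: "U i \<in> borel_measurable M"
  and D_rv [measurable]: "D i \<in> borel_measurable M"
  using U_D_indep1[of i] by (blast dest: indep_var_rv1 indep_var_rv2)+

lemma joint: "distr M (borel \<Otimes>\<^sub>M borel) (\<lambda>\<omega>. (U i \<omega>, D i \<omega>)) = distr M borel (U i) \<Otimes>\<^sub>M gauss h"
  using U_D_indep1[of i] by (simp add: indep_var_distribution_eq D_distr)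

lemma nn_integral_U_D:
  assumes [measurable]: "case_prod f \<in> borel_measurable (borel \<Otimes>\<^sub>M borel)"
  shows "(\<integral>\<^sup>+\<omega>. f (U i \<omega>) (D i \<omega>) \<partial>M) = (\<integral>\<^sup>+\<omega>. (\<integral>\<^sup>+y. f (U i \<omega>) y \<partial>gauss h) \<partial>M)"
proof -
  interpret g: prob_space "gauss h" by (rule prob_space_gauss) (rule h_pos)
  have "(\<integral>\<^sup>+\<omega>. f (U i \<omega>) (D i \<omega>) \<partial>M) = (\<integral>\<^sup>+p. case_prod f p \<partial>distr M (borel \<Otimes>\<^sub>M borel) (\<lambda>\<omega>. (U i \<omega>, D i \<omega>)))"
    by (subst nn_integral_distr) auto
  also have "\<dots> = (\<integral>\<^sup>+u. \<integral>\<^sup>+y. f u y \<partial>gauss h \<partial>distr M borel (U i))"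
    unfolding joint by (subst g.nn_integral_fst[symmetric]) (auto cong: measurable_cong_sets)
  also have "\<dots> = (\<integral>\<^sup>+\<omega>. (\<integral>\<^sup>+y. f (U i \<omega>) y \<partial>gauss h) \<partial>M)"
    by (subst nn_integral_distr) (auto cong: measurable_cong_sets)
  finally show ?thesis .
qed

lemma nn_integral_exp_U_D:
  "(\<integral>\<^sup>+\<omega>. ennreal (exp (- (U i \<omega> + D i \<omega>))) \<partial>M) = ennreal (exp (h / 2)) * (\<integral>\<^sup>+\<omega>. ennreal (exp (- U i \<omega>)) \<partial>M)"
proof -
  have "(\<integral>\<^sup>+y. ennreal (exp (- (u + y))) \<partial>gauss h) = ennreal (exp (h / 2)) * ennreal (exp (- u))" for u
  proof -
    have "(\<integral>\<^sup>+y. ennreal (exp (- (u + y))) \<partial>gauss h) = (\<integral>\<^sup>+y. ennreal (exp (- u) * exp (- 1 * y)) \<partial>gauss h)"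
      by (simp add: exp_add[symmetric])
    also have "\<dots> = ennreal (\<integral>y. exp (- u) * exp (- 1 * y) \<partial>gauss h)"
      by (intro nn_integral_eq_integral integrable_mult_right integrable_gauss_exp h_pos) auto
    also have "(\<integral>y. exp (- u) * exp (- 1 * y) \<partial>gauss h) = exp (h / 2) * exp (- u)"
      using integral_gauss_exp[OF h_pos, of "-1"] by simp
    finally show ?thesis by (simp add: ennreal_mult')
  qed
  then show ?thesis
    by (subst nn_integral_U_D[of "\<lambda>u y. ennreal (exp (- (u + y)))"]) (auto intro!: nn_integral_cmult)
qed

lemma exp_moment_U_D:
  "(\<Sum>i. \<integral>\<^sup>+\<omega>. ennreal (exp (- (U i \<omega> + D i \<omega>))) \<partial>M) \<le> ennreal (exp (h / 2) * S)"
  unfolding nn_integral_exp_U_D using exp_moment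
  by (subst ennreal_suminf_cmult) (simp add: ennreal_mult' mult_left_mono)

lemma AE_summable_U: "AE \<omega> in M. summable (\<lambda>i. exp (- U i \<omega>))"
  using AE_summable_exp[OF _ exp_moment] by simp

lemma AE_summable_U_D: "AE \<omega> in M. summable (\<lambda>i. exp (- (U i \<omega> + D i \<omega>)))"
  using AE_summable_exp[of "\<lambda>i \<omega>. U i \<omega> + D i \<omega>", OF _ exp_moment_U_D] by simp

definition free :: "real \<Rightarrow> 'a \<Rightarrow> real" where
  "free x \<omega> = (\<Sum>i. pos_part (x - U i \<omega> - D i \<omega>))"

definition heated :: "real \<Rightarrow> 'a \<Rightarrow> real" where
  "heated x \<omega> = (\<Sum>i. heat h pos_part (x - U i \<omega>))"

lemma measurable_heat_h [measurable]: "heat h pos_part \<in> borel_measurable borel"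
  by (rule measurable_heat_pos_part) (rule h_pos)

lemma AE_free_heated_sums:
  "AE \<omega> in M. (\<lambda>N. \<Sum>i<N. pos_part (x - U i \<omega> - D i \<omega>) - heat h pos_part (x - U i \<omega>)) \<longlonglongrightarrow> free x \<omega> - heated x \<omega>"
  using AE_summable_U AE_summable_U_D
proof eventually_elim
  case (elim \<omega>)
  have "(\<lambda>i. pos_part (x - U i \<omega> - D i \<omega>)) sums free x \<omega>"
    unfolding free_def using summable_pos_part[OF elim(2), of x] by (simp add: diff_diff_eq summable_sums)
  moreover have "(\<lambda>i. heat h pos_part (x - U i \<omega>)) sums heated x \<omega>"
    unfolding heated_def using summable_heat_pos_part[OF h_pos elim(1), of x] by (rule summable_sums)
  ultimately show ?case
    using sums_diff unfolding sums_def by blast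
qed

context
  fixes x :: real
begin

text \<open>Given the position, the subtracted term is the conditional mean of the first one, so
  each of these terms is centred.\<close>

definition fluct :: "nat \<Rightarrow> 'a \<Rightarrow> real" where
  "fluct i \<omega> = pos_part (x - U i \<omega> - D i \<omega>) - heat h pos_part (x - U i \<omega>)"

lemma fluct_measurable [measurable]: "fluct i \<in> borel_measurable M"
  unfolding fluct_def[abs_def] by measurable

lemma fluct_second_moment:
  "integrable M (\<lambda>\<omega>. (fluct i \<omega>)\<^sup>2)"
  "ennreal (expectation (\<lambda>\<omega>. (fluct i \<omega>)\<^sup>2)) \<le> ennreal (2 * exp (h / 2) * exp x) * (\<integral>\<^sup>+\<omega>. ennreal (exp (- U i \<omega>)) \<partial>M)"
proof -
  have "(\<integral>\<^sup>+\<omega>. ennreal ((fluct i \<omega>)\<^sup>2) \<partial>M) = (\<integral>\<^sup>+\<omega>. (\<integral>\<^sup>+y. ennreal ((pos_part (x - U i \<omega> - y) - heat h pos_part (x - U i \<omega>))\<^sup>2) \<partial>gauss h) \<partial>M)"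
    unfolding fluct_def by (rule nn_integral_U_D[of "\<lambda>u y. ennreal ((pos_part (x - u - y) - heat h pos_part (x - u))\<^sup>2)"]) measurable
  also have "\<dots> \<le> (\<integral>\<^sup>+\<omega>. ennreal (2 * exp (h / 2) * exp x) * ennreal (exp (- U i \<omega>)) \<partial>M)"
  proof (intro nn_integral_mono)
    fix \<omega>
    have "(\<integral>\<^sup>+y. ennreal ((pos_part (x - U i \<omega> - y) - heat h pos_part (x - U i \<omega>))\<^sup>2) \<partial>gauss h)
      = ennreal (\<integral>y. (pos_part (x - U i \<omega> - y) - heat h pos_part (x - U i \<omega>))\<^sup>2 \<partial>gauss h)"
      by (intro nn_integral_eq_integral gauss_pos_part_second_moment h_pos) auto
    also have "\<dots> \<le> ennreal (2 * exp (h / 2) * exp (x - U i \<omega>))"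
      by (intro ennreal_leI gauss_pos_part_second_moment h_pos)
    also have "\<dots> = ennreal (2 * exp (h / 2) * exp x) * ennreal (exp (- U i \<omega>))"
      by (simp add: ennreal_mult'[symmetric] exp_diff exp_minus field_simps)
    finally show "(\<integral>\<^sup>+y. ennreal ((pos_part (x - U i \<omega> - y) - heat h pos_part (x - U i \<omega>))\<^sup>2) \<partial>gauss h) \<le> ennreal (2 * exp (h / 2) * exp x) * ennreal (exp (- U i \<omega>))" .
  qed
  also have "\<dots> = ennreal (2 * exp (h / 2) * exp x) * (\<integral>\<^sup>+\<omega>. ennreal (exp (- U i \<omega>)) \<partial>M)"
    by (rule nn_integral_cmult) auto
  finally have *: "(\<integral>\<^sup>+\<omega>. ennreal ((fluct i \<omega>)\<^sup>2) \<partial>M) \<le> ennreal (2 * exp (h / 2) * exp x) * (\<integral>\<^sup>+\<omega>. ennreal (exp (- U i \<omega>)) \<partial>M)" .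
  have "(\<integral>\<^sup>+\<omega>. ennreal (exp (- U i \<omega>)) \<partial>M) \<le> ennreal S"
    using sum_le_suminf[of "\<lambda>i. \<integral>\<^sup>+\<omega>. ennreal (exp (- U i \<omega>)) \<partial>M" "{i}"] exp_moment by (auto intro: order_trans)
  then have fin: "(\<integral>\<^sup>+\<omega>. ennreal (exp (- U i \<omega>)) \<partial>M) < \<infinity>"
    by (auto simp: top_unique less_top intro: le_less_trans)
  then show int: "integrable M (\<lambda>\<omega>. (fluct i \<omega>)\<^sup>2)"
    using * by (intro integrableI_bounded) (auto simp: ennreal_mult_less_top intro: le_less_trans)
  show "ennreal (expectation (\<lambda>\<omega>. (fluct i \<omega>)\<^sup>2)) \<le> ennreal (2 * exp (h / 2) * exp x) * (\<integral>\<^sup>+\<omega>. ennreal (exp (- U i \<omega>)) \<partial>M)"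
    using * nn_integral_eq_integral[OF int] by simp
qed

lemma fluct_product_integrable: "integrable M (\<lambda>\<omega>. fluct i \<omega> * fluct j \<omega>)"
proof (rule Bochner_Integration.integrable_bound)
  show "integrable M (\<lambda>\<omega>. (fluct i \<omega>)\<^sup>2 + (fluct j \<omega>)\<^sup>2)"
    by (intro Bochner_Integration.integrable_add fluct_second_moment)
  show "AE \<omega> in M. norm (fluct i \<omega> * fluct j \<omega>) \<le> norm ((fluct i \<omega>)\<^sup>2 + (fluct j \<omega>)\<^sup>2)"
  proof (intro AE_I2)
    fix \<omega>
    have "0 \<le> (\<bar>fluct i \<omega>\<bar> - \<bar>fluct j \<omega>\<bar>)\<^sup>2" by simp
    then have "2 * \<bar>fluct i \<omega>\<bar> * \<bar>fluct j \<omega>\<bar> \<le> (fluct i \<omega>)\<^sup>2 + (fluct j \<omega>)\<^sup>2"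
      by (simp add: power2_diff)
    then show "norm (fluct i \<omega> * fluct j \<omega>) \<le> norm ((fluct i \<omega>)\<^sup>2 + (fluct j \<omega>)\<^sup>2)"
      using mult_nonneg_nonneg[of "\<bar>fluct i \<omega>\<bar>" "\<bar>fluct j \<omega>\<bar>"]
      unfolding real_norm_def abs_mult by linarith
  qed
qed measurable

text \<open>The positions of two particles may be dependent. Given both positions, however, the two
  increments are independent and each factor is centred, so the inner integral over the increments
  vanishes.\<close>

lemma fluct_orthogonal:
  assumes "i \<noteq> j" shows "expectation (\<lambda>\<omega>. fluct i \<omega> * fluct j \<omega>) = 0"
proof -
  define k where "k u y = pos_part (x - u - y) - heat h pos_part (x - u)" for u y
  have [measurable]: "case_prod k \<in> borel_measurable (borel \<Otimes>\<^sub>M borel)"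
    unfolding k_def by measurable
  \<comment> \<open>The arguments are grouped as the pair of positions and the pair of increments,
    because these two pairs are independent of each other.\<close>
  define G where "G p q = k (fst p) (fst q) * k (snd p) (snd q)" for p q
  let ?B = "borel \<Otimes>\<^sub>M borel :: (real \<times> real) measure"
  have [measurable]: "case_prod G \<in> borel_measurable (?B \<Otimes>\<^sub>M ?B)"
    unfolding G_def by measurable
  have [measurable]: "G p \<in> borel_measurable ?B" for p
    unfolding G_def by measurable
  define PU where "PU = distr M ?B (\<lambda>\<omega>. (U i \<omega>, U j \<omega>))"
  define PD where "PD = distr M ?B (\<lambda>\<omega>. (D i \<omega>, D j \<omega>))"
  interpret PU: prob_space PU unfolding PU_def by (rule prob_space_distr) measurable
  interpret PD: prob_space PD unfolding PD_def by (rule prob_space_distr) measurable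
  interpret PP: pair_prob_space PU PD ..
  have dist: "distr M (?B \<Otimes>\<^sub>M ?B) (\<lambda>\<omega>. ((U i \<omega>, U j \<omega>), (D i \<omega>, D j \<omega>))) = PU \<Otimes>\<^sub>M PD"
    using U_D_indep[OF assms] by (simp add: indep_var_distribution_eq PU_def PD_def)
  have k1: "integrable M (\<lambda>\<omega>. k u (D l \<omega>))" "expectation (\<lambda>\<omega>. k u (D l \<omega>)) = 0" for u l
  proof -
    interpret g: prob_space "gauss h" by (rule prob_space_gauss) (rule h_pos)
    have i: "integrable (gauss h) (k u)"
      unfolding k_def using integrable_gauss_pos_part[OF h_pos, of "x - u"] by simp
    have "integrable (distr M borel (D l)) (k u)" unfolding D_distr by fact
    then show "integrable M (\<lambda>\<omega>. k u (D l \<omega>))" by (rule integrable_distr[rotated]) measurable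
    have "expectation (\<lambda>\<omega>. k u (D l \<omega>)) = integral\<^sup>L (distr M borel (D l)) (k u)"
      by (rule integral_distr[symmetric]) measurable
    also have "\<dots> = 0"
      unfolding D_distr k_def using integrable_gauss_pos_part[OF h_pos, of "x - u"] h_pos by (simp add: heat_def[symmetric])
    finally show "expectation (\<lambda>\<omega>. k u (D l \<omega>)) = 0" .
  qed
  have inner: "(\<integral>q. G p q \<partial>PD) = 0" for p
  proof -
    have "(\<integral>q. G p q \<partial>PD) = expectation (\<lambda>\<omega>. k (fst p) (D i \<omega>) * k (snd p) (D j \<omega>))"
      unfolding PD_def by (subst integral_distr) (auto simp: G_def)
    also have "\<dots> = expectation (\<lambda>\<omega>. k (fst p) (D i \<omega>)) * expectation (\<lambda>\<omega>. k (snd p) (D j \<omega>))"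
    proof (rule indep_var_lebesgue_integral[OF _ k1(1) k1(1)])
      show "indep_var borel (\<lambda>\<omega>. k (fst p) (D i \<omega>)) borel (\<lambda>\<omega>. k (snd p) (D j \<omega>))"
        using indep_var_compose[OF D_indep[OF assms], of "k (fst p)" borel "k (snd p)" borel] by (simp add: comp_def)
    qed
    finally show ?thesis by (simp add: k1)
  qed
  have GM: "fluct i \<omega> * fluct j \<omega> = case_prod G ((U i \<omega>, U j \<omega>), (D i \<omega>, D j \<omega>))" for \<omega>
    by (simp add: G_def k_def fluct_def)
  have int: "integrable (PU \<Otimes>\<^sub>M PD) (case_prod G)"
    unfolding dist[symmetric] using fluct_product_integrable[of i j] by (subst integrable_distr_eq) (auto simp: GM)
  have "expectation (\<lambda>\<omega>. fluct i \<omega> * fluct j \<omega>) = integral\<^sup>L (PU \<Otimes>\<^sub>M PD) (case_prod G)"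
    unfolding dist[symmetric] GM by (subst integral_distr) auto
  also have "\<dots> = (\<integral>p. \<integral>q. case_prod G (p, q) \<partial>PD \<partial>PU)"
    using PP.integral_fst'[OF int] by simp
  also have "\<dots> = 0" by (simp add: inner)
  finally show ?thesis .
qed

text \<open>Orthogonality makes the second moment of a partial sum the sum of the individual ones,
  which the exponential moment bounds uniformly; Fatou's lemma passes to the infinite sum.\<close>

lemma noise_bound:
  "(\<integral>\<^sup>+\<omega>. ennreal \<bar>free x \<omega> - heated x \<omega>\<bar> \<partial>M) \<le> ennreal (sqrt (2 * exp (h / 2) * exp x * S))"
proof -
  define C where "C = 2 * exp (h / 2) * exp x * S"
  have part: "(\<integral>\<^sup>+\<omega>. ennreal \<bar>\<Sum>i<N. fluct i \<omega>\<bar> \<partial>M) \<le> ennreal (sqrt C)" for N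
  proof -
    have "ennreal (\<Sum>i<N. expectation (\<lambda>\<omega>. (fluct i \<omega>)\<^sup>2)) = (\<Sum>i<N. ennreal (expectation (\<lambda>\<omega>. (fluct i \<omega>)\<^sup>2)))"
      by (subst sum_ennreal) auto
    also have "\<dots> \<le> (\<Sum>i<N. ennreal (2 * exp (h / 2) * exp x) * (\<integral>\<^sup>+\<omega>. ennreal (exp (- U i \<omega>)) \<partial>M))"
      by (intro sum_mono fluct_second_moment)
    also have "\<dots> \<le> (\<Sum>i. ennreal (2 * exp (h / 2) * exp x) * (\<integral>\<^sup>+\<omega>. ennreal (exp (- U i \<omega>)) \<partial>M))"
      by (intro sum_le_suminf) auto
    also have "\<dots> \<le> ennreal (2 * exp (h / 2) * exp x) * ennreal S"
      by (subst ennreal_suminf_cmult) (intro mult_left_mono exp_moment, simp)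
    also have "\<dots> = ennreal C" by (simp add: C_def ennreal_mult'[symmetric])
    finally have "(\<Sum>i<N. expectation (\<lambda>\<omega>. (fluct i \<omega>)\<^sup>2)) \<le> C"
      using S_nonneg by (simp add: C_def)
    then have "expectation (\<lambda>\<omega>. (\<Sum>i<N. fluct i \<omega>)\<^sup>2) \<le> C"
      using expectation_square_sum_orthogonal(2)[of fluct N, OF fluct_product_integrable fluct_orthogonal] by simp
    note E = expectation_abs_le_sqrt[OF _ expectation_square_sum_orthogonal(1)[of fluct N, OF fluct_product_integrable fluct_orthogonal] this]
    have "(\<integral>\<^sup>+\<omega>. ennreal \<bar>\<Sum>i<N. fluct i \<omega>\<bar> \<partial>M) = ennreal (expectation (\<lambda>\<omega>. \<bar>\<Sum>i<N. fluct i \<omega>\<bar>))"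
      by (intro nn_integral_eq_integral integrable_abs E) auto
    also have "\<dots> \<le> ennreal (sqrt C)"
      by (intro ennreal_leI E) auto
    finally show ?thesis .
  qed
  have "(\<integral>\<^sup>+\<omega>. ennreal \<bar>free x \<omega> - heated x \<omega>\<bar> \<partial>M) = (\<integral>\<^sup>+\<omega>. liminf (\<lambda>N. ennreal \<bar>\<Sum>i<N. fluct i \<omega>\<bar>) \<partial>M)"
    using AE_free_heated_sums[of x]
  proof (intro nn_integral_cong_AE, eventually_elim)
    case (elim \<omega>)
    then have "(\<lambda>N. ennreal \<bar>\<Sum>i<N. fluct i \<omega>\<bar>) \<longlonglongrightarrow> ennreal \<bar>free x \<omega> - heated x \<omega>\<bar>"
      unfolding fluct_def by (intro tendsto_ennrealI tendsto_rabs)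
    from lim_imp_Liminf[OF _ this] show ?case by simp
  qed
  also have "\<dots> \<le> liminf (\<lambda>N. \<integral>\<^sup>+\<omega>. ennreal \<bar>\<Sum>i<N. fluct i \<omega>\<bar> \<partial>M)"
    by (rule nn_integral_liminf) measurable
  also have "\<dots> \<le> ennreal (sqrt C)"
    by (intro Liminf_le always_eventually allI part) simp
  finally show ?thesis by (simp add: C_def)
qed

end

end

section \<open>The rescaled particle system\<close>

lemma has_rank_1_iff: "has_rank x i 1 \<longleftrightarrow> (\<forall>j. \<not> ranked_before x j i)"
proof
  assume "has_rank x i 1"
  then have "{j. ranked_before x j i} = {}" by (auto simp: has_rank_def)
  then show "\<forall>j. \<not> ranked_before x j i" by blast
next
  assume "\<forall>j. \<not> ranked_before x j i"
  then have "{j. ranked_before x j i} = {}" by blast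
  then show "has_rank x i 1" unfolding has_rank_def by simp
qed

lemma has_rank_1_unique: "has_rank x i 1 \<Longrightarrow> has_rank x j 1 \<Longrightarrow> i = j"
  unfolding has_rank_1_iff ranked_before_def by (metis linorder_neqE_nat linorder_neqE_linordered_idom)

lemma has_rank_1_le: "has_rank x i 1 \<Longrightarrow> x i \<le> x j"
  unfolding has_rank_1_iff ranked_before_def by (meson not_less)

lemma finite_below_if_summable:
  fixes u :: "nat \<Rightarrow> real"
  assumes "summable (\<lambda>i. exp (- u i))" shows "finite {i. u i \<le> r}"
proof -
  have "(\<lambda>i. exp (- u i)) \<longlonglongrightarrow> 0" by (rule summable_LIMSEQ_zero) fact
  then have "eventually (\<lambda>i. exp (- u i) < exp (- r)) sequentially"
    by (rule order_tendstoD) simp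
  then obtain N where "\<And>i. N \<le> i \<Longrightarrow> exp (- u i) < exp (- r)" by (auto simp: eventually_sequentially)
  then have "{i. u i \<le> r} \<subseteq> {..<N}" by (force simp: not_le)
  then show ?thesis by (rule finite_subset) simp
qed

lemma has_rank_1_exists:
  assumes "\<And>r. finite {i. x i \<le> r}" shows "\<exists>i. has_rank x i 1"
proof -
  let ?A = "{i. x i \<le> x 0}"
  let ?m = "Min (x ` ?A)"
  have fin: "finite ?A" "0 \<in> ?A" by (auto intro: assms)
  then have "?m \<in> x ` ?A" by (intro Min_in) auto
  then obtain i where i: "x i = ?m" by auto
  have min: "?m \<le> x j" for j
  proof (cases "j \<in> ?A")
    case True then show ?thesis using fin by (intro Min_le) auto
  next
    case False
    moreover have "?m \<le> x 0" using fin by (intro Min_le) auto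
    ultimately show ?thesis by simp
  qed
  \<comment> \<open>Several particles may sit at the minimum; the one with the least label comes
    first in the lexicographic order.\<close>
  define k where "k = (LEAST i. x i = ?m)"
  have k: "x k = ?m" unfolding k_def using i by (rule LeastI)
  have "\<not> ranked_before x j k" for j
    using k min[of j] not_less_Least[of j "\<lambda>i. x i = ?m"] by (auto simp: ranked_before_def k_def)
  then show ?thesis unfolding has_rank_1_iff by blast
qed

text \<open>Rounding the time down to multiples of 1 / (n + 1) leaves countably many sections, each
  measurable; continuity of the paths recovers f in the limit.\<close>

lemma measurable_caratheodory:
  fixes f :: "real \<Rightarrow> 'a \<Rightarrow> real"
  assumes cont: "\<And>\<omega>. \<omega> \<in> space M \<Longrightarrow> continuous_on UNIV (\<lambda>u. f u \<omega>)"
    and meas [measurable]: "\<And>u. f u \<in> borel_measurable M"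
  shows "case_prod f \<in> borel_measurable (borel \<Otimes>\<^sub>M M)"
proof (rule borel_measurable_LIMSEQ_real)
  define g where "g n p = f (of_int \<lfloor>fst p * real (Suc n)\<rfloor> / real (Suc n)) (snd p)" for n and p :: "real \<times> 'a"
  show "g n \<in> borel_measurable (borel \<Otimes>\<^sub>M M)" for n
    unfolding g_def
    by (rule measurable_compose_countable[of "\<lambda>k p. f (of_int k / real (Suc n)) (snd p)" _ _ "\<lambda>p. \<lfloor>fst p * real (Suc n)\<rfloor>"]) measurable
  fix p :: "real \<times> 'a" assume p: "p \<in> space (borel \<Otimes>\<^sub>M M)"
  then have \<omega>: "snd p \<in> space M" by (auto simp: space_pair_measure)
  have "(\<lambda>n. of_int \<lfloor>fst p * real (Suc n)\<rfloor> / real (Suc n)) \<longlonglongrightarrow> fst p"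
  proof (rule real_tendsto_sandwich)
    have "fst p - 1 / real (Suc n) \<le> of_int \<lfloor>fst p * real (Suc n)\<rfloor> / real (Suc n)" for n
    proof -
      have "fst p * real (Suc n) - 1 \<le> of_int \<lfloor>fst p * real (Suc n)\<rfloor>" by linarith
      then have "(fst p * real (Suc n) - 1) / real (Suc n) \<le> of_int \<lfloor>fst p * real (Suc n)\<rfloor> / real (Suc n)"
        by (intro divide_right_mono) auto
      then show ?thesis by (simp add: diff_divide_distrib del: of_nat_Suc)
    qed
    then show "eventually (\<lambda>n. fst p - 1 / real (Suc n) \<le> of_int \<lfloor>fst p * real (Suc n)\<rfloor> / real (Suc n)) sequentially"
      by (simp del: of_nat_Suc)
    have "of_int \<lfloor>fst p * real (Suc n)\<rfloor> / real (Suc n) \<le> fst p" for n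
      by (subst pos_divide_le_eq) (auto simp del: of_nat_Suc)
    then show "eventually (\<lambda>n. of_int \<lfloor>fst p * real (Suc n)\<rfloor> / real (Suc n) \<le> fst p) sequentially"
      by (simp del: of_nat_Suc)
    have "(\<lambda>n. fst p - 1 / real (Suc n)) \<longlonglongrightarrow> fst p - 0"
      by (intro tendsto_diff tendsto_const LIMSEQ_Suc[OF lim_1_over_n])
    then show "(\<lambda>n. fst p - 1 / real (Suc n)) \<longlonglongrightarrow> fst p" by simp
  qed simp
  note lim = this
  have "isCont (\<lambda>u. f u (snd p)) (fst p)"
    using cont[OF \<omega>] continuous_on_eq_continuous_at[OF open_UNIV] by blast
  from isCont_tendsto_compose[OF this lim] show "(\<lambda>n. g n p) \<longlonglongrightarrow> case_prod f p"
    by (simp only: g_def case_prod_beta)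
qed

text \<open>Layer-cake form: it turns a sum of exponentials into an integral of the counting
  function, whose mean is known at time 0.\<close>

lemma exp_eq_nn_integral: "ennreal (exp (- y)) = (\<integral>\<^sup>+r. ennreal (exp (- r)) * indicator {y..} r \<partial>lborel)"
proof -
  have "(\<integral>\<^sup>+r. ennreal (exp (- r)) * indicator {y..} r \<partial>lborel) = ennreal (0 - (- exp (- y)))"
  proof (rule nn_integral_FTC_atLeast)
    show "((\<lambda>r::real. - exp (- r)) \<longlongrightarrow> 0) at_top" by real_asymp
  qed (auto intro!: derivative_eq_intros)
  then show ?thesis by simp
qed

lemma exp_tail_integral: "(\<integral>\<^sup>+r. ennreal (exp (- r)) * ennreal (max 0 r) \<partial>lborel) = 1"
proof -
  have "(\<integral>\<^sup>+r. ennreal (exp (- r)) * ennreal (max 0 r) \<partial>lborel) = (\<integral>\<^sup>+r. ennreal (r * exp (- r)) * indicator {0..} r \<partial>lborel)"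
    by (intro nn_integral_cong) (auto simp: indicator_def max_def ennreal_mult'[symmetric] mult.commute)
  also have "\<dots> = ennreal (0 - (- (0 + 1) * exp (- 0)))"
  proof (rule nn_integral_FTC_atLeast)
    show "((\<lambda>r::real. - (r + 1) * exp (- r)) \<longlongrightarrow> 0) at_top" by real_asymp
  qed (auto intro!: derivative_eq_intros simp: algebra_simps)
  finally show ?thesis by simp
qed

text \<open>The Atlas system after diffusive rescaling of space by \<open>b\<close> and of time by \<open>b\<^sup>2\<close>: the
  left-most particle has drift \<open>b\<close> and the initial intensity is \<open>lam * b\<close>.\<close>

locale fast_atlas = prob_space M for M :: "'a measure" +
  fixes F :: "real \<Rightarrow> 'a measure" and w x :: "nat \<Rightarrow> real \<Rightarrow> 'a \<Rightarrow> real" and b lam :: real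
  assumes b_pos: "0 < b" and lam_pos: "0 < lam"
    and F_subalgebra: "0 \<le> t \<Longrightarrow> subalgebra M (F t)"
    and x_adapted: "0 \<le> t \<Longrightarrow> x i t \<in> borel_measurable (F t)"
    and w_measurable: "0 \<le> t \<Longrightarrow> w i t \<in> borel_measurable M"
    and inc_distr: "0 \<le> s \<Longrightarrow> s < t \<Longrightarrow> distr M borel (\<lambda>\<omega>. w i t \<omega> - w i s \<omega>) = gauss (t - s)"
    and inc_indep: "0 \<le> s \<Longrightarrow> s < t \<Longrightarrow> i \<noteq> j \<Longrightarrow> indep_var borel (\<lambda>\<omega>. w i t \<omega> - w i s \<omega>) borel (\<lambda>\<omega>. w j t \<omega> - w j s \<omega>)"
    and inc_future: "0 \<le> s \<Longrightarrow> s < t \<Longrightarrow> indep_set (sets (F s))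
          (sets (vimage_algebra (space M) (\<lambda>\<omega>. (w i t \<omega> - w i s \<omega>, w j t \<omega> - w j s \<omega>)) (borel \<Otimes>\<^sub>M borel)))"
    and x_continuous: "AE \<omega> in M. \<forall>i. continuous_on {0..} (\<lambda>t. x i t \<omega>)"
    and w_continuous: "AE \<omega> in M. \<forall>i. continuous_on {0..} (\<lambda>t. w i t \<omega>)"
    and x_eq: "AE \<omega> in M. \<forall>i. \<forall>t\<ge>0. x i t \<omega> = x i 0 \<omega>
          + b * (LBINT u=0..t. (if has_rank (\<lambda>j. x j u \<omega>) i 1 then 1 else 0)) + w i t \<omega>"
    and init_finite: "AE \<omega> in M. finite {i. x i 0 \<omega> \<le> r}"
    and init_mean: "(\<integral>\<^sup>+\<omega>. ennreal (real (card {i. x i 0 \<omega> \<le> r})) \<partial>M) = ennreal (lam * b * max 0 r)"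
    and init_var: "(\<integral>\<^sup>+\<omega>. ennreal ((real (card {i. x i 0 \<omega> \<le> r}) - lam * b * max 0 r)\<^sup>2) \<partial>M) \<le> ennreal (lam * b * max 0 r)"
begin

section \<open>Exponential moments and the noise of one step\<close>

lemma x_measurable: "0 \<le> t \<Longrightarrow> x i t \<in> borel_measurable M"
  using x_adapted F_subalgebra by (rule measurable_from_subalg[rotated])

abbreviation inc :: "nat \<Rightarrow> real \<Rightarrow> real \<Rightarrow> 'a \<Rightarrow> real" where
  "inc i s t \<omega> \<equiv> w i t \<omega> - w i s \<omega>"

text \<open>A bound for the exponential moment at all times up to 1: the initial value lam b, times
  the factor gained by a Gaussian displacement of variance 1.\<close>

definition S :: real where "S = lam * b * exp (1 / 2)"

lemma S_pos: "0 < S" using b_pos lam_pos by (simp add: S_def)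

text \<open>Written with the layer-cake formula and with the order of integration exchanged, only
  the mean lam b r of the number of points up to r enters, and the integral of r exp(-r) is
  1.\<close>

lemma exp_moment_0: "(\<Sum>i. \<integral>\<^sup>+\<omega>. ennreal (exp (- x i 0 \<omega>)) \<partial>M) = ennreal (lam * b)"
proof -
  note [measurable] = x_measurable[OF order_refl]
  interpret L: pair_sigma_finite M lborel ..
  have "(\<Sum>i. \<integral>\<^sup>+\<omega>. ennreal (exp (- x i 0 \<omega>)) \<partial>M) = (\<integral>\<^sup>+\<omega>. (\<Sum>i. \<integral>\<^sup>+r. ennreal (exp (- r)) * indicator {x i 0 \<omega>..} r \<partial>lborel) \<partial>M)"
    unfolding exp_eq_nn_integral[symmetric] by (subst nn_integral_suminf) auto
  also have "\<dots> = (\<integral>\<^sup>+\<omega>. \<integral>\<^sup>+r. (\<Sum>i. ennreal (exp (- r)) * indicator {x i 0 \<omega>..} r) \<partial>lborel \<partial>M)"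
    by (subst nn_integral_suminf) auto
  also have "\<dots> = (\<integral>\<^sup>+r. \<integral>\<^sup>+\<omega>. (\<Sum>i. ennreal (exp (- r)) * indicator {x i 0 \<omega>..} r) \<partial>M \<partial>lborel)"
    by (rule L.Fubini'[symmetric]) (unfold indicator_def atLeast_iff split_beta, measurable)
  also have "\<dots> = (\<integral>\<^sup>+r. ennreal (exp (- r)) * ennreal (lam * b * max 0 r) \<partial>lborel)"
  proof (intro nn_integral_cong)
    fix r :: real
    have "(\<integral>\<^sup>+\<omega>. (\<Sum>i. ennreal (exp (- r)) * indicator {x i 0 \<omega>..} r) \<partial>M) = (\<integral>\<^sup>+\<omega>. ennreal (exp (- r)) * ennreal (real (card {i. x i 0 \<omega> \<le> r})) \<partial>M)"
      using init_finite[of r]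
    proof (intro nn_integral_cong_AE, eventually_elim)
      case (elim \<omega>)
      have "(\<Sum>i. ennreal (exp (- r)) * indicator {x i 0 \<omega>..} r) = (\<Sum>i\<in>{i. x i 0 \<omega> \<le> r}. ennreal (exp (- r)))"
        by (subst suminf_finite[OF elim(2)]) (auto simp: indicator_def)
      then show ?case by (simp add: mult.commute ennreal_of_nat_eq_real_of_nat)
    qed
    also have "\<dots> = ennreal (exp (- r)) * ennreal (lam * b * max 0 r)"
      by (subst nn_integral_cmult) (auto simp: init_mean)
    finally show "(\<integral>\<^sup>+\<omega>. (\<Sum>i. ennreal (exp (- r)) * indicator {x i 0 \<omega>..} r) \<partial>M) = ennreal (exp (- r)) * ennreal (lam * b * max 0 r)" .
  qed
  also have "\<dots> = (\<integral>\<^sup>+r. ennreal (lam * b) * (ennreal (exp (- r)) * ennreal (max 0 r)) \<partial>lborel)"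
  proof (intro nn_integral_cong)
    fix r :: real
    have "ennreal (lam * b * max 0 r) = ennreal (lam * b) * ennreal (max 0 r)"
      using lam_pos b_pos by (intro ennreal_mult) auto
    then show "ennreal (exp (- r)) * ennreal (lam * b * max 0 r) = ennreal (lam * b) * (ennreal (exp (- r)) * ennreal (max 0 r))"
      by (simp only: mult.left_commute)
  qed
  also have "\<dots> = ennreal (lam * b)"
    by (subst nn_integral_cmult) (measurable, simp only: exp_tail_integral mult_1_right)
  finally show ?thesis .
qed

text \<open>What G generates lies in \<open>F s\<close>, which is independent of the later
  increments.\<close>

lemma indep_var_inc:
  assumes s: "0 \<le> s" "s < t" and G: "G \<in> F s \<rightarrow>\<^sub>M borel \<Otimes>\<^sub>M borel"
  shows "indep_var (borel \<Otimes>\<^sub>M borel) (G :: 'a \<Rightarrow> real \<times> real) (borel \<Otimes>\<^sub>M borel) (\<lambda>\<omega>. (inc i s t \<omega>, inc j s t \<omega>))"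
  unfolding indep_var_eq
proof (intro conjI)
  show GM: "random_variable (borel \<Otimes>\<^sub>M borel) G"
    using measurable_from_subalg[OF F_subalgebra[OF s(1)] G] .
  have [measurable]: "w l s \<in> borel_measurable M" "w l t \<in> borel_measurable M" for l
    using s by (auto intro: w_measurable)
  show incM: "random_variable (borel \<Otimes>\<^sub>M borel) (\<lambda>\<omega>. (inc i s t \<omega>, inc j s t \<omega>))"
    by measurable
  have sp: "space (F s) = space M" using F_subalgebra[OF s(1)] by (simp add: subalgebra_def)
  have 1: "sigma_sets (space M) {G -` A \<inter> space M |A. A \<in> sets (borel \<Otimes>\<^sub>M borel)} \<subseteq> sets (F s)"
    using measurable_sets[OF G] unfolding sp[symmetric] by (intro sets.sigma_sets_subset) auto
  have 2: "sigma_sets (space M) {(\<lambda>\<omega>. (inc i s t \<omega>, inc j s t \<omega>)) -` A \<inter> space M |A. A \<in> sets (borel \<Otimes>\<^sub>M borel)}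
      = sets (vimage_algebra (space M) (\<lambda>\<omega>. (inc i s t \<omega>, inc j s t \<omega>)) (borel \<Otimes>\<^sub>M borel))"
    by (simp add: sets_vimage_algebra)
  show "indep_set (sigma_sets (space M) {G -` A \<inter> space M |A. A \<in> sets (borel \<Otimes>\<^sub>M borel)})
     (sigma_sets (space M) {(\<lambda>\<omega>. (inc i s t \<omega>, inc j s t \<omega>)) -` A \<inter> space M |A. A \<in> sets (borel \<Otimes>\<^sub>M borel)})"
    unfolding 2 using inc_future[OF s, of i j] unfolding indep_set_def
    by (rule indep_sets_mono_sets) (use 1 in \<open>auto split: bool.split\<close>)
qed

lemma gaussian_step:
  assumes "0 \<le> s" "s < t" "0 \<le> S'" and S': "(\<Sum>i. \<integral>\<^sup>+\<omega>. ennreal (exp (- x i s \<omega>)) \<partial>M) \<le> ennreal S'"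
  shows "gaussian_step M (\<lambda>i. x i s) (\<lambda>i. inc i s t) (t - s) S'"
proof
  fix i j :: nat assume ij: "i \<noteq> j"
  note [measurable] = x_adapted[OF assms(1)]
  show "indep_var (borel \<Otimes>\<^sub>M borel) (\<lambda>\<omega>. (x i s \<omega>, x j s \<omega>)) (borel \<Otimes>\<^sub>M borel) (\<lambda>\<omega>. (inc i s t \<omega>, inc j s t \<omega>))"
    by (rule indep_var_inc[OF assms(1,2)]) measurable
  show "indep_var borel (inc i s t) borel (inc j s t)"
    by (rule inc_indep[OF assms(1,2) ij])
qed (use assms inc_distr in auto)

text \<open>The drift is nonnegative, so each particle stays to the right of its driftless version.
  The integrated equation at time 0 forces the initial value of w to be 0.\<close>

lemma AE_x_ge: "AE \<omega> in M. w i 0 \<omega> = 0 \<and> (\<forall>t\<ge>0. x i 0 \<omega> + inc i 0 t \<omega> \<le> x i t \<omega>)"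
  using x_eq
proof eventually_elim
  case (elim \<omega>)
  then have "x i 0 \<omega> = x i 0 \<omega> + b * (LBINT u=0..0. (if has_rank (\<lambda>j. x j u \<omega>) i 1 then 1 else 0)) + w i 0 \<omega>"
    by (metis order_refl zero_ereal_def)
  then have 0: "w i 0 \<omega> = 0" by simp
  moreover have "x i 0 \<omega> + w i t \<omega> \<le> x i t \<omega>" if "0 \<le> t" for t
  proof -
    have "0 \<le> (LBINT u=0..t. (if has_rank (\<lambda>j. x j u \<omega>) i 1 then 1 else 0 :: real))"
      using that by (subst interval_lebesgue_integral_le_eq) (auto simp: set_lebesgue_integral_def indicator_def intro!: integral_nonneg_AE)
    then have "0 \<le> b * (LBINT u=0..t. (if has_rank (\<lambda>j. x j u \<omega>) i 1 then 1 else 0 :: real))"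
      using b_pos by simp
    moreover have "x i t \<omega> = x i 0 \<omega> + b * (LBINT u=0..t. (if has_rank (\<lambda>j. x j u \<omega>) i 1 then 1 else 0)) + w i t \<omega>"
      using elim that by blast
    ultimately show ?thesis by linarith
  qed
  ultimately show ?case by simp
qed

text \<open>Drift to the right only decreases exp(-x), so the driftless moment is an upper
  bound.\<close>

lemma exp_moment:
  assumes "0 \<le> t" "t \<le> 1"
  shows "(\<Sum>i. \<integral>\<^sup>+\<omega>. ennreal (exp (- x i t \<omega>)) \<partial>M) \<le> ennreal S"
proof -
  have lb: "0 \<le> lam * b" using lam_pos b_pos by simp
  show ?thesis
  proof (cases "t = 0")
    case True
    have "lam * b * 1 \<le> S" unfolding S_def using lb by (intro mult_left_mono) auto
    then show ?thesis using True by (simp add: exp_moment_0 ennreal_leI)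
  next
    case False
    with assms have t: "0 < t" by simp
    interpret g: gaussian_step M "\<lambda>i. x i 0" "\<lambda>i. inc i 0 t" "t - 0" "lam * b"
      using t lb by (intro gaussian_step) (auto simp: exp_moment_0)
    have "(\<Sum>i. \<integral>\<^sup>+\<omega>. ennreal (exp (- x i t \<omega>)) \<partial>M) \<le> (\<Sum>i. \<integral>\<^sup>+\<omega>. ennreal (exp (- (x i 0 \<omega> + inc i 0 t \<omega>))) \<partial>M)"
    proof (intro suminf_le summableI nn_integral_mono_AE)
      fix i show "AE \<omega> in M. ennreal (exp (- x i t \<omega>)) \<le> ennreal (exp (- (x i 0 \<omega> + inc i 0 t \<omega>)))"
        using AE_x_ge[of i]
      proof eventually_elim
        case (elim \<omega>)
        with assms(1) have "x i 0 \<omega> + inc i 0 t \<omega> \<le> x i t \<omega>" by blast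
        then show ?case by (intro ennreal_leI) simp
      qed
    qed
    also have "\<dots> \<le> ennreal (exp ((t - 0) / 2) * (lam * b))" by (rule g.exp_moment_U_D)
    also have "\<dots> \<le> ennreal S"
      unfolding S_def using assms lb by (intro ennreal_leI) (simp add: mult_left_mono mult.commute)
    finally show ?thesis .
  qed
qed

lemma step:
  assumes "0 \<le> s" "s < t" "t \<le> 1"
  shows "gaussian_step M (\<lambda>i. x i s) (\<lambda>i. inc i s t) (t - s) S"
  using assms S_pos by (intro gaussian_step exp_moment) auto

lemma AE_summable:
  assumes "0 \<le> t" "t \<le> 1" shows "AE \<omega> in M. summable (\<lambda>i. exp (- x i t \<omega>))"
  using AE_summable_exp[OF x_measurable[OF assms(1)] exp_moment[OF assms]] .

definition A :: "real \<Rightarrow> real \<Rightarrow> 'a \<Rightarrow> real" where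
  "A t z \<omega> = (\<Sum>i. pos_part (z - x i t \<omega>)) / b"

definition HA :: "real \<Rightarrow> real \<Rightarrow> real \<Rightarrow> 'a \<Rightarrow> real" where
  "HA h t z \<omega> = (\<Sum>i. heat h pos_part (z - x i t \<omega>)) / b"

definition free :: "real \<Rightarrow> real \<Rightarrow> real \<Rightarrow> 'a \<Rightarrow> real" where
  "free s t z \<omega> = (\<Sum>i. pos_part (z - x i s \<omega> - inc i s t \<omega>)) / b"

definition noise :: "real \<Rightarrow> real \<Rightarrow> real \<Rightarrow> 'a \<Rightarrow> real" where
  "noise s t z \<omega> = \<bar>free s t z \<omega> - HA (t - s) s z \<omega>\<bar>"

lemma A_measurable: "0 \<le> t \<Longrightarrow> (\<lambda>p. A t (snd p) (fst p)) \<in> borel_measurable (M \<Otimes>\<^sub>M borel)"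
  unfolding A_def using x_measurable by measurable

lemma A_measurable' : "0 \<le> t \<Longrightarrow> A t z \<in> borel_measurable M"
  unfolding A_def[abs_def] using x_measurable by measurable

lemma HA_measurable: "0 \<le> t \<Longrightarrow> 0 < h \<Longrightarrow> HA h t z \<in> borel_measurable M"
  unfolding HA_def[abs_def] using x_measurable by measurable

lemma noise_measurable: "0 \<le> s \<Longrightarrow> s < t \<Longrightarrow> noise s t z \<in> borel_measurable M"
  unfolding noise_def[abs_def] free_def[abs_def] using HA_measurable[of s "t - s" z] x_measurable w_measurable by measurable

text \<open>The second moment of the unscaled fluctuation is of order b; dividing by b leaves an L^1
  size of order 1 / sqrt b.\<close>

lemma noise_bound:
  assumes "0 \<le> s" "s < t" "t \<le> 1"
  shows "(\<integral>\<^sup>+\<omega>. ennreal (noise s t z \<omega>) \<partial>M) \<le> ennreal (sqrt (2 * exp 1 * lam / b * exp z))"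
proof -
  interpret g: gaussian_step M "\<lambda>i. x i s" "\<lambda>i. inc i s t" "t - s" S by (rule step[OF assms])
  have eq: "noise s t z \<omega> = \<bar>g.free z \<omega> - g.heated z \<omega>\<bar> / b" for \<omega>
    using b_pos by (simp add: noise_def free_def HA_def g.free_def g.heated_def diff_divide_distrib[symmetric])
  have [measurable]: "g.free z \<in> borel_measurable M" "g.heated z \<in> borel_measurable M"
    unfolding g.free_def[abs_def] g.heated_def[abs_def] by measurable
  have "(\<integral>\<^sup>+\<omega>. ennreal (noise s t z \<omega>) \<partial>M) = (\<integral>\<^sup>+\<omega>. ennreal (1 / b) * ennreal \<bar>g.free z \<omega> - g.heated z \<omega>\<bar> \<partial>M)"
    unfolding eq using b_pos by (intro nn_integral_cong) (simp add: ennreal_mult'[symmetric])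
  also have "\<dots> = ennreal (1 / b) * (\<integral>\<^sup>+\<omega>. ennreal \<bar>g.free z \<omega> - g.heated z \<omega>\<bar> \<partial>M)"
    by (rule nn_integral_cmult) measurable
  also have "\<dots> \<le> ennreal (1 / b) * ennreal (sqrt (2 * exp ((t - s) / 2) * exp z * S))"
    by (intro mult_left_mono g.noise_bound) simp
  also have "\<dots> = ennreal (1 / b * sqrt (2 * exp ((t - s) / 2) * exp z * S))"
    using b_pos by (simp add: ennreal_mult'[symmetric])
  also have "1 / b * sqrt (2 * exp ((t - s) / 2) * exp z * S) \<le> 1 / b * sqrt (2 * exp (1 / 2) * exp z * S)"
    using b_pos S_pos assms by (intro mult_left_mono iffD2[OF real_sqrt_le_iff] mult_right_mono) auto
  also have "\<dots> = sqrt (2 * exp (1 / 2) * exp z * S / b\<^sup>2)"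
    using b_pos by (simp add: real_sqrt_divide)
  also have "2 * exp (1 / 2) * exp z * S / b\<^sup>2 = 2 * exp 1 * lam / b * exp z"
    using b_pos by (simp add: S_def power2_eq_square field_simps exp_add[symmetric])
  finally show ?thesis by (simp add: ennreal_leI)
qed

end

section \<open>The drift received during one time step\<close>

lemma emeasure_Ioc_subset_finite:
  fixes s t :: real
  assumes "L \<subseteq> {s<..t}" shows "emeasure lborel L < \<infinity>"
proof (cases "s \<le> t")
  case True
  have "emeasure lborel L \<le> emeasure lborel {s<..t}" using assms by (intro emeasure_mono) auto
  then show ?thesis using True by (auto simp: less_top[symmetric] top_unique)
next
  case False
  then have "L = {}" using assms by auto
  then show ?thesis by simp
qed

lemma measure_Ioc_subset_le:
  fixes s t :: real
  assumes "L \<subseteq> {s<..t}" "s \<le> t" shows "measure lborel L \<le> t - s"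
proof (cases "L \<in> sets lborel")
  case True
  have "measure lborel L \<le> measure lborel {s<..t}"
    using assms by (intro measure_mono_fmeasurable) (auto simp: fmeasurable_def True[simplified])
  then show ?thesis using assms by simp
qed (use assms in \<open>simp add: measure_notin_sets\<close>)

text \<open>The set on the left has no points after the time, found by the intermediate value theorem, at
  which the displacement reaches \<open>z\<close>.\<close>

lemma drift_gain:
  fixes L :: "real set"
  assumes L [measurable]: "L \<in> sets lborel" and sub: "L \<subseteq> {s<..t}" and "s \<le> t" and b: "0 < b"
  shows "b * measure lborel {u\<in>L. b * measure lborel (L \<inter> {s<..u}) < z}
    \<le> pos_part z - pos_part (z - b * measure lborel L)"
proof -
  define f where "f u = b * measure lborel (L \<inter> {s<..u})" for u
  have Lb [measurable]: "L \<in> sets borel" using L by simp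
  have fin: "emeasure lborel (L \<inter> X) < \<infinity>" for X
    using emeasure_Ioc_subset_finite[of "L \<inter> X" s t] sub by auto
  have mono: "f u \<le> f v" if "u \<le> v" for u v
    unfolding f_def using b that fin
    by (intro mult_left_mono measure_mono_fmeasurable) (auto simp: fmeasurable_def)
  have lip: "f v \<le> f u + b * (v - u)" if "u \<le> v" for u v
  proof -
    have "measure lborel (L \<inter> {s<..v}) \<le> measure lborel (L \<inter> {s<..u} \<union> {u<..v})"
      using that fin[of "{s<..u}"]
      by (intro measure_mono_fmeasurable fmeasurable.Un) (auto simp: fmeasurable_def)
    also have "\<dots> \<le> measure lborel (L \<inter> {s<..u}) + measure lborel {u<..v}"
      by (intro measure_Un_le) auto
    also have "measure lborel {u<..v} = v - u" using that by simp
    finally have "b * measure lborel (L \<inter> {s<..v}) \<le> b * (measure lborel (L \<inter> {s<..u}) + (v - u))"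
      using b by (intro mult_left_mono) auto
    then show ?thesis by (simp add: f_def distrib_left)
  qed
  have ft: "f t = b * measure lborel L"
  proof -
    have "L \<inter> {s<..t} = L" using sub by auto
    then show ?thesis by (simp add: f_def)
  qed
  have fs: "f s = 0" by (simp add: f_def)
  have cont: "isCont f u" for u
    unfolding continuous_at_eps_delta
  proof (intro allI impI)
    fix e :: real assume e: "0 < e"
    show "\<exists>d>0. \<forall>v. dist v u < d \<longrightarrow> dist (f v) (f u) < e"
    proof (intro exI[of _ "e / b"] conjI allI impI)
      show "0 < e / b" using e b by simp
      fix v assume "dist v u < e / b"
      then have "b * \<bar>v - u\<bar> < e" using b by (simp add: dist_real_def pos_less_divide_eq mult.commute)
      moreover have "\<bar>f v - f u\<bar> \<le> b * \<bar>v - u\<bar>"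
        using mono[of u v] mono[of v u] lip[of u v] lip[of v u] by (cases "u \<le> v") (auto simp: abs_if)
      ultimately show "dist (f v) (f u) < e" by (simp add: dist_real_def)
    qed
  qed
  have meas: "{u\<in>L. f u < z} \<in> sets lborel"
  proof -
    have [measurable]: "f \<in> borel_measurable borel" by (rule borel_measurable_mono) (simp add: mono_def mono)
    have "{u\<in>L. f u < z} = L \<inter> {u. f u < z}" by auto
    also have "\<dots> \<in> sets lborel" using L by (intro sets.Int) auto
    finally show ?thesis .
  qed
  have "b * measure lborel {u\<in>L. f u < z} \<le> pos_part z - pos_part (z - f t)"
  proof -
    consider "z \<le> 0" | "0 < z" "f t \<le> z" | "0 < z" "z < f t" by linarith
    then show ?thesis
    proof cases
      case 1
      have "0 \<le> f u" for u using b by (simp add: f_def)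
      then have e: "{u\<in>L. f u < z} = {}" using 1 by (auto simp: not_less intro: order_trans)
      show ?thesis unfolding e using pos_part_mono[of "z - f t" z] \<open>0 \<le> f t\<close> by simp
    next
      case 2
      have "measure lborel {u\<in>L. f u < z} \<le> measure lborel L"
        using meas fin[of UNIV] Lb by (intro measure_mono_fmeasurable) (auto simp: fmeasurable_def)
      then have "b * measure lborel {u\<in>L. f u < z} \<le> f t" using b by (simp add: ft)
      then show ?thesis using 2 by (simp add: pos_part_def)
    next
      case 3
      have "\<exists>v\<ge>s. v \<le> t \<and> f v = z"
        using 3 fs \<open>s \<le> t\<close> by (intro IVT) (auto intro: cont)
      then obtain v where v: "s \<le> v" "v \<le> t" "f v = z" by blast
      have "u < v" if "f u < z" for u using mono[of v u] v(3) that by (meson not_le)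
      then have "{u\<in>L. f u < z} \<subseteq> L \<inter> {s<..v}" using sub by force
      then have "measure lborel {u\<in>L. f u < z} \<le> measure lborel (L \<inter> {s<..v})"
        using meas fin by (intro measure_mono_fmeasurable) (auto simp: fmeasurable_def)
      then have "b * measure lborel {u\<in>L. f u < z} \<le> f v" using b by (simp add: f_def)
      then show ?thesis using v 3 by (simp add: pos_part_def)
    qed
  qed
  then show ?thesis unfolding ft unfolding f_def .
qed

context fast_atlas
begin

definition lead :: "nat \<Rightarrow> real \<Rightarrow> 'a \<Rightarrow> bool" where
  "lead i u \<omega> \<longleftrightarrow> has_rank (\<lambda>j. x j u \<omega>) i 1"

definition leadset :: "nat \<Rightarrow> real \<Rightarrow> real \<Rightarrow> 'a \<Rightarrow> real set" where
  "leadset i s t \<omega> = {u\<in>{s<..t}. lead i u \<omega>}"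

text \<open>Times in the step whose drift does not reduce \<open>A t z\<close>: the position of a particle at time \<open>t\<close>,
  disregarding drift received after time \<open>u\<close>, is \<open>x i u + inc i u t\<close>.\<close>

definition bad :: "real \<Rightarrow> real \<Rightarrow> real \<Rightarrow> 'a \<Rightarrow> real set" where
  "bad s t z \<omega> = {u\<in>{s<..t}. \<not> (\<exists>i. lead i u \<omega> \<and> x i u \<omega> + inc i u t \<omega> < z)}"

lemma lead_pred: 
  assumes [measurable]: "\<And>j. x j u \<in> borel_measurable N"
  shows "Measurable.pred N (\<lambda>\<omega>. lead i u \<omega>)"
  unfolding lead_def has_rank_1_iff ranked_before_def by measurable

lemma leadset_measurable:
  assumes "\<And>i. continuous_on {0..} (\<lambda>t. x i t \<omega>)" "0 \<le> s"
  shows "leadset i s t \<omega> \<in> sets lborel"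
proof -
  define y where "y j u = x j (max 0 u) \<omega>" for j u
  have "continuous_on UNIV (y j)" for j
    unfolding y_def by (rule continuous_on_compose2[OF assms(1)]) (auto intro!: continuous_intros)
  then have [measurable]: "y j \<in> borel_measurable borel" for j
    by (rule borel_measurable_continuous_onI)
  have "leadset i s t \<omega> = {u\<in>space borel. s < u \<and> u \<le> t \<and> (\<forall>j. \<not> ranked_before (\<lambda>j. y j u) j i)}"
    unfolding leadset_def lead_def has_rank_1_iff using assms(2) by (auto simp: y_def)
  also have "\<dots> \<in> sets borel" unfolding ranked_before_def by measurable
  finally show ?thesis by simp
qed

definition drift :: "nat \<Rightarrow> real \<Rightarrow> real \<Rightarrow> 'a \<Rightarrow> real" where
  "drift i s t \<omega> = b * measure lborel (leadset i s t \<omega>)"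

text \<open>The exceptional set does not depend on the particle or on the two times; the analysis of
  a step evaluates the identity at all intermediate times of the same path.\<close>

lemma AE_decomp:
  "AE \<omega> in M. \<forall>i s t. 0 \<le> s \<longrightarrow> s \<le> t \<longrightarrow> leadset i s t \<omega> \<in> sets lborel \<and> x i t \<omega> = x i s \<omega> + drift i s t \<omega> + inc i s t \<omega>"
  using x_continuous x_eq
proof eventually_elim
  case (elim \<omega>)
  have meas: "leadset i s t \<omega> \<in> sets lborel" if "0 \<le> s" for i s t
    using elim(1) that by (intro leadset_measurable) auto
  have fin: "emeasure lborel (leadset i s t \<omega>) < \<infinity>" for i s t
    by (rule emeasure_Ioc_subset_finite) (auto simp: leadset_def)
  have eq0: "x i t \<omega> = x i 0 \<omega> + drift i 0 t \<omega> + w i t \<omega>" if "0 \<le> t" for i t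
  proof -
    have "(LBINT u=0..t. (if has_rank (\<lambda>j. x j u \<omega>) i 1 then 1 else 0 :: real))
      = (LBINT u:{0<..t}. (if has_rank (\<lambda>j. x j u \<omega>) i 1 then 1 else 0))"
      using that interval_integral_Ioc[of 0 t] by (simp add: zero_ereal_def)
    also have "\<dots> = (\<integral>u. indicator (leadset i 0 t \<omega>) u \<partial>lborel)"
      unfolding set_lebesgue_integral_def by (intro Bochner_Integration.integral_cong) (auto simp: leadset_def lead_def indicator_def)
    also have "\<dots> = measure lborel (leadset i 0 t \<omega>)" using meas[of 0 i t] by simp
    finally have "(LBINT u=0..t. (if has_rank (\<lambda>j. x j u \<omega>) i 1 then 1 else 0 :: real)) = measure lborel (leadset i 0 t \<omega>)" .
    moreover have "x i t \<omega> = x i 0 \<omega> + b * (LBINT u=0..t. (if has_rank (\<lambda>j. x j u \<omega>) i 1 then 1 else 0)) + w i t \<omega>"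
      using elim(2) that by blast
    ultimately show ?thesis by (simp only: drift_def)
  qed
  show ?case
  proof (intro allI impI conjI meas)
    fix i s t assume st: "0 \<le> s" "s \<le> (t :: real)"
    have "leadset i 0 t \<omega> = leadset i 0 s \<omega> \<union> leadset i s t \<omega>"
      using st by (auto simp: leadset_def)
    then have "measure lborel (leadset i 0 t \<omega>) = measure lborel (leadset i 0 s \<omega>) + measure lborel (leadset i s t \<omega>)"
      using meas st fin by (simp add: less_top[symmetric]) (subst measure_Union, auto simp: leadset_def less_top[symmetric])
    then have "drift i 0 t \<omega> = drift i 0 s \<omega> + drift i s t \<omega>"
      by (simp add: drift_def distrib_left)
    then show "x i t \<omega> = x i s \<omega> + drift i s t \<omega> + inc i s t \<omega>"
      using eq0[of t i] eq0[of s i] st by simp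
  qed
qed

text \<open>Moving a particle to the right by its drift lowers its positive part by at least 0 and
  at most that drift, and the total drift is b times at most t - s. The third bound applies
  \<open>drift_gain\<close> to each particle: all drift received outside the bad times lowers the
  sum in full.\<close>

lemma AE_one_step:
  assumes st: "0 \<le> s" "s < t" "t \<le> 1"
  shows "AE \<omega> in M. \<forall>z. A t z \<omega> \<le> free s t z \<omega> \<and> free s t z \<omega> - (t - s) \<le> A t z \<omega> \<and>
      A t z \<omega> \<le> free s t z \<omega> - (t - s) + measure lborel (bad s t z \<omega>) \<and> bad s t z \<omega> \<in> sets lborel"
proof -
  interpret g: gaussian_step M "\<lambda>i. x i s" "\<lambda>i. inc i s t" "t - s" S by (rule step[OF st])
  have t0: "0 \<le> t" using st by simp
  show ?thesis
    using AE_decomp AE_summable[OF t0 st(3)] g.AE_summable_U_D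
  proof eventually_elim
    case (elim \<omega>)
    show ?case
    proof (intro allI)
      fix z
      define v where "v i = z - x i s \<omega> - inc i s t \<omega>" for i
      define L where "L i = leadset i s t \<omega>" for i
      \<comment> \<open>The part of the leading time of particle i whose drift counts: with the
        drift received so far, but none later, the particle would end the step to the left of
        z.\<close>
      define G where "G i = {u\<in>L i. b * measure lborel (L i \<inter> {s<..u}) < v i}" for i
      have L: "L i \<in> sets lborel" "L i \<subseteq> {s<..t}" for i
      proof -
        show "L i \<in> sets lborel" unfolding L_def using elim(1) st less_imp_le by blast
        show "L i \<subseteq> {s<..t}" by (auto simp: L_def leadset_def)
      qed
      have xt: "z - x i t \<omega> = v i - b * measure lborel (L i)" for i
      proof -
        have "x i t \<omega> = x i s \<omega> + drift i s t \<omega> + inc i s t \<omega>" using elim(1) st less_imp_le by blast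
        then show ?thesis by (simp add: v_def L_def drift_def)
      qed
      have Gi: "u \<in> G i \<longleftrightarrow> u \<in> {s<..t} \<and> lead i u \<omega> \<and> x i u \<omega> + inc i u t \<omega> < z" for u i
      proof -
        have "b * measure lborel (L i \<inter> {s<..u}) < v i \<longleftrightarrow> x i u \<omega> + inc i u t \<omega> < z" if u: "u \<in> {s<..t}"
        proof -
          have "L i \<inter> {s<..u} = leadset i s u \<omega>" using u by (auto simp: L_def leadset_def)
          moreover have "x i u \<omega> = x i s \<omega> + drift i s u \<omega> + inc i s u \<omega>"
            using elim(1) st(1) u less_imp_le unfolding greaterThanAtMost_iff by blast
          ultimately show ?thesis by (auto simp: v_def drift_def)
        qed
        then show ?thesis by (auto simp: G_def L_def leadset_def)
      qed
      have Gmeas: "G i \<in> sets lborel" for i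
      proof -
        have "mono (\<lambda>u. b * measure lborel (L i \<inter> {s<..u}))"
          unfolding mono_def using b_pos L(1)[of i] emeasure_Ioc_subset_finite[of "L i \<inter> X" s t for X, OF order_trans[OF Int_lower1 L(2)]]
          by (intro allI impI mult_left_mono measure_mono_fmeasurable) (auto simp: fmeasurable_def)
        then have [measurable]: "(\<lambda>u. b * measure lborel (L i \<inter> {s<..u})) \<in> borel_measurable borel"
          by (rule borel_measurable_mono)
        have "G i = L i \<inter> {u. b * measure lborel (L i \<inter> {s<..u}) < v i}" by (auto simp: G_def)
        also have "\<dots> \<in> sets lborel" using L by (intro sets.Int) auto
        finally show ?thesis .
      qed
      \<comment> \<open>Only one particle leads at a time, so the leading times are disjoint and
        their lengths add up to at most t - s.\<close>
      have disj: "disjoint_family L" 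
        by (auto simp: disjoint_family_on_def L_def leadset_def lead_def dest: has_rank_1_unique[unfolded One_nat_def])
      have Gsub: "G i \<subseteq> L i" for i by (auto simp: G_def)
      have disjG: "disjoint_family G"
        using disj Gsub unfolding disjoint_family_on_def by blast
      have UL: "(\<Union>i. L i) \<subseteq> {s<..t}" "(\<Union>i. G i) \<subseteq> {s<..t}" using L Gsub by blast+
      have sL: "(\<lambda>i. measure lborel (L i)) sums measure lborel (\<Union>i. L i)"
        using emeasure_Ioc_subset_finite[OF UL(1)] L disj by (intro measure_UNION) (auto simp: less_top)
      have sG: "(\<lambda>i. measure lborel (G i)) sums measure lborel (\<Union>i. G i)"
        using emeasure_Ioc_subset_finite[OF UL(2)] Gmeas disjG by (intro measure_UNION) (auto simp: less_top)
      have sA: "(\<lambda>i. pos_part (z - x i t \<omega>)) sums (b * A t z \<omega>)"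
        using summable_pos_part[of "\<lambda>i. x i t \<omega>" z] elim(2) st b_pos by (simp add: A_def summable_sums)
      have sF: "(\<lambda>i. pos_part (v i)) sums (b * free s t z \<omega>)"
        using summable_pos_part[of "\<lambda>i. x i s \<omega> + inc i s t \<omega>" z] elim(3) b_pos by (simp add: free_def v_def diff_diff_eq summable_sums)
      have p1: "pos_part (z - x i t \<omega>) \<le> pos_part (v i)" for i
        unfolding xt using b_pos by (intro pos_part_mono) simp
      have p2: "pos_part (v i) - b * measure lborel (L i) \<le> pos_part (z - x i t \<omega>)" for i
      proof -
        have "0 \<le> b * measure lborel (L i)" using b_pos by simp
        then show ?thesis unfolding xt pos_part_def by linarith
      qed
      have p3: "pos_part (z - x i t \<omega>) \<le> pos_part (v i) - b * measure lborel (G i)" for i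
        using drift_gain[OF L(1) L(2) _ b_pos, of i "v i"] st unfolding xt G_def by simp
      have "b * A t z \<omega> \<le> b * free s t z \<omega>" by (rule sums_le[OF p1 sA sF])
      then have 1: "A t z \<omega> \<le> free s t z \<omega>" using b_pos by simp
      have "b * free s t z \<omega> - b * measure lborel (\<Union>i. L i) \<le> b * A t z \<omega>"
        by (rule sums_le[OF p2 sums_diff[OF sF sums_mult[OF sL]] sA])
      then have "b * (free s t z \<omega> - measure lborel (\<Union>i. L i)) \<le> b * A t z \<omega>" by (simp add: right_diff_distrib)
      then have "free s t z \<omega> - measure lborel (\<Union>i. L i) \<le> A t z \<omega>" using b_pos by simp
      then have 2: "free s t z \<omega> - (t - s) \<le> A t z \<omega>"
        using measure_Ioc_subset_le[OF UL(1)] st by simp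
      have "b * A t z \<omega> \<le> b * free s t z \<omega> - b * measure lborel (\<Union>i. G i)"
        by (rule sums_le[OF p3 sA sums_diff[OF sF sums_mult[OF sG]]])
      then have "b * A t z \<omega> \<le> b * (free s t z \<omega> - measure lborel (\<Union>i. G i))" by (simp add: right_diff_distrib)
      then have 3: "A t z \<omega> \<le> free s t z \<omega> - measure lborel (\<Union>i. G i)" using b_pos by simp
      have badeq: "bad s t z \<omega> = {s<..t} - (\<Union>i. G i)"
        unfolding bad_def using Gi by auto
      have UG: "(\<Union>i. G i) \<in> sets lborel" using Gmeas by blast
      have 4: "measure lborel (bad s t z \<omega>) = (t - s) - measure lborel (\<Union>i. G i)"
        unfolding badeq using UG UL st by (subst measure_Diff) auto
      have 5: "bad s t z \<omega> \<in> sets lborel" unfolding badeq using UG by auto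
      from 1 2 3 4 5 show "A t z \<omega> \<le> free s t z \<omega> \<and> free s t z \<omega> - (t - s) \<le> A t z \<omega> \<and>
        A t z \<omega> \<le> free s t z \<omega> - (t - s) + measure lborel (bad s t z \<omega>) \<and> bad s t z \<omega> \<in> sets lborel"
        by simp
    qed
  qed
qed

end

section \<open>Times at which the drift does not lower the profile\<close>

lemma emeasure_Markov_real:
  assumes [measurable]: "f \<in> borel_measurable M" and "0 < c" "0 \<le> C" and f: "(\<integral>\<^sup>+\<omega>. ennreal (f \<omega>) \<partial>M) \<le> ennreal C"
  shows "emeasure M {\<omega>\<in>space M. c \<le> f \<omega>} \<le> ennreal (C / c)"
proof -
  have eq: "1 \<le> ennreal (1 / c) * ennreal y \<longleftrightarrow> c \<le> y" for y
  proof -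
    have "ennreal (1 / c) * ennreal y = ennreal (y / c)"
      using ennreal_mult'[of "1 / c" y] assms(2) by simp
    then show ?thesis
      unfolding ennreal_1[symmetric] using assms(2) by (auto simp: ennreal_le_iff2 pos_le_divide_eq simp del: ennreal_1)
  qed
  have "emeasure M {\<omega>\<in>space M. c \<le> f \<omega>} = emeasure M {\<omega>\<in>space M. 1 \<le> ennreal (1 / c) * ennreal (f \<omega>)}"
    unfolding eq ..
  also have "\<dots> \<le> ennreal (1 / c) * (\<integral>\<^sup>+\<omega>. ennreal (f \<omega>) * indicator (space M) \<omega> \<partial>M)"
    by (rule nn_integral_Markov_inequality) auto
  also have "(\<integral>\<^sup>+\<omega>. ennreal (f \<omega>) * indicator (space M) \<omega> \<partial>M) = (\<integral>\<^sup>+\<omega>. ennreal (f \<omega>) \<partial>M)"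
    by (intro nn_integral_cong) auto
  also have "ennreal (1 / c) * \<dots> \<le> ennreal (1 / c) * ennreal C"
    by (intro mult_left_mono f) simp
  also have "\<dots> = ennreal (C / c)" using assms by (simp add: ennreal_mult'[symmetric])
  finally show ?thesis .
qed

text \<open>A majorant, for h \<le> 1, of the coefficient in
  \<open>heat_pos_part_diff_le\<close>.\<close>

definition modulus :: "real \<Rightarrow> real \<Rightarrow> real" where
  "modulus h a = exp 2 * (sqrt h + a)"

context fast_atlas
begin

lemma AE_lead_exists:
  assumes "0 \<le> u" "u \<le> 1" shows "AE \<omega> in M. \<exists>i. lead i u \<omega>"
  using AE_summable[OF assms]
proof eventually_elim
  case (elim \<omega>)
  show ?case unfolding lead_def by (rule has_rank_1_exists) (rule finite_below_if_summable[OF elim])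
qed

text \<open>Which particle leads at time u is known at time u, so the later increment of the leader
  is as small as that of a fixed particle. Summing over the disjoint events that particle i leads
  costs no factor.\<close>

lemma prob_lead_inc_ge:
  assumes u: "0 \<le> u" "u < t" and a: "0 < a"
  shows "emeasure M {\<omega>\<in>space M. \<exists>i. lead i u \<omega> \<and> a \<le> inc i u t \<omega>} \<le> ennreal ((t - u) / a\<^sup>2)"
proof -
  have sp: "space (F u) = space M" using F_subalgebra[OF u(1)] by (simp add: subalgebra_def)
  have [measurable]: "w l u \<in> borel_measurable M" "w l t \<in> borel_measurable M" for l
    using u by (auto intro: w_measurable)
  have [measurable]: "Measurable.pred M (\<lambda>\<omega>. lead i u \<omega>)" for i
    by (rule lead_pred) (rule x_measurable[OF u(1)])
  define q where "q = (t - u) / a\<^sup>2"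
  have q: "0 \<le> q" using u by (simp add: q_def)
  define E where "E i = {\<omega>\<in>space M. lead i u \<omega>}" for i
  have EF: "E i \<in> sets (F u)" for i
    using lead_pred[OF x_adapted[OF u(1)], of i] unfolding E_def pred_def sp .
  have EM: "E i \<in> events" for i unfolding E_def by measurable
  have one: "emeasure M {\<omega>\<in>space M. lead i u \<omega> \<and> a \<le> inc i u t \<omega>} \<le> ennreal q * emeasure M (E i)" for i
  proof -
    \<comment> \<open>A pair with equal components, because \<open>inc_future\<close> speaks of
      pairs of increments.\<close>
    let ?Q = "\<lambda>\<omega>. (inc i u t \<omega>, inc i u t \<omega>)"
    let ?B = "?Q -` {p. a \<le> fst p} \<inter> space M"
    have B: "?B \<in> sets (vimage_algebra (space M) ?Q (borel \<Otimes>\<^sub>M borel))"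
    proof (rule in_vimage_algebra)
      have "{p\<in>space (borel \<Otimes>\<^sub>M borel). a \<le> fst p} \<in> sets (borel \<Otimes>\<^sub>M borel :: (real \<times> real) measure)" by measurable
      then show "{p. a \<le> fst p} \<in> sets (borel \<Otimes>\<^sub>M borel :: (real \<times> real) measure)" by (simp add: space_pair_measure)
    qed
    have prod: "prob (E i \<inter> ?B) = prob (E i) * prob ?B"
      by (rule indep_setD[OF inc_future[OF u] EF B])
    have "prob ?B = measure (distr M borel (inc i u t)) {a..}"
      by (subst measure_distr) (auto intro!: arg_cong[where f = prob])
    also have "\<dots> \<le> q"
      unfolding inc_distr[OF u] q_def using u a by (intro gauss_tail) auto
    finally have "prob (E i) * prob ?B \<le> prob (E i) * q" by (rule mult_left_mono) simp
    then have "prob (E i \<inter> ?B) \<le> q * prob (E i)" unfolding prod by (simp only: mult.commute)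
    moreover have "E i \<inter> ?B = {\<omega>\<in>space M. lead i u \<omega> \<and> a \<le> inc i u t \<omega>}" by (auto simp: E_def)
    ultimately show ?thesis using q by (simp add: emeasure_eq_measure ennreal_mult'[symmetric] ennreal_leI)
  qed
  have "{\<omega>\<in>space M. \<exists>i. lead i u \<omega> \<and> a \<le> inc i u t \<omega>} = (\<Union>i. {\<omega>\<in>space M. lead i u \<omega> \<and> a \<le> inc i u t \<omega>})" by auto
  then have "emeasure M {\<omega>\<in>space M. \<exists>i. lead i u \<omega> \<and> a \<le> inc i u t \<omega>} \<le> (\<Sum>i. emeasure M {\<omega>\<in>space M. lead i u \<omega> \<and> a \<le> inc i u t \<omega>})"
    by (simp only:) (rule emeasure_subadditive_countably, auto)
  also have "\<dots> \<le> (\<Sum>i. ennreal q * emeasure M (E i))"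
    by (intro suminf_le summableI one)
  also have "\<dots> = ennreal q * (\<Sum>i. emeasure M (E i))" by simp
  also have "(\<Sum>i. emeasure M (E i)) = emeasure M (\<Union>i. E i)"
    using EM by (intro suminf_emeasure) (auto simp: disjoint_family_on_def E_def lead_def dest: has_rank_1_unique[unfolded One_nat_def])
  also have "\<dots> \<le> 1" by (rule emeasure_le_1)
  finally show ?thesis by (simp add: q_def mult_left_mono)
qed

lemma A_le_HA:
  assumes "0 < h" "summable (\<lambda>i. exp (- x i t \<omega>))" shows "A t z \<omega> \<le> HA h t z \<omega>"
  unfolding A_def HA_def using b_pos
  by (intro divide_right_mono suminf_le heat_pos_part_ge[OF assms(1)] summable_heat_pos_part summable_pos_part assms) simp

lemma heat_diff_le_modulus:
  assumes "0 < h" "h \<le> 1" "0 \<le> a"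
  shows "heat h pos_part z - pos_part (z - a) \<le> modulus h a * exp z"
proof -
  have "heat h pos_part z - pos_part (z - a) \<le> (sqrt h * (1 + exp (2 * h)) / 2 + a * exp (h / 2)) * exp z"
    by (rule heat_pos_part_diff_le[OF assms(1,3)])
  also have "\<dots> \<le> modulus h a * exp z"
  proof (intro mult_right_mono)
    have "sqrt h * ((1 + exp (2 * h)) / 2) \<le> sqrt h * exp 2"
    proof (intro mult_left_mono)
      have "exp (2 * h) \<le> exp 2" "1 \<le> exp (2 :: real)" using assms by auto
      moreover have "(1 + E) / 2 \<le> K" if "E \<le> K" "1 \<le> K" for E K :: real using that by simp
      ultimately show "(1 + exp (2 * h)) / 2 \<le> exp 2" by blast
    qed (use assms in auto)
    moreover have "a * exp (h / 2) \<le> a * exp 2" using assms by (intro mult_left_mono) auto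
    ultimately have "sqrt h * ((1 + exp (2 * h)) / 2) + a * exp (h / 2) \<le> sqrt h * exp 2 + a * exp 2"
      by (rule add_mono)
    moreover have "modulus h a = sqrt h * exp 2 + a * exp 2"
      unfolding modulus_def by algebra
    ultimately show "sqrt h * (1 + exp (2 * h)) / 2 + a * exp (h / 2) \<le> modulus h a"
      by simp
  qed simp
  finally show ?thesis .
qed

text \<open>Each particle contributes at most \<open>modulus\<close> times exp(z - x_i), and the
  exponential moment divided by b is bounded independently of b.\<close>

lemma HA_diff_bound:
  assumes s: "0 \<le> s" "s \<le> 1" and h: "0 < h" "h \<le> 1" and a: "0 \<le> a"
  shows "(\<integral>\<^sup>+\<omega>. ennreal (HA h s z \<omega> - A s (z - a) \<omega>) \<partial>M) \<le> ennreal (lam * exp (1 / 2) * modulus h a * exp z)"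
proof -
  let ?K = "modulus h a * exp z / b"
  have K: "0 \<le> ?K" using h a b_pos by (simp add: modulus_def)
  have "(\<integral>\<^sup>+\<omega>. ennreal (HA h s z \<omega> - A s (z - a) \<omega>) \<partial>M) \<le> (\<integral>\<^sup>+\<omega>. ennreal ?K * (\<Sum>i. ennreal (exp (- x i s \<omega>))) \<partial>M)"
    using AE_summable[OF s]
  proof (intro nn_integral_mono_AE, eventually_elim)
    case (elim \<omega>)
    note sm = elim(2)
    have 1: "(\<lambda>i. heat h pos_part (z - x i s \<omega>) - pos_part (z - a - x i s \<omega>)) sums (b * HA h s z \<omega> - b * A s (z - a) \<omega>)"
      using summable_heat_pos_part[OF h(1) sm, of z] summable_pos_part[OF sm, of "z - a"] b_pos
      by (intro sums_diff) (auto simp: HA_def A_def summable_sums)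
    have 2: "(\<lambda>i. modulus h a * exp z * exp (- x i s \<omega>)) sums (modulus h a * exp z * (\<Sum>i. exp (- x i s \<omega>)))"
      using sm by (intro sums_mult summable_sums)
    have "b * HA h s z \<omega> - b * A s (z - a) \<omega> \<le> modulus h a * exp z * (\<Sum>i. exp (- x i s \<omega>))"
    proof (rule sums_le[OF _ 1 2])
      fix i
      show "heat h pos_part (z - x i s \<omega>) - pos_part (z - a - x i s \<omega>) \<le> modulus h a * exp z * exp (- x i s \<omega>)"
        using heat_diff_le_modulus[OF h a, of "z - x i s \<omega>"] by (simp add: exp_diff exp_minus field_simps diff_right_commute)
    qed
    then have "HA h s z \<omega> - A s (z - a) \<omega> \<le> ?K * (\<Sum>i. exp (- x i s \<omega>))"
      using b_pos by (simp add: field_simps)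
    then have "ennreal (HA h s z \<omega> - A s (z - a) \<omega>) \<le> ennreal ?K * ennreal (\<Sum>i. exp (- x i s \<omega>))"
      using K by (simp add: ennreal_mult'[symmetric] ennreal_leI)
    also have "ennreal (\<Sum>i. exp (- x i s \<omega>)) = (\<Sum>i. ennreal (exp (- x i s \<omega>)))"
      using sm by (intro suminf_ennreal2[symmetric]) auto
    finally show ?case .
  qed
  also have "\<dots> = ennreal ?K * (\<Sum>i. \<integral>\<^sup>+\<omega>. ennreal (exp (- x i s \<omega>)) \<partial>M)"
    using x_measurable[OF s(1)] by (simp add: nn_integral_cmult nn_integral_suminf)
  also have "\<dots> \<le> ennreal ?K * ennreal S" by (intro mult_left_mono exp_moment s) simp
  also have "\<dots> = ennreal (lam * exp (1 / 2) * modulus h a * exp z)"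
    using K b_pos by (simp add: ennreal_mult'[symmetric] S_def ac_simps)
  finally show ?thesis .
qed

definition noise_size :: "real \<Rightarrow> real" where
  "noise_size z = sqrt (2 * exp 1 * lam / b * exp z)"

text \<open>The first term bounds the probability that the leader later moves right by a; the second
  is Markov's inequality at level e / 2 for the noise together with the change of the profile under
  heating and a shift by a.\<close>

definition bad_size :: "real \<Rightarrow> real \<Rightarrow> real \<Rightarrow> real \<Rightarrow> real" where
  "bad_size h a e z = h / a\<^sup>2 + (noise_size (z - a) + lam * exp (1 / 2) * modulus h a * exp z) / (e / 2)"

lemma noise_size_nonneg: "0 \<le> noise_size z"
  using lam_pos b_pos by (simp add: noise_size_def)

lemma modulus_nonneg: "0 \<le> h \<Longrightarrow> 0 \<le> a \<Longrightarrow> 0 \<le> modulus h a"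
  by (simp add: modulus_def)

text \<open>At a bad time u the leader ends at z or beyond without further drift. So either its
  increment after u is at least a, or no particle is left of z - a at time u. In the latter case the
  profile there is 0, hence at time s it was at most the elapsed time plus noise; since the heated
  profile at z is at least e, the noise and the heating error together reach e / 2.\<close>

lemma bad_prob:
  assumes t: "0 \<le> s" "s < u" "u < t" "t \<le> 1" and a: "0 < a" and e: "0 < e" "t - s \<le> e / 2"
  shows "emeasure M {\<omega>\<in>space M. e \<le> HA (t - s) s z \<omega> \<and> u \<in> bad s t z \<omega>} \<le> ennreal (bad_size (t - s) a e z)"
proof -
  define E1 where "E1 = {\<omega>\<in>space M. \<exists>i. lead i u \<omega> \<and> a \<le> inc i u t \<omega>}"
  define f where "f \<omega> = noise s u (z - a) \<omega> + max 0 (HA (t - s) s z \<omega> - A s (z - a) \<omega>)" for \<omega>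
  define E2 where "E2 = {\<omega>\<in>space M. e / 2 \<le> f \<omega>}"
  define C where "C = noise_size (z - a) + lam * exp (1 / 2) * modulus (t - s) a * exp z"
  have u0: "0 \<le> u" using t by simp
  have [measurable]: "w l u \<in> borel_measurable M" "w l t \<in> borel_measurable M" for l
    using t by (auto intro: w_measurable)
  have [measurable]: "x l u \<in> borel_measurable M" for l
    by (rule x_measurable[OF u0])
  have [measurable]: "Measurable.pred M (\<lambda>\<omega>. lead i u \<omega>)" for i
    by (rule lead_pred) measurable
  have [measurable]: "HA (t - s) s z \<in> borel_measurable M" "A s (z - a) \<in> borel_measurable M" "noise s u (z - a) \<in> borel_measurable M"
    using t by (auto intro!: HA_measurable A_measurable' noise_measurable)
  have [measurable]: "f \<in> borel_measurable M" unfolding f_def[abs_def] by measurable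
  have [measurable]: "E1 \<in> events" "E2 \<in> events" unfolding E1_def E2_def by measurable
  have C: "0 \<le> C" unfolding C_def using noise_size_nonneg modulus_nonneg t a lam_pos by (auto intro!: add_nonneg_nonneg)
  have "(\<integral>\<^sup>+\<omega>. ennreal (f \<omega>) \<partial>M) = (\<integral>\<^sup>+\<omega>. ennreal (noise s u (z - a) \<omega>) + ennreal (HA (t - s) s z \<omega> - A s (z - a) \<omega>) \<partial>M)"
    unfolding f_def by (intro nn_integral_cong) (simp add: noise_def ennreal_plus[symmetric] del: ennreal_plus, simp add: max_def ennreal_neg)
  also have "\<dots> = (\<integral>\<^sup>+\<omega>. ennreal (noise s u (z - a) \<omega>) \<partial>M) + (\<integral>\<^sup>+\<omega>. ennreal (HA (t - s) s z \<omega> - A s (z - a) \<omega>) \<partial>M)"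
    by (rule nn_integral_add) measurable
  also have "\<dots> \<le> ennreal (noise_size (z - a)) + ennreal (lam * exp (1 / 2) * modulus (t - s) a * exp z)"
    unfolding noise_size_def using t a by (intro add_mono noise_bound HA_diff_bound) auto
  also have "\<dots> = ennreal C"
    unfolding C_def using noise_size_nonneg modulus_nonneg t a lam_pos by (intro ennreal_plus[symmetric]) auto
  finally have fC: "(\<integral>\<^sup>+\<omega>. ennreal (f \<omega>) \<partial>M) \<le> ennreal C" .
  have E2: "emeasure M E2 \<le> ennreal (C / (e / 2))"
    unfolding E2_def using e C fC by (intro emeasure_Markov_real) auto
  have E1: "emeasure M E1 \<le> ennreal ((t - s) / a\<^sup>2)"
    unfolding E1_def using prob_lead_inc_ge[OF u0 t(3) a] t
    by (elim order_trans) (auto intro!: ennreal_leI divide_right_mono)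
  have "emeasure M {\<omega>\<in>space M. e \<le> HA (t - s) s z \<omega> \<and> u \<in> bad s t z \<omega>} \<le> emeasure M (E1 \<union> E2)"
  proof (rule emeasure_mono_AE)
    have u1: "u \<le> 1" and s1: "s \<le> 1" using t by auto
    show "AE \<omega> in M. \<omega> \<in> {\<omega>\<in>space M. e \<le> HA (t - s) s z \<omega> \<and> u \<in> bad s t z \<omega>} \<longrightarrow> \<omega> \<in> E1 \<union> E2"
      using AE_lead_exists[OF u0 u1] AE_one_step[OF t(1,2) u1] AE_summable[OF t(1) s1]
    proof eventually_elim
      case (elim \<omega>)
      show ?case
      proof (intro impI)
        assume *: "\<omega> \<in> {\<omega>\<in>space M. e \<le> HA (t - s) s z \<omega> \<and> u \<in> bad s t z \<omega>}"
        show "\<omega> \<in> E1 \<union> E2"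
        proof (cases "\<omega> \<in> E1")
          case False
          from elim(1) obtain i where i: "lead i u \<omega>" by blast
          with False * have "inc i u t \<omega> < a" by (auto simp: E1_def not_le)
          moreover have "z \<le> x i u \<omega> + inc i u t \<omega>" using * i by (auto simp: bad_def not_less)
          ultimately have "z - a < x i u \<omega>" by simp
          \<comment> \<open>The leader is the left-most particle, so its being beyond z - a puts all
            particles there.\<close>
          then have "z - a - x j u \<omega> < 0" for j
            using has_rank_1_le[of "\<lambda>j. x j u \<omega>" i j] i by (simp add: lead_def)
          then have "pos_part (z - a - x j u \<omega>) = 0" for j by (simp add: pos_part_def max_def less_le_not_le)
          then have A0: "A u (z - a) \<omega> = 0" by (simp add: A_def)
          have "free s u (z - a) \<omega> - (u - s) \<le> A u (z - a) \<omega>" using elim(2) by blast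
          then have "free s u (z - a) \<omega> \<le> u - s" using A0 by simp
          moreover have "HA (u - s) s (z - a) \<omega> \<le> free s u (z - a) \<omega> + noise s u (z - a) \<omega>"
            unfolding noise_def by linarith
          moreover have "A s (z - a) \<omega> \<le> HA (u - s) s (z - a) \<omega>" using t elim(3) by (intro A_le_HA) auto
          ultimately have "A s (z - a) \<omega> \<le> (t - s) + noise s u (z - a) \<omega>" using t by linarith
          moreover have "e \<le> HA (t - s) s z \<omega>" using * by simp
          ultimately have "e / 2 \<le> f \<omega>" using e unfolding f_def by linarith
          then show ?thesis using * by (simp add: E2_def)
        qed simp
      qed
    qed
  qed measurable
  also have "\<dots> \<le> emeasure M E1 + emeasure M E2" by (rule emeasure_subadditive) auto
  also have "\<dots> \<le> ennreal ((t - s) / a\<^sup>2) + ennreal (C / (e / 2))" by (intro add_mono E1 E2)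
  also have "\<dots> = ennreal ((t - s) / a\<^sup>2 + C / (e / 2))"
    using t C e by (intro ennreal_plus[symmetric]) auto
  finally show ?thesis unfolding bad_size_def C_def .
qed

lemma bad_size_nonneg: "0 \<le> h \<Longrightarrow> 0 \<le> a \<Longrightarrow> 0 < e \<Longrightarrow> 0 \<le> bad_size h a e z"
  unfolding bad_size_def using noise_size_nonneg modulus_nonneg lam_pos
  by (auto intro!: add_nonneg_nonneg divide_nonneg_nonneg mult_nonneg_nonneg)

text \<open>Tonelli's theorem integrates \<open>bad_prob\<close> over the times of the step. Paths
  are continuous only almost surely, so joint measurability in time and chance is arranged through a
  modification; J is the resulting measurable majorant of the length of the bad set.\<close>

lemma bad_expectation:
  assumes t: "0 \<le> s" "s < t" "t \<le> 1" and a: "0 < a" and e: "0 < e" "t - s \<le> e / 2"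
  obtains J where "J \<in> borel_measurable M"
    "AE \<omega> in M. e \<le> HA (t - s) s z \<omega> \<longrightarrow> ennreal (measure lborel (bad s t z \<omega>)) \<le> J \<omega>"
    "(\<integral>\<^sup>+\<omega>. J \<omega> \<partial>M) \<le> ennreal ((t - s) * bad_size (t - s) a e z)"
proof -
  have "AE \<omega> in M. (\<forall>i. continuous_on {0..} (\<lambda>t. x i t \<omega>)) \<and> (\<forall>i. continuous_on {0..} (\<lambda>t. w i t \<omega>))"
    using x_continuous w_continuous by eventually_elim auto
  then obtain N where N: "N \<in> null_sets M" and cont: "\<And>\<omega>. \<omega> \<in> space M - N \<Longrightarrow>
      (\<forall>i. continuous_on {0..} (\<lambda>t. x i t \<omega>)) \<and> (\<forall>i. continuous_on {0..} (\<lambda>t. w i t \<omega>))"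
    by (rule AE_E3) blast
  have [measurable]: "N \<in> sets M" using N by auto
  \<comment> \<open>The modification is 0 on the null set and frozen at negative times, which makes
    every path continuous on the whole line.\<close>
  define y where "y i u \<omega> = (if \<omega> \<in> N then 0 else x i (max 0 u) \<omega>)" for i u \<omega>
  define v where "v i u \<omega> = (if \<omega> \<in> N then 0 else w i (max 0 u) \<omega>)" for i u \<omega>
  have y: "case_prod (y i) \<in> borel_measurable (borel \<Otimes>\<^sub>M M)" for i
  proof (rule measurable_caratheodory)
    show "continuous_on UNIV (\<lambda>u. y i u \<omega>)" if "\<omega> \<in> space M" for \<omega>
    proof (cases "\<omega> \<in> N")
      case False
      have "continuous_on {0..} (\<lambda>t. x i t \<omega>)" using cont[of \<omega>] that False by blast
      then have "continuous_on UNIV (\<lambda>u. x i (max 0 u) \<omega>)"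
        by (rule continuous_on_compose2) (auto intro!: continuous_intros)
      then show ?thesis using False by (simp add: y_def)
    qed (simp add: y_def)
    have [measurable]: "x i (max 0 u) \<in> borel_measurable M" for u by (rule x_measurable) simp
    show "y i u \<in> borel_measurable M" for u unfolding y_def[abs_def] by measurable
  qed
  have v: "case_prod (v i) \<in> borel_measurable (borel \<Otimes>\<^sub>M M)" for i
  proof (rule measurable_caratheodory)
    show "continuous_on UNIV (\<lambda>u. v i u \<omega>)" if "\<omega> \<in> space M" for \<omega>
    proof (cases "\<omega> \<in> N")
      case False
      have "continuous_on {0..} (\<lambda>t. w i t \<omega>)" using cont[of \<omega>] that False by blast
      then have "continuous_on UNIV (\<lambda>u. w i (max 0 u) \<omega>)"
        by (rule continuous_on_compose2) (auto intro!: continuous_intros)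
      then show ?thesis using False by (simp add: v_def)
    qed (simp add: v_def)
    have [measurable]: "w i (max 0 u) \<in> borel_measurable M" for u by (rule w_measurable) simp
    show "v i u \<in> borel_measurable M" for u unfolding v_def[abs_def] by measurable
  qed
  have ym [measurable]: "(\<lambda>p. y i (fst p) (snd p)) \<in> borel_measurable (lborel \<Otimes>\<^sub>M M)"
    and vm [measurable]: "(\<lambda>p. v i (fst p) (snd p)) \<in> borel_measurable (lborel \<Otimes>\<^sub>M M)" for i
    using y[of i] v[of i] by (simp_all add: split_beta' cong: measurable_cong_sets)
  have [measurable]: "w i t \<in> borel_measurable M" for i using t by (intro w_measurable) simp
  have [measurable]: "HA (t - s) s z \<in> borel_measurable M" using t by (intro HA_measurable) auto
  \<comment> \<open>The bad times, spelled out for the modified paths. The endpoint u = t is left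
    out because \<open>bad_prob\<close> needs u < t; it has length zero.\<close>
  define P where "P u \<omega> \<longleftrightarrow> s < u \<and> u < t \<and> e \<le> HA (t - s) s z \<omega> \<and>
     \<not> (\<exists>i. (\<forall>j. \<not> (y j u \<omega> < y i u \<omega> \<or> (y j u \<omega> = y i u \<omega> \<and> j < i))) \<and> y i u \<omega> + (w i t \<omega> - v i u \<omega>) < z)" for u \<omega>
  have Pm [measurable]: "Measurable.pred (lborel \<Otimes>\<^sub>M M) (\<lambda>p. P (fst p) (snd p))"
    unfolding P_def by measurable
  have P_iff: "P u \<omega> \<longleftrightarrow> e \<le> HA (t - s) s z \<omega> \<and> u \<in> bad s t z \<omega>" if "s < u" "u < t" "\<omega> \<notin> N" for u \<omega>
    using that t unfolding P_def bad_def lead_def has_rank_1_iff ranked_before_def by (simp add: y_def v_def)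
  define J where "J \<omega> = (\<integral>\<^sup>+u. (if P u \<omega> then 1 else 0) \<partial>lborel)" for \<omega>
  have ind: "(\<lambda>(u, \<omega>). if P u \<omega> then 1 else 0 :: ennreal) \<in> borel_measurable (lborel \<Otimes>\<^sub>M M)"
    unfolding case_prod_beta by measurable
  interpret L: pair_sigma_finite lborel M ..
  show ?thesis
  proof (rule that)
    show "J \<in> borel_measurable M"
    proof -
      have "(\<lambda>(\<omega>, u). if P u \<omega> then 1 else 0 :: ennreal) \<in> borel_measurable (M \<Otimes>\<^sub>M lborel)"
        using measurable_pair_swap[OF ind] by (simp add: split_beta')
      from lborel.borel_measurable_nn_integral[OF this] show ?thesis by (simp only: J_def[abs_def])
    qed
    show "AE \<omega> in M. e \<le> HA (t - s) s z \<omega> \<longrightarrow> ennreal (measure lborel (bad s t z \<omega>)) \<le> J \<omega>"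
      using AE_not_in[OF N] AE_one_step[OF t] AE_space
    proof eventually_elim
      case (elim \<omega>)
      show ?case
      proof
        assume H: "e \<le> HA (t - s) s z \<omega>"
        have bm: "bad s t z \<omega> \<in> sets lborel" using elim(2) by blast
        have fin: "emeasure lborel (bad s t z \<omega>) < \<infinity>"
          by (rule emeasure_Ioc_subset_finite) (auto simp: bad_def)
        have "ennreal (measure lborel (bad s t z \<omega>)) = emeasure lborel (bad s t z \<omega>)"
          using fin by (intro emeasure_eq_ennreal_measure[symmetric]) (auto simp: less_top)
        also have "\<dots> = (\<integral>\<^sup>+u. indicator (bad s t z \<omega>) u \<partial>lborel)" using bm by simp
        also have "\<dots> \<le> J \<omega>"
          unfolding J_def
        proof (rule nn_integral_mono_AE)
          have "AE u in lborel. u \<noteq> t" by (rule AE_lborel_singleton)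
          then show "AE u in lborel. indicator (bad s t z \<omega>) u \<le> (if P u \<omega> then 1 else 0 :: ennreal)"
          proof eventually_elim
            case (elim u)
            show ?case
            proof (cases "u \<in> bad s t z \<omega>")
              case True
              with elim have "s < u" "u < t" by (auto simp: bad_def)
              with True H P_iff \<open>\<omega> \<notin> N\<close> have "P u \<omega>" by blast
              then show ?thesis by (simp add: indicator_def)
            qed simp
          qed
        qed
        finally show "ennreal (measure lborel (bad s t z \<omega>)) \<le> J \<omega>" .
      qed
    qed
    have "(\<integral>\<^sup>+\<omega>. J \<omega> \<partial>M) = (\<integral>\<^sup>+u. \<integral>\<^sup>+\<omega>. (if P u \<omega> then 1 else 0) \<partial>M \<partial>lborel)"
      unfolding J_def by (rule L.Fubini') (rule ind)
    also have "\<dots> \<le> (\<integral>\<^sup>+u. ennreal (bad_size (t - s) a e z) * indicator {s<..<t} u \<partial>lborel)"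
    proof (rule nn_integral_mono)
      fix u
      show "(\<integral>\<^sup>+\<omega>. (if P u \<omega> then 1 else 0) \<partial>M) \<le> ennreal (bad_size (t - s) a e z) * indicator {s<..<t} u"
      proof (cases "s < u \<and> u < t")
        case True
        then have u: "s < u" "u < t" by auto
        have [measurable]: "Measurable.pred M (P u)" using measurable_compose_Pair1[of u lborel _ M, OF _ Pm] by simp
        have "(\<integral>\<^sup>+\<omega>. (if P u \<omega> then 1 else 0) \<partial>M) = (\<integral>\<^sup>+\<omega>. indicator {\<omega>\<in>space M. P u \<omega>} \<omega> \<partial>M)"
          by (intro nn_integral_cong) (auto simp: indicator_def)
        also have "\<dots> = emeasure M {\<omega>\<in>space M. P u \<omega>}" by (rule nn_integral_indicator) measurable
        also have "\<dots> \<le> emeasure M {\<omega>\<in>space M. e \<le> HA (t - s) s z \<omega> \<and> u \<in> bad s t z \<omega>}"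
        proof (rule emeasure_mono_AE)
          show "AE \<omega> in M. \<omega> \<in> {\<omega>\<in>space M. P u \<omega>} \<longrightarrow> \<omega> \<in> {\<omega>\<in>space M. e \<le> HA (t - s) s z \<omega> \<and> u \<in> bad s t z \<omega>}"
            using AE_not_in[OF N] by eventually_elim (use P_iff[OF u] in auto)
          have [measurable]: "w l u \<in> borel_measurable M" "x l u \<in> borel_measurable M" for l
            using t u by (auto intro!: w_measurable x_measurable)
          have [measurable]: "Measurable.pred M (\<lambda>\<omega>. lead i u \<omega>)" for i by (rule lead_pred) measurable
          show "{\<omega>\<in>space M. e \<le> HA (t - s) s z \<omega> \<and> u \<in> bad s t z \<omega>} \<in> events"
            unfolding bad_def using u by (simp, measurable)
        qed
        also have "\<dots> \<le> ennreal (bad_size (t - s) a e z)"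
          by (rule bad_prob[OF t(1) u t(3) a e])
        finally show ?thesis using u by simp
      next
        case False
        then have "\<not> P u \<omega>" for \<omega> by (auto simp: P_def)
        then show ?thesis by (simp add: indicator_def)
      qed
    qed
    also have "\<dots> = ennreal (bad_size (t - s) a e z) * ennreal (t - s)"
      using t by (simp add: nn_integral_cmult)
    also have "\<dots> = ennreal ((t - s) * bad_size (t - s) a e z)"
      using t a e bad_size_nonneg[of "t - s" a e z] by (simp add: ennreal_mult'[symmetric] mult.commute)
    finally show "(\<integral>\<^sup>+\<omega>. J \<omega> \<partial>M) \<le> ennreal ((t - s) * bad_size (t - s) a e z)" .
  qed
qed

end

section \<open>Comparison with the obstacle problem\<close>

text \<open>Coercion to extended nonnegative reals takes the positive part, so this is Jensen's
  inequality for it. It is what makes averaging by the heat operator contractive for one-sided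
  excesses.\<close>

lemma ennreal_integral_le_nn_integral:
  fixes f :: "'a \<Rightarrow> real"
  shows "ennreal (\<integral>x. f x \<partial>M) \<le> (\<integral>\<^sup>+x. ennreal (f x) \<partial>M)"
proof (cases "integrable M f")
  case True
  then have "(\<integral>x. f x \<partial>M) \<le> (\<integral>x. max 0 (f x) \<partial>M)" by (intro integral_mono) auto
  then have "ennreal (\<integral>x. f x \<partial>M) \<le> ennreal (\<integral>x. max 0 (f x) \<partial>M)" by (rule ennreal_leI)
  also have "\<dots> = (\<integral>\<^sup>+x. ennreal (max 0 (f x)) \<partial>M)" using True by (intro nn_integral_eq_integral[symmetric]) auto
  finally show ?thesis by simp
qed (simp add: not_integrable_integral_eq)

lemma ennreal_add_leI: "a \<le> b + c \<Longrightarrow> ennreal a \<le> ennreal b + ennreal c"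
proof -
  assume "a \<le> b + c"
  then have "ennreal a \<le> ennreal (max 0 b + max 0 c)" by (intro ennreal_leI) linarith
  also have "\<dots> = ennreal b + ennreal c" by (subst ennreal_plus) auto
  finally show ?thesis .
qed

text \<open>Constants are preserved and exp z gains the factor exp(h / 2), so the weight grows by at
  most that factor in a step.\<close>

lemma nn_integral_gauss_weight:
  assumes "0 < h"
  shows "(\<integral>\<^sup>+y. ennreal (1 + exp (z - y)) \<partial>gauss h) \<le> ennreal (exp (h / 2) * (1 + exp z))"
proof -
  interpret g: prob_space "gauss h" by (rule prob_space_gauss) fact
  have i: "integrable (gauss h) (\<lambda>y. exp z * exp (- 1 * y))"
    by (intro integrable_mult_right integrable_gauss_exp assms)
  have "(\<integral>\<^sup>+y. ennreal (1 + exp (z - y)) \<partial>gauss h) = (\<integral>\<^sup>+y. ennreal (1 + exp z * exp (- 1 * y)) \<partial>gauss h)"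
    by (simp add: exp_diff exp_minus field_simps)
  also have "\<dots> = ennreal (\<integral>y. 1 + exp z * exp (- 1 * y) \<partial>gauss h)"
    using i by (intro nn_integral_eq_integral) auto
  also have "(\<integral>y. 1 + exp z * exp (- 1 * y) \<partial>gauss h) = 1 + exp z * exp (h / 2)"
  proof -
    have "(\<integral>y. exp z * exp (- 1 * y) \<partial>gauss h) = exp z * exp (h / 2)"
      using integral_gauss_exp[OF assms, of "-1"] by simp
    then show ?thesis using i assms by (subst Bochner_Integration.integral_add) auto
  qed
  also have "1 + exp z * exp (h / 2) \<le> exp (h / 2) * (1 + exp z)"
    using assms by (simp add: algebra_simps)
  finally show ?thesis by (simp add: ennreal_leI)
qed

text \<open>A discrete Duhamel estimate. Each step averages the previous excess and adds a fresh
  error; the growth factors exp(h / 2) of the weight multiply to exp(k h / 2), which stays bounded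
  while k h is at most 1.\<close>

lemma (in prob_space) heat_recursion:
  fixes T :: "nat \<Rightarrow> real \<Rightarrow> 'a \<Rightarrow> real" and e :: "nat \<Rightarrow> real"
  assumes h: "0 < h" and e: "\<And>k. 0 \<le> e k" and e0: "0 \<le> e0"
    and meas: "\<And>k. k \<le> n \<Longrightarrow> (\<lambda>p. T k (snd p) (fst p)) \<in> borel_measurable (M \<Otimes>\<^sub>M borel)"
    and init: "\<And>z. (\<integral>\<^sup>+\<omega>. ennreal (T 0 z \<omega>) \<partial>M) \<le> ennreal (e0 * (1 + exp z))"
    and step: "\<And>k z. k < n \<Longrightarrow> \<exists>E\<in>borel_measurable M.
      (AE \<omega> in M. ennreal (T (Suc k) z \<omega>) \<le> (\<integral>\<^sup>+y. ennreal (T k (z - y) \<omega>) \<partial>gauss h) + E \<omega>) \<and>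
      (\<integral>\<^sup>+\<omega>. E \<omega> \<partial>M) \<le> ennreal (e k * (1 + exp z))"
  shows "k \<le> n \<Longrightarrow> (\<integral>\<^sup>+\<omega>. ennreal (T k z \<omega>) \<partial>M) \<le> ennreal (exp (real k * h / 2) * (e0 + (\<Sum>j<k. e j)) * (1 + exp z))"
proof (induction k arbitrary: z)
  case 0
  then show ?case using init[of z] by simp
next
  case (Suc k)
  interpret g: prob_space "gauss h" by (rule prob_space_gauss) fact
  interpret G: pair_sigma_finite M "gauss h" ..
  define c where "c = exp (real k * h / 2) * (e0 + (\<Sum>j<k. e j))"
  have c: "0 \<le> c" using e e0 by (auto simp: c_def intro!: mult_nonneg_nonneg add_nonneg_nonneg sum_nonneg)
  from step[of k z] Suc.prems obtain E where [measurable]: "E \<in> borel_measurable M" and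
    E: "AE \<omega> in M. ennreal (T (Suc k) z \<omega>) \<le> (\<integral>\<^sup>+y. ennreal (T k (z - y) \<omega>) \<partial>gauss h) + E \<omega>"
    "(\<integral>\<^sup>+\<omega>. E \<omega> \<partial>M) \<le> ennreal (e k * (1 + exp z))" by auto
  have Tm: "(\<lambda>p. T k (snd p) (fst p)) \<in> borel_measurable (M \<Otimes>\<^sub>M borel)"
    using Suc.prems by (intro meas) simp
  have "(\<lambda>p. (fst p, z - snd p)) \<in> M \<Otimes>\<^sub>M gauss h \<rightarrow>\<^sub>M M \<Otimes>\<^sub>M borel" by measurable
  from measurable_compose[OF this Tm]
  have Tm' [measurable]: "(\<lambda>(\<omega>, y). ennreal (T k (z - y) \<omega>)) \<in> borel_measurable (M \<Otimes>\<^sub>M gauss h)"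
    by (simp add: split_beta')
  have [measurable]: "(\<lambda>\<omega>. \<integral>\<^sup>+y. ennreal (T k (z - y) \<omega>) \<partial>gauss h) \<in> borel_measurable M"
    by (rule g.borel_measurable_nn_integral) (rule Tm')
  have "(\<integral>\<^sup>+\<omega>. ennreal (T (Suc k) z \<omega>) \<partial>M) \<le> (\<integral>\<^sup>+\<omega>. (\<integral>\<^sup>+y. ennreal (T k (z - y) \<omega>) \<partial>gauss h) + E \<omega> \<partial>M)"
    by (rule nn_integral_mono_AE) (rule E)
  also have "\<dots> = (\<integral>\<^sup>+\<omega>. \<integral>\<^sup>+y. ennreal (T k (z - y) \<omega>) \<partial>gauss h \<partial>M) + (\<integral>\<^sup>+\<omega>. E \<omega> \<partial>M)"
    by (rule nn_integral_add) measurable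
  also have "(\<integral>\<^sup>+\<omega>. \<integral>\<^sup>+y. ennreal (T k (z - y) \<omega>) \<partial>gauss h \<partial>M) = (\<integral>\<^sup>+y. \<integral>\<^sup>+\<omega>. ennreal (T k (z - y) \<omega>) \<partial>M \<partial>gauss h)"
    by (rule G.Fubini'[symmetric]) (rule Tm')
  also have "\<dots> \<le> (\<integral>\<^sup>+y. ennreal c * ennreal (1 + exp (z - y)) \<partial>gauss h)"
  proof (rule nn_integral_mono)
    fix y
    show "(\<integral>\<^sup>+\<omega>. ennreal (T k (z - y) \<omega>) \<partial>M) \<le> ennreal c * ennreal (1 + exp (z - y))"
      unfolding ennreal_mult'[OF c, symmetric] using Suc.IH[of "z - y"] Suc.prems by (simp only: c_def Suc_leD)
  qed
  also have "\<dots> = ennreal c * (\<integral>\<^sup>+y. ennreal (1 + exp (z - y)) \<partial>gauss h)"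
    by (rule nn_integral_cmult) measurable
  also have "\<dots> \<le> ennreal c * ennreal (exp (h / 2) * (1 + exp z))"
    by (intro mult_left_mono nn_integral_gauss_weight h) simp
  also have "\<dots> = ennreal (c * (exp (h / 2) * (1 + exp z)))" using c by (simp add: ennreal_mult'[symmetric])
  finally have "(\<integral>\<^sup>+\<omega>. ennreal (T (Suc k) z \<omega>) \<partial>M) \<le> ennreal (c * (exp (h / 2) * (1 + exp z))) + ennreal (e k * (1 + exp z))"
    using E(2) by (meson add_mono order_trans order_refl)
  also have "\<dots> = ennreal (c * (exp (h / 2) * (1 + exp z)) + e k * (1 + exp z))"
    using c e by (intro ennreal_plus[symmetric]) (auto simp: add_nonneg_nonneg)
  also have "\<dots> \<le> ennreal (exp (real (Suc k) * h / 2) * (e0 + (\<Sum>j<Suc k. e j)) * (1 + exp z))"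
  proof (rule ennreal_leI)
    have ex: "exp (real (Suc k) * h / 2) = exp (real k * h / 2) * exp (h / 2)"
      by (simp add: exp_add[symmetric] algebra_simps add_divide_distrib)
    have "1 \<le> exp (real (Suc k) * h / 2)" using h by simp
    then have "e k * 1 \<le> e k * exp (real (Suc k) * h / 2)" using e by (intro mult_left_mono)
    then have "e k * (1 + exp z) \<le> e k * exp (real (Suc k) * h / 2) * (1 + exp z)"
      by (intro mult_right_mono) (auto simp: add_nonneg_nonneg)
    moreover have "c * (exp (h / 2) * (1 + exp z)) = exp (real (Suc k) * h / 2) * (e0 + (\<Sum>j<k. e j)) * (1 + exp z)"
      unfolding ex c_def by (simp only: ac_simps)
    moreover have "exp (real (Suc k) * h / 2) * (e0 + (\<Sum>j<Suc k. e j)) * (1 + exp z)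
      = exp (real (Suc k) * h / 2) * (e0 + (\<Sum>j<k. e j)) * (1 + exp z) + e k * exp (real (Suc k) * h / 2) * (1 + exp z)"
      by (simp only: sum.lessThan_Suc) (simp only: distrib_left distrib_right ac_simps)
    ultimately show "c * (exp (h / 2) * (1 + exp z)) + e k * (1 + exp z) \<le> exp (real (Suc k) * h / 2) * (e0 + (\<Sum>j<Suc k. e j)) * (1 + exp z)"
      by linarith
  qed
  finally show ?case .
qed

text \<open>A crude bound on the harmonic sum, telescoping in square roots. Multiplied by h = 1 / n
  it gives 2 sqrt h, which is enough.\<close>

lemma sum_inverse_le_sqrt: "(\<Sum>k<n. 1 / real (Suc k)) \<le> 2 * sqrt (real n)"
proof (induction n)
  case (Suc n)
  have p: "0 < sqrt (real (Suc n))" by simp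
  have "1 = (sqrt (real (Suc n)) - sqrt (real n)) * (sqrt (real (Suc n)) + sqrt (real n))"
    by (simp add: algebra_simps)
  also have "\<dots> \<le> (sqrt (real (Suc n)) - sqrt (real n)) * (2 * sqrt (real (Suc n)))"
    by (intro mult_left_mono) auto
  finally have "1 \<le> 2 * (sqrt (real (Suc n)) - sqrt (real n)) * sqrt (real (Suc n))"
    by (simp only: ac_simps)
  then have "1 / sqrt (real (Suc n)) \<le> 2 * (sqrt (real (Suc n)) - sqrt (real n))"
    by (simp only: pos_divide_le_eq[OF p])
  moreover have "1 / real (Suc n) \<le> 1 / sqrt (real (Suc n))"
  proof (rule divide_left_mono)
    have "sqrt (real (Suc n)) * 1 \<le> sqrt (real (Suc n)) * sqrt (real (Suc n))" by (intro mult_left_mono) auto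
    then show "sqrt (real (Suc n)) \<le> real (Suc n)" by (simp del: of_nat_Suc)
  qed auto
  ultimately show ?case using Suc by (simp del: of_nat_Suc)
qed simp

lemma sqrt_le_exp: "sqrt (max 0 r) \<le> exp r"
proof (cases "0 \<le> r")
  case True
  have "sqrt r \<le> sqrt ((1 + r)\<^sup>2)" using True by (intro iffD2[OF real_sqrt_le_iff]) (simp add: power2_eq_square algebra_simps)
  then have "sqrt r \<le> 1 + r" using True by simp
  then show ?thesis using True order_trans[OF _ exp_ge_add_one_self[of r]] by simp
qed simp

lemma nn_integral_exp_atMost: "(\<integral>\<^sup>+r. ennreal (exp r) * indicator {..z} r \<partial>lborel) = ennreal (exp z)"
proof -
  have "(\<integral>\<^sup>+r. ennreal (exp r) * indicator {..z} r \<partial>lborel) = (\<integral>\<^sup>+r. ennreal (exp (- r)) * indicator {- z..} r \<partial>lborel)"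
    by (subst nn_integral_real_affine[where c = "-1" and t = 0]) (auto simp: indicator_def intro!: nn_integral_cong)
  also have "\<dots> = ennreal (0 - (- exp (- (- z))))"
  proof (rule nn_integral_FTC_atLeast)
    show "((\<lambda>r::real. - exp (- r)) \<longlongrightarrow> 0) at_top" by real_asymp
  qed (auto intro!: derivative_eq_intros)
  finally show ?thesis by simp
qed

lemma nn_integral_pos_part_interval: "(\<integral>\<^sup>+r. indicator {y..z} r \<partial>lborel) = ennreal (pos_part (z - y))"
  by (cases "y \<le> z") (auto simp: pos_part_def)

lemma nn_integral_half_square: 
  assumes "0 \<le> c" shows "(\<integral>\<^sup>+r. ennreal (c * max 0 r) * indicator {..z} r \<partial>lborel) = ennreal (c * half_square z)"
proof -
  have "(\<integral>\<^sup>+r. ennreal (c * max 0 r) * indicator {..z} r \<partial>lborel) = (\<integral>\<^sup>+r. ennreal (c * r) * indicator {0..max 0 z} r \<partial>lborel)"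
    by (intro nn_integral_cong) (auto simp: indicator_def max_def)
  also have "\<dots> = ennreal (c * (max 0 z)\<^sup>2 / 2 - c * 0\<^sup>2 / 2)"
    using assms by (intro nn_integral_FTC_Icc) (auto intro!: derivative_eq_intros)
  finally show ?thesis by (simp add: half_square_def pos_part_def)
qed

section \<open>The deviation of the initial configuration\<close>

sublocale fast_atlas \<subseteq> prof: profile lam
  by unfold_locales (rule lam_pos)

context fast_atlas
begin

lemma init_abs_deviation:
  "(\<integral>\<^sup>+\<omega>. ennreal \<bar>real (card {i. x i 0 \<omega> \<le> r}) - lam * b * max 0 r\<bar> \<partial>M) \<le> ennreal (sqrt (lam * b) * exp r)"
proof -
  note [measurable] = x_measurable[OF order_refl]
  let ?Y = "\<lambda>\<omega>. real (card {i. x i 0 \<omega> \<le> r}) - lam * b * max 0 r"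
  have m: "0 \<le> lam * b * max 0 r" using lam_pos b_pos by simp
  have i2: "integrable M (\<lambda>\<omega>. (?Y \<omega>)\<^sup>2)"
    using init_var[of r] by (intro integrableI_bounded) (auto intro: le_less_trans)
  have "ennreal (expectation (\<lambda>\<omega>. (?Y \<omega>)\<^sup>2)) \<le> ennreal (lam * b * max 0 r)"
    using init_var[of r] nn_integral_eq_integral[OF i2] by simp
  then have "expectation (\<lambda>\<omega>. (?Y \<omega>)\<^sup>2) \<le> lam * b * max 0 r" using m by (simp only: ennreal_le_iff)
  note E = expectation_abs_le_sqrt[OF _ i2 this]
  have "(\<integral>\<^sup>+\<omega>. ennreal \<bar>?Y \<omega>\<bar> \<partial>M) = ennreal (expectation (\<lambda>\<omega>. \<bar>?Y \<omega>\<bar>))"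
    by (intro nn_integral_eq_integral integrable_abs E) auto
  also have "\<dots> \<le> ennreal (sqrt (lam * b * max 0 r))" by (intro ennreal_leI E) auto
  also have "\<dots> \<le> ennreal (sqrt (lam * b) * exp r)"
    using sqrt_le_exp[of r] lam_pos b_pos by (intro ennreal_leI) (simp add: real_sqrt_mult mult_left_mono)
  finally show ?thesis .
qed

text \<open>A majorant of the deviation at time 0: both profiles are, up to 1 / b, integrals of
  counting functions up to z. Its mean is of order 1 / sqrt b since the Poisson count up to r has
  standard deviation of order sqrt(b r).\<close>

definition init_dev :: "real \<Rightarrow> 'a \<Rightarrow> ennreal" where
  "init_dev z \<omega> = ennreal (1 / b) * (\<integral>\<^sup>+r. ennreal \<bar>real (card {i. x i 0 \<omega> \<le> r}) - lam * b * max 0 r\<bar> * indicator {..z} r \<partial>lborel)"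

lemma card_measurable [measurable]:
  "(\<lambda>p. real (card {i. x i 0 (fst p) \<le> snd p})) \<in> borel_measurable (M \<Otimes>\<^sub>M lborel)"
proof -
  note [measurable] = x_measurable[OF order_refl]
  have "(\<lambda>p. card {i. x i 0 (fst p) \<le> snd p}) \<in> (M \<Otimes>\<^sub>M lborel) \<rightarrow>\<^sub>M count_space UNIV"
  proof (rule measurable_card)
    fix i
    have "{p\<in>space (M \<Otimes>\<^sub>M lborel). x i 0 (fst p) \<le> snd p} \<in> sets (M \<Otimes>\<^sub>M lborel)" by measurable
    then show "{p\<in>space (M \<Otimes>\<^sub>M lborel). i \<in> {i. x i 0 (fst p) \<le> snd p}} \<in> sets (M \<Otimes>\<^sub>M lborel)" by simp
  qed
  then show ?thesis by measurable
qed

lemma init_dev_bound: "(\<integral>\<^sup>+\<omega>. init_dev z \<omega> \<partial>M) \<le> ennreal (sqrt (lam / b) * exp z)"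
  and init_dev_measurable: "init_dev z \<in> borel_measurable M"
proof -
  interpret L: pair_sigma_finite M lborel ..
  let ?f = "\<lambda>\<omega> r. ennreal \<bar>real (card {i. x i 0 \<omega> \<le> r}) - lam * b * max 0 r\<bar> * indicator {..z} r"
  have f [measurable]: "case_prod ?f \<in> borel_measurable (M \<Otimes>\<^sub>M lborel)"
    unfolding split_beta' by measurable
  have fm: "(\<lambda>\<omega>. \<integral>\<^sup>+r. ?f \<omega> r \<partial>lborel) \<in> borel_measurable M"
    by (rule lborel.borel_measurable_nn_integral) (rule f)
  then show "init_dev z \<in> borel_measurable M" unfolding init_dev_def[abs_def] by measurable
  have "(\<integral>\<^sup>+\<omega>. init_dev z \<omega> \<partial>M) = ennreal (1 / b) * (\<integral>\<^sup>+\<omega>. \<integral>\<^sup>+r. ?f \<omega> r \<partial>lborel \<partial>M)"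
    unfolding init_dev_def by (rule nn_integral_cmult[OF fm])
  also have "(\<integral>\<^sup>+\<omega>. \<integral>\<^sup>+r. ?f \<omega> r \<partial>lborel \<partial>M) = (\<integral>\<^sup>+r. \<integral>\<^sup>+\<omega>. ?f \<omega> r \<partial>M \<partial>lborel)"
    by (rule L.Fubini'[symmetric]) (rule f)
  also have "\<dots> \<le> (\<integral>\<^sup>+r. ennreal (sqrt (lam * b)) * (ennreal (exp r) * indicator {..z} r) \<partial>lborel)"
  proof (rule nn_integral_mono)
    fix r
    have "(\<integral>\<^sup>+\<omega>. ?f \<omega> r \<partial>M) = (\<integral>\<^sup>+\<omega>. ennreal \<bar>real (card {i. x i 0 \<omega> \<le> r}) - lam * b * max 0 r\<bar> \<partial>M) * indicator {..z} r"
      by (cases "r \<le> z") auto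
    also have "\<dots> \<le> ennreal (sqrt (lam * b) * exp r) * indicator {..z} r"
      by (intro mult_right_mono init_abs_deviation) simp
    also have "\<dots> = ennreal (sqrt (lam * b)) * (ennreal (exp r) * indicator {..z} r)"
      using lam_pos b_pos by (simp add: ennreal_mult mult.assoc)
    finally show "(\<integral>\<^sup>+\<omega>. ?f \<omega> r \<partial>M) \<le> ennreal (sqrt (lam * b)) * (ennreal (exp r) * indicator {..z} r)" .
  qed
  also have "\<dots> = ennreal (sqrt (lam * b)) * ennreal (exp z)"
    by (subst nn_integral_cmult) (auto simp: nn_integral_exp_atMost)
  also have "ennreal (1 / b) * \<dots> = ennreal (1 / b * (sqrt (lam * b) * exp z))"
    using lam_pos b_pos by (simp add: ennreal_mult'[symmetric])
  also have "1 / b * (sqrt (lam * b) * exp z) = sqrt (lam / b) * exp z"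
  proof -
    have "sqrt (lam * b) / b = sqrt (lam / b)"
      using lam_pos b_pos by (simp add: real_sqrt_mult real_sqrt_divide field_simps)
    then show ?thesis by (simp add: field_simps)
  qed
  finally show "(\<integral>\<^sup>+\<omega>. init_dev z \<omega> \<partial>M) \<le> ennreal (sqrt (lam / b) * exp z)" by (simp add: mult_left_mono)
qed

lemma AE_init_dev:
  "AE \<omega> in M. ennreal (A 0 z \<omega> - prof.Astar 0 z) \<le> init_dev z \<omega> \<and> ennreal (prof.Astar 0 z - A 0 z \<omega>) \<le> init_dev z \<omega>"
proof -
  have z01: "(0 :: real) \<le> 0" "(0 :: real) \<le> 1" by auto
  \<comment> \<open>Finiteness is given for each fixed level; integer levels yield one exceptional
    set for all of them.\<close>
  have fin: "AE \<omega> in M. \<forall>n::nat. finite {i. x i 0 \<omega> \<le> real n}"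
    by (subst AE_all_countable) (intro allI init_finite)
  show ?thesis
    using AE_summable[OF z01] fin
  proof eventually_elim
    case (elim \<omega>)
    have finr: "finite {i. x i 0 \<omega> \<le> r}" for r
    proof -
      obtain n where "r \<le> real n" using real_arch_simple by blast
      then have "{i. x i 0 \<omega> \<le> r} \<subseteq> {i. x i 0 \<omega> \<le> real n}" by auto
      then show ?thesis using elim(2) finite_subset by blast
    qed
    define N where "N r = real (card {i. x i 0 \<omega> \<le> r})" for r
    have Nm [measurable]: "N \<in> borel_measurable borel"
      unfolding N_def by (rule borel_measurable_mono) (auto simp: mono_def intro!: card_mono finr)
    let ?m = "\<lambda>r. lam * b * max 0 r"
    have m0: "0 \<le> ?m r" for r using lam_pos b_pos by simp
    have sm: "summable (\<lambda>i. pos_part (z - x i 0 \<omega>))" using elim(1) by (rule summable_pos_part)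
    have A0: "0 \<le> A 0 z \<omega>" unfolding A_def using sm b_pos by (intro divide_nonneg_pos suminf_nonneg) auto
    have As0: "0 \<le> prof.Astar 0 z" by (rule prof.Astar_nonneg) simp
    have bA: "ennreal (b * A 0 z \<omega>) = (\<integral>\<^sup>+r. ennreal (N r) * indicator {..z} r \<partial>lborel)"
    proof -
      have "ennreal (b * A 0 z \<omega>) = (\<Sum>i. ennreal (pos_part (z - x i 0 \<omega>)))"
        using sm b_pos by (simp add: A_def suminf_ennreal2)
      also have "\<dots> = (\<Sum>i. \<integral>\<^sup>+r. indicator {x i 0 \<omega>..z} r \<partial>lborel)"
        by (simp only: nn_integral_pos_part_interval)
      also have "\<dots> = (\<integral>\<^sup>+r. (\<Sum>i. indicator {x i 0 \<omega>..z} r) \<partial>lborel)"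
        by (rule nn_integral_suminf[symmetric]) measurable
      also have "\<dots> = (\<integral>\<^sup>+r. ennreal (N r) * indicator {..z} r \<partial>lborel)"
      proof (rule nn_integral_cong)
        fix r
        have "(\<Sum>i. indicator {x i 0 \<omega>..z} r :: ennreal) = (\<Sum>i\<in>{i. x i 0 \<omega> \<le> r}. indicator {..z} r)"
          by (subst suminf_finite[OF finr[of r]]) (auto simp: indicator_def intro!: sum.cong)
        then show "(\<Sum>i. indicator {x i 0 \<omega>..z} r :: ennreal) = ennreal (N r) * indicator {..z} r"
          by (simp add: N_def ennreal_of_nat_eq_real_of_nat)
      qed
      finally show ?thesis .
    qed
    have bS: "ennreal (b * prof.Astar 0 z) = (\<integral>\<^sup>+r. ennreal (?m r) * indicator {..z} r \<partial>lborel)"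
      using nn_integral_half_square[of "lam * b" z] lam_pos b_pos by (simp add: prof.Astar_0 ac_simps)
    define I where "I = (\<integral>\<^sup>+r. ennreal \<bar>N r - ?m r\<bar> * indicator {..z} r \<partial>lborel)"
    have I: "init_dev z \<omega> = ennreal (1 / b) * I" by (simp add: init_dev_def I_def N_def)
    have cmp: "(\<integral>\<^sup>+r. ennreal (p r) * indicator {..z} r \<partial>lborel) \<le> (\<integral>\<^sup>+r. ennreal (q r) * indicator {..z} r \<partial>lborel) + I"
      if [measurable]: "q \<in> borel_measurable borel" and pq: "\<And>r. p r \<le> q r + \<bar>N r - ?m r\<bar>" for p q
    proof -
      have "(\<integral>\<^sup>+r. ennreal (p r) * indicator {..z} r \<partial>lborel) \<le> (\<integral>\<^sup>+r. ennreal (q r) * indicator {..z} r + ennreal \<bar>N r - ?m r\<bar> * indicator {..z} r \<partial>lborel)"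
        using ennreal_add_leI[OF pq] by (intro nn_integral_mono) (auto simp: indicator_def)
      also have "\<dots> = (\<integral>\<^sup>+r. ennreal (q r) * indicator {..z} r \<partial>lborel) + I"
        unfolding I_def by (rule nn_integral_add) measurable
      finally show ?thesis .
    qed
    have fin: "ennreal (p - q) \<le> ennreal (1 / b) * I" if "0 \<le> q" "ennreal (b * p) \<le> ennreal (b * q) + I" for p q
    proof -
      have "ennreal (b * p - b * q) = ennreal (b * p) - ennreal (b * q)"
        using that(1) b_pos by (intro ennreal_minus[symmetric]) simp
      also have "\<dots> \<le> I" using that(2) by (simp add: ennreal_minus_le_iff add.commute)
      finally have "ennreal (1 / b) * ennreal (b * p - b * q) \<le> ennreal (1 / b) * I" by (rule mult_left_mono) simp
      moreover have "ennreal (1 / b) * ennreal (b * p - b * q) = ennreal (p - q)"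
        using b_pos by (simp add: ennreal_mult'[symmetric] right_diff_distrib[symmetric])
      ultimately show ?thesis by simp
    qed
    show ?case
      unfolding I
    proof (intro conjI fin)
      show "ennreal (b * A 0 z \<omega>) \<le> ennreal (b * prof.Astar 0 z) + I"
        unfolding bA bS by (rule cmp) auto
      show "ennreal (b * prof.Astar 0 z) \<le> ennreal (b * A 0 z \<omega>) + I"
        unfolding bA bS by (rule cmp) auto
    qed (use A0 As0 in auto)
  qed
qed

lemma HA_eq_heat:
  assumes h: "0 < h" and sm: "summable (\<lambda>i. exp (- x i t \<omega>))"
  shows "integrable (gauss h) (\<lambda>y. A t (z - y) \<omega>)" "HA h t z \<omega> = (\<integral>y. A t (z - y) \<omega> \<partial>gauss h)"
proof -
  let ?f = "\<lambda>i y. pos_part (z - x i t \<omega> - y)"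
  have f: "?f i y = pos_part (z - y - x i t \<omega>)" for i y by (simp add: algebra_simps)
  have 1: "integrable (gauss h) (?f i)" for i by (rule integrable_gauss_pos_part[OF h])
  have 2: "AE y in gauss h. summable (\<lambda>i. norm (?f i y))"
  proof (rule AE_I2)
    fix y show "summable (\<lambda>i. norm (?f i y))"
      unfolding f using summable_pos_part[OF sm, of "z - y"] by simp
  qed
  have 3: "summable (\<lambda>i. \<integral>y. norm (?f i y) \<partial>gauss h)"
    using summable_heat_pos_part[OF h sm, of z] by (simp add: heat_def)
  have eq: "A t (z - y) \<omega> = (\<Sum>i. ?f i y) / b" for y by (simp only: A_def f)
  show "integrable (gauss h) (\<lambda>y. A t (z - y) \<omega>)"
    unfolding eq by (intro integrable_divide integrable_suminf 1 2 3)
  show "HA h t z \<omega> = (\<integral>y. A t (z - y) \<omega> \<partial>gauss h)"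
    unfolding eq HA_def using integral_suminf[of "gauss h" ?f, OF 1 2 3] by (simp add: heat_def)
qed

end

section \<open>Errors of the exact solution on the time grid\<close>

context profile
begin

text \<open>\<open>init_const\<close> serves the step from time 0; the factor 2 comes from 1 / k
  \<le> 2 / (k + 1) in the later steps.\<close>

definition lower_err :: real where
  "lower_err = init_const + 2 * lower_const"

lemma init_const_nonneg: "0 \<le> init_const"
  using lam_pos by (simp add: init_const_def add_nonneg_nonneg)

lemma lower_const_nonneg: "0 \<le> lower_const"
  by (simp add: lower_const_def)

lemma lower_err_nonneg: "0 \<le> lower_err"
  using init_const_nonneg lower_const_nonneg by (simp add: lower_err_def)

text \<open>At time k h the error h^2 / t of \<open>Astar_step_lower\<close> is h / k. Writing k + 1
  in the denominator includes the initial step in the same form.\<close>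

lemma Astar_lower_grid:
  assumes n: "0 < n" "k < n" and h: "h = 1 / real n"
  shows "heat h (Astar (real k * h)) z - h \<le> Astar (real (Suc k) * h) z + lower_err * h / real (Suc k)"
proof (cases "k = 0")
  case True
  have h0: "0 < h" using n h by simp
  have "heat h (Astar 0) z - h \<le> Astar h z + init_const * h"
    using Astar_initial_step[OF h0, of z] h0 by linarith
  moreover have "init_const * h \<le> lower_err * h"
    using h0 lower_const_nonneg unfolding lower_err_def by (intro mult_right_mono) auto
  ultimately show ?thesis using True by simp
next
  case False
  have h0: "0 < h" using n h by simp
  have k1: "1 \<le> real k" using False by simp
  then have hk: "h \<le> real k * h" using h0 by simp
  have "real k * h \<le> 1" using n h by (simp add: divide_le_eq)
  then have "heat h (Astar (real k * h)) z - h \<le> Astar (real k * h + h) z + lower_const * h\<^sup>2 / (real k * h)"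
    by (intro Astar_step_lower h0 hk)
  also have "lower_const * h\<^sup>2 / (real k * h) = lower_const * h * (1 / real k)"
    using h0 by (simp add: power2_eq_square)
  also have "\<dots> \<le> lower_const * h * (2 / real (Suc k))"
    using h0 k1 lower_const_nonneg by (intro mult_left_mono) (auto simp: field_simps)
  also have "\<dots> \<le> lower_err * h / real (Suc k)"
    using h0 init_const_nonneg unfolding lower_err_def by (simp add: divide_right_mono field_simps)
  finally show ?thesis by (simp add: algebra_simps)
qed

text \<open>The additional 1 next to \<open>init_const\<close> is there because
  \<open>Astar_initial_step\<close> compares with the heated profile itself, whereas here h has been
  subtracted from it.\<close>

definition upper_err :: "real \<Rightarrow> real \<Rightarrow> nat \<Rightarrow> real" where
  "upper_err h a k = 12 * dens_bound * h\<^sup>2 / a\<^sup>2 + (if k = 0 then (init_const + 1) * h else 0)"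

lemma upper_err_nonneg: "0 \<le> h \<Longrightarrow> 0 \<le> upper_err h a k"
  using dens_bound_nonneg init_const_nonneg by (simp add: upper_err_def)

lemma Astar_upper_grid:
  assumes n: "0 < n" "k < n" and h: "h = 1 / real n" and a: "0 < a" "2 * \<bar>\<kappa>\<bar> * sqrt h \<le> a" "dens_bound * a\<^sup>2 \<le> e"
  shows "Astar (real (Suc k) * h) z \<le> max (heat h (Astar (real k * h)) z - h) e + upper_err h a k"
proof (cases "k = 0")
  case True
  have h0: "0 < h" using n h by simp
  have "Astar h z \<le> heat h (Astar 0) z + init_const * h"
    using Astar_initial_step[OF h0, of z] by linarith
  also have "\<dots> = (heat h (Astar 0) z - h) + (init_const + 1) * h" by (simp add: algebra_simps)
  finally have "Astar h z \<le> max (heat h (Astar 0) z - h) e + (init_const + 1) * h" by linarith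
  moreover have "0 \<le> 12 * dens_bound * h\<^sup>2 / a\<^sup>2" using dens_bound_nonneg by simp
  ultimately show ?thesis using True unfolding upper_err_def by simp
next
  case False
  have h0: "0 < h" using n h by simp
  have hk: "h \<le> real k * h" using h0 False by simp
  have "real k * h \<le> 1" using n h by (simp add: divide_le_eq)
  then have "Astar (real k * h + h) z \<le> max (heat h (Astar (real k * h)) z - h) (dens_bound * a\<^sup>2) + 12 * dens_bound * h\<^sup>2 / a\<^sup>2"
    by (intro Astar_step_upper h0 hk a)
  also have "\<dots> \<le> max (heat h (Astar (real k * h)) z - h) e + upper_err h a k"
    using a False by (intro add_mono max.mono) (auto simp: upper_err_def)
  finally show ?thesis by (simp add: algebra_simps)
qed

end

section \<open>Propagation of the deviation through the time steps\<close>

context fast_atlas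
begin

lemma heat_difference:
  assumes h: "0 < h" and t: "0 \<le> t" "t \<le> 1" and sm: "summable (\<lambda>i. exp (- x i t \<omega>))"
  shows "HA h t z \<omega> - heat h (prof.Astar t) z - e = (\<integral>y. A t (z - y) \<omega> - prof.Astar t (z - y) - e \<partial>gauss h)"
    and "heat h (prof.Astar t) z - HA h t z \<omega> - e = (\<integral>y. prof.Astar t (z - y) - A t (z - y) \<omega> - e \<partial>gauss h)"
proof -
  interpret g: prob_space "gauss h" by (rule prob_space_gauss) fact
  note [simp] = HA_eq_heat(1)[OF h sm, of z] prof.integrable_heat_Astar[OF h t, of z]
  show "HA h t z \<omega> - heat h (prof.Astar t) z - e = (\<integral>y. A t (z - y) \<omega> - prof.Astar t (z - y) - e \<partial>gauss h)"
    using HA_eq_heat(2)[OF h sm, of z] h by (simp add: heat_def)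
  show "heat h (prof.Astar t) z - HA h t z \<omega> - e = (\<integral>y. prof.Astar t (z - y) - A t (z - y) \<omega> - e \<partial>gauss h)"
    using HA_eq_heat(2)[OF h sm, of z] h by (simp add: heat_def)
qed

text \<open>Where the heated profile is at least e, all drift counts except during bad times, whose
  mean length is controlled. Where it is below e, the profile after the step is at most e plus
  noise, and the threshold e removes all but the noise.\<close>

lemma upper_step:
  assumes t: "0 \<le> s" "s < t" "t \<le> 1" and a: "0 < a" and e: "0 < e" "t - s \<le> e / 2" and d: "0 \<le> d"
    and det: "heat (t - s) (prof.Astar s) z - (t - s) \<le> prof.Astar t z + d"
  shows "\<exists>E\<in>borel_measurable M.
      (AE \<omega> in M. ennreal (A t z \<omega> - prof.Astar t z - e) \<le> (\<integral>\<^sup>+y. ennreal (A s (z - y) \<omega> - prof.Astar s (z - y) - e) \<partial>gauss (t - s)) + E \<omega>) \<and>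
      (\<integral>\<^sup>+\<omega>. E \<omega> \<partial>M) \<le> ennreal (noise_size z + (t - s) * bad_size (t - s) a e z + d)"
proof -
  define h where "h = t - s"
  have h: "0 < h" using t by (simp add: h_def)
  obtain J where [measurable]: "J \<in> borel_measurable M" and
    J: "AE \<omega> in M. e \<le> HA (t - s) s z \<omega> \<longrightarrow> ennreal (measure lborel (bad s t z \<omega>)) \<le> J \<omega>"
    "(\<integral>\<^sup>+\<omega>. J \<omega> \<partial>M) \<le> ennreal ((t - s) * bad_size (t - s) a e z)"
    using bad_expectation[OF t a e] by blast
  have [measurable]: "noise s t z \<in> borel_measurable M" using t by (intro noise_measurable)
  have s1: "s \<le> 1" using t by simp
  have As0: "0 \<le> prof.Astar t z" using t by (intro prof.Astar_nonneg) simp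
  define E where "E \<omega> = ennreal (noise s t z \<omega>) + J \<omega> + ennreal d" for \<omega>
  have "AE \<omega> in M. ennreal (A t z \<omega> - prof.Astar t z - e) \<le> (\<integral>\<^sup>+y. ennreal (A s (z - y) \<omega> - prof.Astar s (z - y) - e) \<partial>gauss (t - s)) + E \<omega>"
    using J(1) AE_one_step[OF t] AE_summable[OF t(1) s1]
  proof eventually_elim
    case (elim \<omega>)
    have nf: "free s t z \<omega> \<le> HA h s z \<omega> + noise s t z \<omega>" unfolding noise_def h_def by linarith
    have n0: "0 \<le> noise s t z \<omega>" by (simp add: noise_def)
    show ?case
    proof (cases "e \<le> HA h s z \<omega>")
      case True
      let ?D = "HA h s z \<omega> - heat h (prof.Astar s) z - e"
      let ?m = "measure lborel (bad s t z \<omega>)"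
      have "A t z \<omega> \<le> free s t z \<omega> - h + ?m" using elim(2) unfolding h_def by blast
      then have "A t z \<omega> - prof.Astar t z - e \<le> ?D + (noise s t z \<omega> + ?m + d)"
        using nf det unfolding h_def[symmetric] by linarith
      then have "ennreal (A t z \<omega> - prof.Astar t z - e) \<le> ennreal ?D + ennreal (noise s t z \<omega> + ?m + d)"
        by (rule ennreal_add_leI)
      also have "ennreal (noise s t z \<omega> + ?m + d) = ennreal (noise s t z \<omega>) + ennreal ?m + ennreal d"
        using n0 d by (simp add: ennreal_plus)
      also have "ennreal ?D + \<dots> \<le> (\<integral>\<^sup>+y. ennreal (A s (z - y) \<omega> - prof.Astar s (z - y) - e) \<partial>gauss h) + E \<omega>"
        unfolding E_def heat_difference(1)[OF h t(1) s1 elim(3)]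
        using elim(1) True by (intro add_mono ennreal_integral_le_nn_integral) (auto simp: h_def)
      finally show ?thesis by (simp add: h_def)
    next
      case False
      have "A t z \<omega> \<le> free s t z \<omega>" using elim(2) by blast
      then have "A t z \<omega> - prof.Astar t z - e \<le> noise s t z \<omega>" using nf False As0 by linarith
      then have "ennreal (A t z \<omega> - prof.Astar t z - e) \<le> ennreal (noise s t z \<omega>)" by (rule ennreal_leI)
      also have "\<dots> \<le> (\<integral>\<^sup>+y. ennreal (A s (z - y) \<omega> - prof.Astar s (z - y) - e) \<partial>gauss (t - s)) + E \<omega>"
        unfolding E_def by (simp add: add.assoc add_increasing add_increasing2)
      finally show ?thesis .
    qed
  qed
  moreover have "(\<integral>\<^sup>+\<omega>. E \<omega> \<partial>M) \<le> ennreal (noise_size z + (t - s) * bad_size (t - s) a e z + d)"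
  proof -
    have "(\<integral>\<^sup>+\<omega>. E \<omega> \<partial>M) = (\<integral>\<^sup>+\<omega>. ennreal (noise s t z \<omega>) \<partial>M) + (\<integral>\<^sup>+\<omega>. J \<omega> \<partial>M) + ennreal d"
      unfolding E_def by (simp add: nn_integral_add emeasure_space_1)
    also have "\<dots> \<le> ennreal (noise_size z) + ennreal ((t - s) * bad_size (t - s) a e z) + ennreal d"
      unfolding noise_size_def by (intro add_mono noise_bound t J(2) order_refl)
    also have "\<dots> = ennreal (noise_size z + (t - s) * bad_size (t - s) a e z + d)"
      using noise_size_nonneg[of z] bad_size_nonneg[of "t - s" a e z] t a e d by (simp add: ennreal_plus)
    finally show ?thesis .
  qed
  moreover have "E \<in> borel_measurable M" unfolding E_def by measurable
  ultimately show ?thesis by blast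
qed

text \<open>The bound that the drift lowers the profile by at most the step length always holds, so
  bad times do not enter. If the maximum in the hypothesis is e, the excess is at most d because A
  is nonnegative.\<close>

lemma lower_step:
  assumes t: "0 \<le> s" "s < t" "t \<le> 1" and d: "0 \<le> d"
    and det: "prof.Astar t z \<le> max (heat (t - s) (prof.Astar s) z - (t - s)) e + d"
  shows "\<exists>E\<in>borel_measurable M.
      (AE \<omega> in M. ennreal (prof.Astar t z - A t z \<omega> - e) \<le> (\<integral>\<^sup>+y. ennreal (prof.Astar s (z - y) - A s (z - y) \<omega> - e) \<partial>gauss (t - s)) + E \<omega>) \<and>
      (\<integral>\<^sup>+\<omega>. E \<omega> \<partial>M) \<le> ennreal (noise_size z + d)"
proof -
  define h where "h = t - s"
  have h: "0 < h" using t by (simp add: h_def)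
  have [measurable]: "noise s t z \<in> borel_measurable M" using t by (intro noise_measurable)
  have s1: "s \<le> 1" and t0: "0 \<le> t" using t by auto
  define E where "E \<omega> = ennreal (noise s t z \<omega>) + ennreal d" for \<omega>
  have "AE \<omega> in M. ennreal (prof.Astar t z - A t z \<omega> - e) \<le> (\<integral>\<^sup>+y. ennreal (prof.Astar s (z - y) - A s (z - y) \<omega> - e) \<partial>gauss (t - s)) + E \<omega>"
    using AE_one_step[OF t] AE_summable[OF t(1) s1] AE_summable[OF t0 t(3)]
  proof eventually_elim
    case (elim \<omega>)
    have nf: "HA h s z \<omega> - noise s t z \<omega> \<le> free s t z \<omega>" unfolding noise_def h_def by linarith
    have n0: "0 \<le> noise s t z \<omega>" by (simp add: noise_def)
    have A0: "0 \<le> A t z \<omega>"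
      unfolding A_def using b_pos summable_pos_part[OF elim(3), of z] by (intro divide_nonneg_pos suminf_nonneg) auto
    let ?D = "heat h (prof.Astar s) z - HA h s z \<omega> - e"
    have "free s t z \<omega> - h \<le> A t z \<omega>" using elim(1) unfolding h_def by blast
    then have "prof.Astar t z - A t z \<omega> - e \<le> max 0 ?D + (noise s t z \<omega> + d)"
      using nf det A0 n0 d unfolding h_def[symmetric] by linarith
    then have "ennreal (prof.Astar t z - A t z \<omega> - e) \<le> ennreal (max 0 ?D) + ennreal (noise s t z \<omega> + d)"
      by (rule ennreal_add_leI)
    also have "ennreal (noise s t z \<omega> + d) = ennreal (noise s t z \<omega>) + ennreal d"
      using n0 d by (simp add: ennreal_plus)
    also have "ennreal (max 0 ?D) = ennreal ?D" by (simp add: max_def ennreal_neg)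
    also have "ennreal ?D + (ennreal (noise s t z \<omega>) + ennreal d) \<le> (\<integral>\<^sup>+y. ennreal (prof.Astar s (z - y) - A s (z - y) \<omega> - e) \<partial>gauss h) + E \<omega>"
      unfolding E_def heat_difference(2)[OF h t(1) s1 elim(2)]
      by (intro add_mono ennreal_integral_le_nn_integral order_refl)
    finally show ?case by (simp add: h_def)
  qed
  moreover have "(\<integral>\<^sup>+\<omega>. E \<omega> \<partial>M) \<le> ennreal (noise_size z + d)"
  proof -
    have "(\<integral>\<^sup>+\<omega>. E \<omega> \<partial>M) = (\<integral>\<^sup>+\<omega>. ennreal (noise s t z \<omega>) \<partial>M) + ennreal d"
      unfolding E_def by (simp add: nn_integral_add emeasure_space_1)
    also have "\<dots> \<le> ennreal (noise_size z) + ennreal d"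
      unfolding noise_size_def by (intro add_mono noise_bound t order_refl)
    also have "\<dots> = ennreal (noise_size z + d)"
      using noise_size_nonneg[of z] d by (simp add: ennreal_plus)
    finally show ?thesis .
  qed
  moreover have "E \<in> borel_measurable M" unfolding E_def by measurable
  ultimately show ?thesis by blast
qed

abbreviation nu :: real where "nu \<equiv> sqrt (2 * exp 1 * lam / b)"

text \<open>The noise grows like exp(z / 2), which the weight 1 + exp z dominates at both
  ends.\<close>

lemma noise_size_le: "z' \<le> z \<Longrightarrow> noise_size z' \<le> nu * (1 + exp z)"
proof -
  assume z: "z' \<le> z"
  have "sqrt (exp z') \<le> sqrt ((1 + exp z)\<^sup>2)"
  proof (intro iffD2[OF real_sqrt_le_iff])
    have "exp z' \<le> exp z" using z by simp
    also have "\<dots> \<le> 1 + 2 * exp z + (exp z)\<^sup>2" using exp_gt_zero[of z] zero_le_power2[of "exp z"] by linarith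
    finally show "exp z' \<le> (1 + exp z)\<^sup>2" by (simp add: power2_sum)
  qed
  also have "\<dots> = 1 + exp z" using exp_gt_zero[of z] by simp
  finally have "nu * sqrt (exp z') \<le> nu * (1 + exp z)" using lam_pos b_pos by (intro mult_left_mono) auto
  then show ?thesis unfolding noise_size_def by (simp only: real_sqrt_mult)
qed

definition bad_coeff :: "real \<Rightarrow> real \<Rightarrow> real \<Rightarrow> real" where
  "bad_coeff h a e = h / a\<^sup>2 + (nu + lam * exp (1 / 2) * modulus h a) / (e / 2)"

lemma bad_coeff_nonneg: "0 \<le> h \<Longrightarrow> 0 \<le> a \<Longrightarrow> 0 < e \<Longrightarrow> 0 \<le> bad_coeff h a e"
  unfolding bad_coeff_def using lam_pos b_pos modulus_nonneg
  by (auto intro!: add_nonneg_nonneg divide_nonneg_nonneg mult_nonneg_nonneg)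

lemma bad_size_le:
  assumes "0 \<le> h" "0 < a" "0 < e" shows "bad_size h a e z \<le> bad_coeff h a e * (1 + exp z)"
proof -
  have "h / a\<^sup>2 * 1 \<le> h / a\<^sup>2 * (1 + exp z)" using assms by (intro mult_left_mono) auto
  moreover have "(noise_size (z - a) + lam * exp (1 / 2) * modulus h a * exp z) / (e / 2)
    \<le> (nu + lam * exp (1 / 2) * modulus h a) * (1 + exp z) / (e / 2)"
  proof (rule divide_right_mono)
    have "lam * exp (1 / 2) * modulus h a * exp z \<le> lam * exp (1 / 2) * modulus h a * (1 + exp z)"
      using lam_pos modulus_nonneg[of h a] assms by (intro mult_left_mono) auto
    then show "noise_size (z - a) + lam * exp (1 / 2) * modulus h a * exp z \<le> (nu + lam * exp (1 / 2) * modulus h a) * (1 + exp z)"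
      using noise_size_le[of "z - a" z] assms by (simp add: distrib_right)
  qed (use assms in simp)
  moreover have "bad_coeff h a e * (1 + exp z) = h / a\<^sup>2 * (1 + exp z) + (nu + lam * exp (1 / 2) * modulus h a) * (1 + exp z) / (e / 2)"
    unfolding bad_coeff_def by (simp only: distrib_right times_divide_eq_left)
  ultimately show ?thesis unfolding bad_size_def by linarith
qed

text \<open>The sign \<sigma> selects the direction of the excess, so that both directions share the
  initial estimate and the recursion over n steps up to time n h = 1.\<close>

lemma grid_bound:
  assumes n: "0 < n" and h: "h = 1 / real n" and e: "0 < e" and \<sigma>: "\<sigma> = 1 \<or> \<sigma> = - 1" and ee: "\<And>k. 0 \<le> ee k"
    and step: "\<And>k z. k < n \<Longrightarrow> \<exists>E\<in>borel_measurable M.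
      (AE \<omega> in M. ennreal (\<sigma> * (A (real (Suc k) * h) z \<omega> - prof.Astar (real (Suc k) * h) z) - e)
        \<le> (\<integral>\<^sup>+y. ennreal (\<sigma> * (A (real k * h) (z - y) \<omega> - prof.Astar (real k * h) (z - y)) - e) \<partial>gauss h) + E \<omega>) \<and>
      (\<integral>\<^sup>+\<omega>. E \<omega> \<partial>M) \<le> ennreal (ee k * (1 + exp z))"
  shows "(\<integral>\<^sup>+\<omega>. ennreal (\<sigma> * (A 1 z \<omega> - prof.Astar 1 z) - e) \<partial>M)
    \<le> ennreal (exp (1 / 2) * (sqrt (lam / b) + (\<Sum>j<n. ee j)) * (1 + exp z))"
proof -
  have h0: "0 < h" using n h by simp
  define T where "T k z \<omega> = \<sigma> * (A (real k * h) z \<omega> - prof.Astar (real k * h) z) - e" for k z \<omega>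
  have "(\<integral>\<^sup>+\<omega>. ennreal (T n z \<omega>) \<partial>M) \<le> ennreal (exp (real n * h / 2) * (sqrt (lam / b) + (\<Sum>j<n. ee j)) * (1 + exp z))"
  proof (rule heat_recursion[OF h0 ee])
    show "0 \<le> sqrt (lam / b)" using lam_pos b_pos by simp
    show "(\<lambda>p. T k (snd p) (fst p)) \<in> borel_measurable (M \<Otimes>\<^sub>M borel)" for k
    proof -
      have k0: "0 \<le> real k * h" using h0 by simp
      note [measurable] = A_measurable[OF k0] prof.measurable_Astar[OF k0]
      show ?thesis unfolding T_def by measurable
    qed
    show "(\<integral>\<^sup>+\<omega>. ennreal (T 0 z \<omega>) \<partial>M) \<le> ennreal (sqrt (lam / b) * (1 + exp z))" for z
    proof -
      have "(\<integral>\<^sup>+\<omega>. ennreal (T 0 z \<omega>) \<partial>M) \<le> (\<integral>\<^sup>+\<omega>. init_dev z \<omega> \<partial>M)"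
        using AE_init_dev[of z]
      proof (intro nn_integral_mono_AE, eventually_elim)
        case (elim \<omega>)
        have "ennreal (T 0 z \<omega>) \<le> ennreal (\<sigma> * (A 0 z \<omega> - prof.Astar 0 z))" using e by (intro ennreal_leI) (simp add: T_def)
        also have "\<dots> \<le> init_dev z \<omega>" using elim \<sigma> by auto
        finally show ?case .
      qed
      also have "\<dots> \<le> ennreal (sqrt (lam / b) * exp z)" by (rule init_dev_bound)
      also have "\<dots> \<le> ennreal (sqrt (lam / b) * (1 + exp z))"
        using lam_pos b_pos by (intro ennreal_leI mult_left_mono) auto
      finally show ?thesis .
    qed
    show "\<exists>E\<in>borel_measurable M.
      (AE \<omega> in M. ennreal (T (Suc k) z \<omega>) \<le> (\<integral>\<^sup>+y. ennreal (T k (z - y) \<omega>) \<partial>gauss h) + E \<omega>) \<and>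
      (\<integral>\<^sup>+\<omega>. E \<omega> \<partial>M) \<le> ennreal (ee k * (1 + exp z))" if "k < n" for k z
      using step[OF that] unfolding T_def .
  qed simp
  then show ?thesis using n by (simp add: T_def h)
qed

text \<open>Over n steps the noise adds up to n times \<open>nu\<close>, the bad times to n h = 1
  times \<open>bad_coeff\<close>, and the error of the exact solution to h times a harmonic
  sum.\<close>

lemma upper_bound:
  assumes n: "0 < n" and h: "h = 1 / real n" and a: "0 < a" and e: "0 < e" "h \<le> e / 2"
  shows "(\<integral>\<^sup>+\<omega>. ennreal (A 1 z \<omega> - prof.Astar 1 z - e) \<partial>M)
    \<le> ennreal (exp (1 / 2) * (sqrt (lam / b) + real n * nu + bad_coeff h a e + prof.lower_err * (2 * sqrt h)) * (1 + exp z))"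
proof -
  have h0: "0 < h" using n h by simp
  define ee where "ee k = nu + h * bad_coeff h a e + prof.lower_err * h * (1 / real (Suc k))" for k
  have nu0: "0 \<le> nu" using lam_pos b_pos by simp
  have bc0: "0 \<le> bad_coeff h a e" using h0 a e by (intro bad_coeff_nonneg) auto
  have ee0: "0 \<le> ee k" for k
    using nu0 bc0 h0 prof.lower_err_nonneg by (auto simp: ee_def intro!: add_nonneg_nonneg)
  have "(\<integral>\<^sup>+\<omega>. ennreal (1 * (A 1 z \<omega> - prof.Astar 1 z) - e) \<partial>M)
      \<le> ennreal (exp (1 / 2) * (sqrt (lam / b) + (\<Sum>j<n. ee j)) * (1 + exp z))"
  proof (rule grid_bound[OF n h e(1) _ ee0])
    fix k z assume k: "k < n"
    have kh: "real (Suc k) * h \<le> 1" using k n h by (simp add: divide_le_eq del: of_nat_Suc)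
    have diff: "real (Suc k) * h - real k * h = h" by (simp add: algebra_simps)
    define d where "d = prof.lower_err * h / real (Suc k)"
    have d0: "0 \<le> d" using prof.lower_err_nonneg h0 by (simp add: d_def)
    have lt: "real k * h < real (Suc k) * h" and k0: "0 \<le> real k * h" using h0 by auto
    have det: "heat (real (Suc k) * h - real k * h) (prof.Astar (real k * h)) z - (real (Suc k) * h - real k * h) \<le> prof.Astar (real (Suc k) * h) z + d"
      unfolding diff d_def by (rule prof.Astar_lower_grid[OF n k h])
    obtain E where E: "E \<in> borel_measurable M" 
      "AE \<omega> in M. ennreal (A (real (Suc k) * h) z \<omega> - prof.Astar (real (Suc k) * h) z - e)
        \<le> (\<integral>\<^sup>+y. ennreal (A (real k * h) (z - y) \<omega> - prof.Astar (real k * h) (z - y) - e) \<partial>gauss h) + E \<omega>"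
      "(\<integral>\<^sup>+\<omega>. E \<omega> \<partial>M) \<le> ennreal (noise_size z + h * bad_size h a e z + d)"
      using upper_step[OF k0 lt kh a e(1) _ d0 det] e(2) unfolding diff by blast
    have "noise_size z + h * bad_size h a e z + d \<le> ee k * (1 + exp z)"
    proof -
      have "h * bad_size h a e z \<le> h * (bad_coeff h a e * (1 + exp z))"
        using h0 a e by (intro mult_left_mono bad_size_le) auto
      moreover have "d * 1 \<le> d * (1 + exp z)" using d0 by (intro mult_left_mono) auto
      moreover have "ee k * (1 + exp z) = nu * (1 + exp z) + h * (bad_coeff h a e * (1 + exp z)) + d * (1 + exp z)"
        by (simp add: ee_def d_def distrib_right mult.assoc)
      ultimately show ?thesis using noise_size_le[of z z] by linarith
    qed
    then have "(\<integral>\<^sup>+\<omega>. E \<omega> \<partial>M) \<le> ennreal (ee k * (1 + exp z))"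
      using E(3) by (meson ennreal_leI order_trans)
    with E(1,2) show "\<exists>E\<in>borel_measurable M.
      (AE \<omega> in M. ennreal (1 * (A (real (Suc k) * h) z \<omega> - prof.Astar (real (Suc k) * h) z) - e)
        \<le> (\<integral>\<^sup>+y. ennreal (1 * (A (real k * h) (z - y) \<omega> - prof.Astar (real k * h) (z - y)) - e) \<partial>gauss h) + E \<omega>) \<and>
      (\<integral>\<^sup>+\<omega>. E \<omega> \<partial>M) \<le> ennreal (ee k * (1 + exp z))" unfolding mult_1 by blast
  qed simp
  also have "\<dots> \<le> ennreal (exp (1 / 2) * (sqrt (lam / b) + real n * nu + bad_coeff h a e + prof.lower_err * (2 * sqrt h)) * (1 + exp z))"
  proof (intro ennreal_leI mult_right_mono)
    have nh: "real n * h = 1" using n h by simp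
    have "(\<Sum>j<n. ee j) = real n * nu + real n * h * bad_coeff h a e + prof.lower_err * h * (\<Sum>j<n. 1 / real (Suc j))"
      unfolding ee_def by (simp add: sum.distrib sum_distrib_left distrib_left mult.assoc del: of_nat_Suc)
    also have "\<dots> \<le> real n * nu + real n * h * bad_coeff h a e + prof.lower_err * h * (2 * sqrt (real n))"
      using prof.lower_err_nonneg h0 by (intro add_left_mono mult_left_mono sum_inverse_le_sqrt) auto
    also have "prof.lower_err * h * (2 * sqrt (real n)) = prof.lower_err * (2 * sqrt h)"
    proof -
      have "h * sqrt (real n) = sqrt h"
        using n unfolding h by (simp add: real_sqrt_divide field_simps)
      then show ?thesis by (simp add: algebra_simps)
    qed
    finally have "(\<Sum>j<n. ee j) \<le> real n * nu + bad_coeff h a e + prof.lower_err * (2 * sqrt h)"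
      by (simp add: nh)
    then show "exp (1 / 2) * (sqrt (lam / b) + (\<Sum>j<n. ee j)) \<le> exp (1 / 2) * (sqrt (lam / b) + real n * nu + bad_coeff h a e + prof.lower_err * (2 * sqrt h))"
      by (intro mult_left_mono) auto
  qed (simp add: add_nonneg_nonneg)
  finally show ?thesis by simp
qed

text \<open>The error of order h^2 / a^2 occurs n times and leaves h / a^2; the error of the step
  from time 0 enters once.\<close>

lemma lower_bound:
  assumes n: "0 < n" and h: "h = 1 / real n" and a: "0 < a" "2 * \<bar>kappa lam\<bar> * sqrt h \<le> a" "prof.dens_bound * a\<^sup>2 \<le> e" and e: "0 < e"
  shows "(\<integral>\<^sup>+\<omega>. ennreal (prof.Astar 1 z - A 1 z \<omega> - e) \<partial>M)
    \<le> ennreal (exp (1 / 2) * (sqrt (lam / b) + real n * nu + 12 * prof.dens_bound * h / a\<^sup>2 + (prof.init_const + 1) * h) * (1 + exp z))"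
proof -
  have h0: "0 < h" using n h by simp
  define ee where "ee k = nu + prof.upper_err h a k" for k
  have nu0: "0 \<le> nu" using lam_pos b_pos by simp
  have ee0: "0 \<le> ee k" for k
    using nu0 h0 prof.upper_err_nonneg[of h a k] by (auto simp: ee_def)
  have minus: "- 1 * (p - q) = q - (p :: real)" for p q by simp
  have "(\<integral>\<^sup>+\<omega>. ennreal (- 1 * (A 1 z \<omega> - prof.Astar 1 z) - e) \<partial>M)
      \<le> ennreal (exp (1 / 2) * (sqrt (lam / b) + (\<Sum>j<n. ee j)) * (1 + exp z))"
  proof (rule grid_bound[OF n h e _ ee0])
    fix k z assume k: "k < n"
    have kh: "real (Suc k) * h \<le> 1" using k n h by (simp add: divide_le_eq del: of_nat_Suc)
    have diff: "real (Suc k) * h - real k * h = h" by (simp add: algebra_simps)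
    define d where "d = prof.upper_err h a k"
    have d0: "0 \<le> d" using prof.upper_err_nonneg h0 by (simp add: d_def)
    have lt: "real k * h < real (Suc k) * h" and k0: "0 \<le> real k * h" using h0 by auto
    have det: "prof.Astar (real (Suc k) * h) z \<le> max (heat (real (Suc k) * h - real k * h) (prof.Astar (real k * h)) z - (real (Suc k) * h - real k * h)) e + d"
      unfolding diff d_def by (rule prof.Astar_upper_grid[OF n k h a])
    obtain E where E: "E \<in> borel_measurable M" 
      "AE \<omega> in M. ennreal (prof.Astar (real (Suc k) * h) z - A (real (Suc k) * h) z \<omega> - e)
        \<le> (\<integral>\<^sup>+y. ennreal (prof.Astar (real k * h) (z - y) - A (real k * h) (z - y) \<omega> - e) \<partial>gauss h) + E \<omega>"
      "(\<integral>\<^sup>+\<omega>. E \<omega> \<partial>M) \<le> ennreal (noise_size z + d)"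
      using lower_step[OF k0 lt kh d0 det] unfolding diff by blast
    have "d * 1 \<le> d * (1 + exp z)" using d0 by (intro mult_left_mono) auto
    then have "noise_size z + d \<le> ee k * (1 + exp z)"
      using noise_size_le[of z z] by (simp add: ee_def d_def distrib_right)
    then have "(\<integral>\<^sup>+\<omega>. E \<omega> \<partial>M) \<le> ennreal (ee k * (1 + exp z))"
      using E(3) by (meson ennreal_leI order_trans)
    with E(1,2) show "\<exists>E\<in>borel_measurable M.
      (AE \<omega> in M. ennreal (- 1 * (A (real (Suc k) * h) z \<omega> - prof.Astar (real (Suc k) * h) z) - e)
        \<le> (\<integral>\<^sup>+y. ennreal (- 1 * (A (real k * h) (z - y) \<omega> - prof.Astar (real k * h) (z - y)) - e) \<partial>gauss h) + E \<omega>) \<and>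
      (\<integral>\<^sup>+\<omega>. E \<omega> \<partial>M) \<le> ennreal (ee k * (1 + exp z))" unfolding minus by blast
  qed simp
  also have "(\<Sum>j<n. ee j) = real n * nu + 12 * prof.dens_bound * h / a\<^sup>2 + (prof.init_const + 1) * h"
  proof -
    have nh: "real n * h = 1" using n h by simp
    have "(\<Sum>j<n. ee j) = real n * nu + real n * (12 * prof.dens_bound * h\<^sup>2 / a\<^sup>2) + (prof.init_const + 1) * h"
      unfolding ee_def prof.upper_err_def using n by (simp add: sum.distrib)
    also have "real n * (12 * prof.dens_bound * h\<^sup>2 / a\<^sup>2) = (real n * h) * (12 * prof.dens_bound * h / a\<^sup>2)"
      by (simp add: power2_eq_square)
    finally show ?thesis by (simp add: nh)
  qed
  finally show ?thesis by (simp add: add.assoc)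
qed

text \<open>A deviation of at least 2 e means that the excess over e, in one of the two directions,
  is at least e; Markov's inequality is applied to both.\<close>

lemma deviation_bound:
  assumes n: "0 < n" and h: "h = 1 / real n" and a: "0 < a" "2 * \<bar>kappa lam\<bar> * sqrt h \<le> a" "prof.dens_bound * a\<^sup>2 \<le> e" and e: "0 < e" "h \<le> e / 2"
  shows "emeasure M {\<omega>\<in>space M. 2 * e \<le> \<bar>A 1 z \<omega> - prof.Astar 1 z\<bar>}
    \<le> ennreal (exp (1 / 2) * (1 + exp z) / e * (2 * (sqrt (lam / b) + real n * nu) + bad_coeff h a e + prof.lower_err * (2 * sqrt h)
        + 12 * prof.dens_bound * h / a\<^sup>2 + (prof.init_const + 1) * h))"
proof -
  have h0: "0 < h" using n h by simp
  define B1 where "B1 = exp (1 / 2) * (sqrt (lam / b) + real n * nu + bad_coeff h a e + prof.lower_err * (2 * sqrt h)) * (1 + exp z)"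
  define B2 where "B2 = exp (1 / 2) * (sqrt (lam / b) + real n * nu + 12 * prof.dens_bound * h / a\<^sup>2 + (prof.init_const + 1) * h) * (1 + exp z)"
  have B: "0 \<le> B1" "0 \<le> B2"
    unfolding B1_def B2_def using lam_pos b_pos h0 a e bad_coeff_nonneg prof.lower_err_nonneg prof.dens_bound_nonneg prof.init_const_nonneg
    by (auto intro!: mult_nonneg_nonneg add_nonneg_nonneg divide_nonneg_nonneg)
  have [measurable]: "A 1 z \<in> borel_measurable M" by (intro A_measurable') simp
  have 1: "emeasure M {\<omega>\<in>space M. e \<le> A 1 z \<omega> - prof.Astar 1 z - e} \<le> ennreal (B1 / e)"
    using upper_bound[OF n h a(1) e, of z] B e unfolding B1_def[symmetric] by (intro emeasure_Markov_real) auto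
  have 2: "emeasure M {\<omega>\<in>space M. e \<le> prof.Astar 1 z - A 1 z \<omega> - e} \<le> ennreal (B2 / e)"
    using lower_bound[OF n h a e(1), of z] B e unfolding B2_def[symmetric] by (intro emeasure_Markov_real) auto
  have "emeasure M {\<omega>\<in>space M. 2 * e \<le> \<bar>A 1 z \<omega> - prof.Astar 1 z\<bar>}
    \<le> emeasure M ({\<omega>\<in>space M. e \<le> A 1 z \<omega> - prof.Astar 1 z - e} \<union> {\<omega>\<in>space M. e \<le> prof.Astar 1 z - A 1 z \<omega> - e})"
    by (intro emeasure_mono) auto
  also have "\<dots> \<le> emeasure M {\<omega>\<in>space M. e \<le> A 1 z \<omega> - prof.Astar 1 z - e} + emeasure M {\<omega>\<in>space M. e \<le> prof.Astar 1 z - A 1 z \<omega> - e}"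
    by (rule emeasure_subadditive) auto
  also have "\<dots> \<le> ennreal (B1 / e) + ennreal (B2 / e)" by (intro add_mono 1 2)
  also have "\<dots> = ennreal (B1 / e + B2 / e)" using B e by (intro ennreal_plus[symmetric]) auto
  also have "B1 / e + B2 / e = exp (1 / 2) * (1 + exp z) / e * (2 * (sqrt (lam / b) + real n * nu) + bad_coeff h a e + prof.lower_err * (2 * sqrt h)
        + 12 * prof.dens_bound * h / a\<^sup>2 + (prof.init_const + 1) * h)"
  proof -
    have sum: "c * p * q / e + c * r * q / e = c * q / e * (p + r)" for c p q r :: real
      by (simp add: algebra_simps add_divide_distrib)
    show ?thesis
      unfolding B1_def B2_def sum by (rule arg_cong[where f = "\<lambda>y. exp (1 / 2) * (1 + exp z) / e * y"]) simp
  qed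
  finally show ?thesis .
qed

end

section \<open>Rescaling the Atlas system\<close>

context
  fixes m :: real and p :: "nat \<Rightarrow> real"
  assumes m: "0 \<le> m" and p: "\<And>n. p n = m ^ n / fact n * exp (- m)"
begin

lemma poisson_sums_1: "p sums 1"
proof -
  have "(\<lambda>n. m ^ n / fact n) sums exp m"
    using exp_converges[of m] by (simp add: scaleR_conv_of_real field_simps)
  then have "(\<lambda>n. m ^ n / fact n * exp (- m)) sums (exp m * exp (- m))" by (rule sums_mult2)
  then show ?thesis by (simp add: p[abs_def] exp_minus)
qed

lemma poisson_Suc: "real (Suc n) * p (Suc n) = m * p n"
  unfolding p by (simp add: field_simps del: of_nat_Suc)

lemma poisson_sums_mean: "(\<lambda>n. real n * p n) sums m"
proof -
  have "(\<lambda>n. real (Suc n) * p (Suc n)) sums (m * 1)"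
    unfolding poisson_Suc by (rule sums_mult[OF poisson_sums_1])
  from sums_Suc[OF this] show ?thesis by simp
qed

text \<open>The second factorial moment reduces to the mean by shifting the index, as the mean
  reduces to the total mass.\<close>

lemma poisson_sums_variance: "(\<lambda>n. (real n - m)\<^sup>2 * p n) sums m"
proof -
  have eq: "real (Suc n) * (real (Suc n) - 1) * p (Suc n) = m * (real n * p n)" for n
  proof -
    have "real (Suc n) * (real (Suc n) - 1) * p (Suc n) = real n * (real (Suc n) * p (Suc n))" by simp
    then show ?thesis unfolding poisson_Suc by simp
  qed
  have "(\<lambda>n. real (Suc n) * (real (Suc n) - 1) * p (Suc n)) sums (m * m)"
    unfolding eq by (rule sums_mult[OF poisson_sums_mean])
  from sums_Suc[OF this] have 2: "(\<lambda>n. real n * (real n - 1) * p n) sums (m * m)" by simp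
  \<comment> \<open>The expansion (n - m)^2 = n (n - 1) + (1 - 2 m) n + m^2.\<close>
  have "(\<lambda>n. real n * (real n - 1) * p n + (1 - 2 * m) * (real n * p n) + m\<^sup>2 * p n) sums (m * m + (1 - 2 * m) * m + m\<^sup>2 * 1)"
    by (intro sums_add sums_mult 2 poisson_sums_mean poisson_sums_1)
  also have "(\<lambda>n. real n * (real n - 1) * p n + (1 - 2 * m) * (real n * p n) + m\<^sup>2 * p n) = (\<lambda>n. (real n - m)\<^sup>2 * p n)"
    by (simp add: fun_eq_iff power2_eq_square algebra_simps)
  also have "m * m + (1 - 2 * m) * m + m\<^sup>2 * 1 = m" by (simp add: power2_eq_square algebra_simps)
  finally show ?thesis .
qed

end

lemma (in prob_space) nn_integral_discrete:
  fixes K :: "'a \<Rightarrow> nat" and f :: "nat \<Rightarrow> real"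
  assumes K [measurable]: "K \<in> M \<rightarrow>\<^sub>M count_space UNIV" and f: "\<And>n. 0 \<le> f n"
    and prob: "\<And>n. prob {\<omega>\<in>space M. K \<omega> = n} = p n" and sums: "(\<lambda>n. f n * p n) sums s"
  shows "(\<integral>\<^sup>+\<omega>. ennreal (f (K \<omega>)) \<partial>M) = ennreal s"
proof -
  have p0: "0 \<le> p n" for n unfolding prob[symmetric] by simp
  have "(\<integral>\<^sup>+\<omega>. ennreal (f (K \<omega>)) \<partial>M) = (\<integral>\<^sup>+\<omega>. (\<Sum>n. ennreal (f n) * indicator {\<omega>\<in>space M. K \<omega> = n} \<omega>) \<partial>M)"
  proof (rule nn_integral_cong)
    fix \<omega> assume \<omega>: "\<omega> \<in> space M"
    have "(\<Sum>n. ennreal (f n) * indicator {\<omega>\<in>space M. K \<omega> = n} \<omega>) = (\<Sum>n\<in>{K \<omega>}. ennreal (f n) * indicator {\<omega>\<in>space M. K \<omega> = n} \<omega>)"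
      by (rule suminf_finite) auto
    then show "ennreal (f (K \<omega>)) = (\<Sum>n. ennreal (f n) * indicator {\<omega>\<in>space M. K \<omega> = n} \<omega>)"
      using \<omega> by simp
  qed
  also have "\<dots> = (\<Sum>n. ennreal (f n) * emeasure M {\<omega>\<in>space M. K \<omega> = n})"
    by (subst nn_integral_suminf) (auto simp: nn_integral_cmult)
  also have "\<dots> = (\<Sum>n. ennreal (f n * p n))"
    by (simp add: emeasure_eq_measure prob ennreal_mult f p0)
  also have "\<dots> = ennreal s"
    using sums f p0 by (subst suminf_ennreal2) (auto simp: sums_iff)
  finally show ?thesis .
qed

lemma has_rank_scale:
  assumes "0 < b" shows "has_rank (\<lambda>j. y j / b) i k \<longleftrightarrow> has_rank y i k"
  using assms by (simp add: has_rank_def ranked_before_def divide_less_cancel)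

lemma interval_integral_rescale:
  fixes f :: "real \<Rightarrow> real" and c t :: real
  assumes "0 < c" "0 \<le> t"
  shows "(LBINT u=0..c * t. f u) = c * (LBINT u=0..t. f (c * u))"
proof -
  have "(LBINT u=0..c * t. f u) = (LBINT u:{0..c * t}. f u)"
    using assms interval_integral_Icc[of 0 "c * t" f] by (simp add: zero_ereal_def)
  also have "\<dots> = (\<integral>u. indicator {0..c * t} u *\<^sub>R f u \<partial>lborel)" by (simp add: set_lebesgue_integral_def)
  also have "\<dots> = \<bar>c\<bar> *\<^sub>R (\<integral>u. indicator {0..c * t} (0 + c * u) *\<^sub>R f (0 + c * u) \<partial>lborel)"
    by (rule lborel_integral_real_affine) (use assms in simp)
  also have "(\<integral>u. indicator {0..c * t} (0 + c * u) *\<^sub>R f (0 + c * u) \<partial>lborel) = (LBINT u:{0..t}. f (c * u))"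
    unfolding set_lebesgue_integral_def using assms
    by (intro Bochner_Integration.integral_cong) (auto simp: indicator_def zero_le_mult_iff)
  also have "\<dots> = (LBINT u=0..t. f (c * u))"
    using assms interval_integral_Icc[of 0 t "\<lambda>u. f (c * u)"] by (simp add: zero_ereal_def)
  finally show ?thesis using assms by simp
qed

lemma emeasure_half_line_intensity:
  assumes "0 \<le> lam"
  shows "emeasure (density lborel (\<lambda>x. ennreal (lam * indicator {0..} x))) {..r} = ennreal (lam * max 0 r)"
proof -
  have "emeasure (density lborel (\<lambda>x. ennreal (lam * indicator {0..} x))) {..r} = (\<integral>\<^sup>+x. ennreal (lam * indicator {0..} x) * indicator {..r} x \<partial>lborel)"
    by (rule emeasure_density) auto
  also have "\<dots> = (\<integral>\<^sup>+x. ennreal lam * indicator {0..max 0 r} x \<partial>lborel)"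
  proof (rule nn_integral_cong_AE)
    \<comment> \<open>For negative r the interval on the right is the single point 0 and the set on
      the left is empty.\<close>
    have "AE x in lborel. x \<noteq> (0 :: real)" by (rule AE_lborel_singleton)
    then show "AE x in lborel. ennreal (lam * indicator {0..} x) * indicator {..r} x = ennreal lam * indicator {0..max 0 r} x"
      by eventually_elim (auto simp: indicator_def max_def)
  qed
  also have "\<dots> = ennreal lam * ennreal (max 0 r)" by (simp add: nn_integral_cmult)
  also have "\<dots> = ennreal (lam * max 0 r)" using assms by (simp add: ennreal_mult)
  finally show ?thesis .
qed

context atlas_infinity
begin

lemma W_continuous: "AE \<omega> in M. \<forall>i. continuous_on {0..} (\<lambda>t. W i t \<omega>)"
  unfolding AE_all_countable using brownian standard_brownian_motion.continuous_paths by blast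

text \<open>Brownian scaling keeps the increments standard. Time runs faster by b^2 and space is
  divided by b, so the unit drift becomes b, and a unit of rescaled length carries lam b points in
  the mean.\<close>

lemma fast_atlas_rescaled:
  assumes lam: "0 < lam" and init: "PPP_plus M lam (\<lambda>i. X i 0)" and b: "0 < b"
  shows "fast_atlas M (\<lambda>t. F (b\<^sup>2 * t)) (\<lambda>i t \<omega>. W i (b\<^sup>2 * t) \<omega> / b) (\<lambda>i t \<omega>. X i (b\<^sup>2 * t) \<omega> / b) b lam"
proof
  show "0 < b" "0 < lam" by fact+
  have bt: "0 \<le> b\<^sup>2 * t" if "0 \<le> t" for t using that by simp
  fix t :: real assume t: "0 \<le> t"
  show "subalgebra M (F (b\<^sup>2 * t))" by (rule subalgebra_F)
  fix i
  have [measurable]: "X i (b\<^sup>2 * t) \<in> borel_measurable (F (b\<^sup>2 * t))" by (rule X_adapted[OF bt[OF t]])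
  show "(\<lambda>\<omega>. X i (b\<^sup>2 * t) \<omega> / b) \<in> borel_measurable (F (b\<^sup>2 * t))" by measurable
  have [measurable]: "W i (b\<^sup>2 * t) \<in> borel_measurable M"
    by (rule standard_brownian_motion.random_variable[OF brownian bt[OF t]])
  show "(\<lambda>\<omega>. W i (b\<^sup>2 * t) \<omega> / b) \<in> borel_measurable M" by measurable
next
  fix s t :: real and i assume st: "0 \<le> s" "s < t"
  have bst: "b\<^sup>2 * s < b\<^sup>2 * t" "0 \<le> b\<^sup>2 * s" using b st by auto
  have "distributed M lborel (\<lambda>\<omega>. W i (b\<^sup>2 * t) \<omega> - W i (b\<^sup>2 * s) \<omega>) (\<lambda>x. ennreal (normal_density 0 (sqrt (b\<^sup>2 * t - b\<^sup>2 * s)) x))"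
    by (rule standard_brownian_motion.gaussian_increments[OF brownian bst(2,1)])
  then have "distributed M lborel (\<lambda>\<omega>. 0 + (1 / b) * (W i (b\<^sup>2 * t) \<omega> - W i (b\<^sup>2 * s) \<omega>)) (normal_density (0 + (1 / b) * 0) (\<bar>1 / b\<bar> * sqrt (b\<^sup>2 * t - b\<^sup>2 * s)))"
    using bst b by (intro normal_density_affine) auto
  moreover have "\<bar>1 / b\<bar> * sqrt (b\<^sup>2 * t - b\<^sup>2 * s) = sqrt (t - s)"
    using b by (simp add: right_diff_distrib[symmetric] real_sqrt_mult)
  ultimately have "distributed M lborel (\<lambda>\<omega>. W i (b\<^sup>2 * t) \<omega> / b - W i (b\<^sup>2 * s) \<omega> / b) (normal_density 0 (sqrt (t - s)))"
    by (simp add: diff_divide_distrib)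
  then have "distr M lborel (\<lambda>\<omega>. W i (b\<^sup>2 * t) \<omega> / b - W i (b\<^sup>2 * s) \<omega> / b) = gauss (t - s)"
    unfolding gauss_def by (rule distributed_distr_eq_density)
  moreover have "distr M lborel (\<lambda>\<omega>. W i (b\<^sup>2 * t) \<omega> / b - W i (b\<^sup>2 * s) \<omega> / b) = distr M borel (\<lambda>\<omega>. W i (b\<^sup>2 * t) \<omega> / b - W i (b\<^sup>2 * s) \<omega> / b)"
    by (rule distr_cong) auto
  ultimately show "distr M borel (\<lambda>\<omega>. W i (b\<^sup>2 * t) \<omega> / b - W i (b\<^sup>2 * s) \<omega> / b) = gauss (t - s)" by simp
next
  fix s t :: real and i j :: nat assume st: "0 \<le> s" "s < t" and ij: "i \<noteq> j"
  have bst: "b\<^sup>2 * s \<in> {0..}" "b\<^sup>2 * t \<in> {0..}" using b st by auto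
  have component: "(\<lambda>y. y u) \<in> (\<Pi>\<^sub>M t\<in>{0 :: real..}. borel :: real measure) \<rightarrow>\<^sub>M borel" if "u \<in> {0..}" for u
    by (rule measurable_component_singleton[OF that])
  define g where "g y = y (b\<^sup>2 * t) / b - y (b\<^sup>2 * s) / b" for y :: "real \<Rightarrow> real"
  have g: "g \<in> borel_measurable (\<Pi>\<^sub>M t\<in>{0..}. borel)"
    unfolding g_def by (intro borel_measurable_diff borel_measurable_divide component bst measurable_const) auto
  have "indep_vars (\<lambda>_. borel) (\<lambda>i \<omega>. g (\<lambda>t\<in>{0..}. W i t \<omega>)) UNIV"
    by (rule indep_vars_compose2[OF W_indep, of "\<lambda>_. g" "\<lambda>_. borel"]) (rule g)
  moreover have "g (\<lambda>t\<in>{0..}. W i t \<omega>) = W i (b\<^sup>2 * t) \<omega> / b - W i (b\<^sup>2 * s) \<omega> / b" for i \<omega>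
    using bst by (simp add: g_def)
  ultimately have "indep_vars (\<lambda>_. borel) (\<lambda>i \<omega>. W i (b\<^sup>2 * t) \<omega> / b - W i (b\<^sup>2 * s) \<omega> / b) UNIV"
    by (simp only:)
  then have "indep_vars (\<lambda>_. borel) (\<lambda>i \<omega>. W i (b\<^sup>2 * t) \<omega> / b - W i (b\<^sup>2 * s) \<omega> / b) (insert i {j})"
    by (rule indep_vars_subset) simp
  from indep_vars_sum[OF _ _ this] ij
  show "indep_var borel (\<lambda>\<omega>. W i (b\<^sup>2 * t) \<omega> / b - W i (b\<^sup>2 * s) \<omega> / b) borel (\<lambda>\<omega>. W j (b\<^sup>2 * t) \<omega> / b - W j (b\<^sup>2 * s) \<omega> / b)"
    by simp
next
  fix s t :: real and i j :: nat assume st: "0 \<le> s" "s < t"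
  define s' t' where "s' = b\<^sup>2 * s" and "t' = b\<^sup>2 * t"
  have st': "0 \<le> s'" "s' < t'" using st b by (auto simp: s'_def t'_def)
  let ?P = "\<Pi>\<^sub>M p\<in>(UNIV :: nat set) \<times> {s'..}. borel :: real measure"
  let ?Psi = "\<lambda>\<omega>. \<lambda>(i, t)\<in>UNIV \<times> {s'..}. W i t \<omega> - W i s' \<omega>"
  let ?V = "vimage_algebra (space M) ?Psi ?P"
  have Psi: "?Psi \<in> ?V \<rightarrow>\<^sub>M ?P"
    by (rule measurable_vimage_algebra1) (auto simp: space_PiM)
  \<comment> \<open>The rescaled increments of two particles are functions of the whole future of
    the Brownian family after s', so their algebra lies inside the one that is independent of the
    past.\<close>
  have comp: "(\<lambda>f. f (l, t') / b) \<in> ?P \<rightarrow>\<^sub>M borel" for l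
  proof -
    have "(l, t') \<in> (UNIV :: nat set) \<times> {s'..}" using st' by simp
    from measurable_component_singleton[OF this]
    have "(\<lambda>f. f (l, t')) \<in> ?P \<rightarrow>\<^sub>M borel" .
    then show ?thesis by (intro borel_measurable_divide) auto
  qed
  have inc: "(\<lambda>\<omega>. W l t' \<omega> / b - W l s' \<omega> / b) \<in> ?V \<rightarrow>\<^sub>M borel" for l
    using measurable_compose[OF Psi comp, of l] st' by (simp add: diff_divide_distrib)
  have sub: "sets (vimage_algebra (space M) (\<lambda>\<omega>. (W i t' \<omega> / b - W i s' \<omega> / b, W j t' \<omega> / b - W j s' \<omega> / b)) (borel \<Otimes>\<^sub>M borel)) \<subseteq> sets ?V"
    by (rule sets_image_in_sets) (auto intro!: measurable_Pair inc)
  show "indep_set (sets (F (b\<^sup>2 * s))) (sets (vimage_algebra (space M)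
      (\<lambda>\<omega>. (W i (b\<^sup>2 * t) \<omega> / b - W i (b\<^sup>2 * s) \<omega> / b, W j (b\<^sup>2 * t) \<omega> / b - W j (b\<^sup>2 * s) \<omega> / b)) (borel \<Otimes>\<^sub>M borel)))"
    using future_indep[OF st'(1)] unfolding indep_set_def s'_def[symmetric] t'_def[symmetric]
    by (rule indep_sets_mono_sets) (use sub in \<open>auto split: bool.split\<close>)
next
  have cont: "continuous_on {0..} (\<lambda>t. f (b\<^sup>2 * t) / b)" if "continuous_on {0..} f" for f :: "real \<Rightarrow> real"
  proof -
    have "continuous_on {0..} (\<lambda>t. f (b\<^sup>2 * t))"
      by (rule continuous_on_compose2[OF that]) (auto intro!: continuous_intros)
    then show ?thesis using b by (auto intro!: continuous_intros)
  qed
  show "AE \<omega> in M. \<forall>i. continuous_on {0..} (\<lambda>t. X i (b\<^sup>2 * t) \<omega> / b)"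
    using X_continuous
  proof eventually_elim
    case (elim \<omega>)
    show ?case
    proof
      fix i show "continuous_on {0..} (\<lambda>t. X i (b\<^sup>2 * t) \<omega> / b)"
        by (rule cont) (use elim in blast)
    qed
  qed
  show "AE \<omega> in M. \<forall>i. continuous_on {0..} (\<lambda>t. W i (b\<^sup>2 * t) \<omega> / b)"
    using W_continuous
  proof eventually_elim
    case (elim \<omega>)
    show ?case
    proof
      fix i show "continuous_on {0..} (\<lambda>t. W i (b\<^sup>2 * t) \<omega> / b)"
        by (rule cont) (use elim in blast)
    qed
  qed
next
  show "AE \<omega> in M. \<forall>i. \<forall>t\<ge>0. X i (b\<^sup>2 * t) \<omega> / b = X i (b\<^sup>2 * 0) \<omega> / b
      + b * (LBINT u=0..t. (if has_rank (\<lambda>j. X j (b\<^sup>2 * u) \<omega> / b) i 1 then 1 else 0)) + W i (b\<^sup>2 * t) \<omega> / b"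
    using sde
  proof eventually_elim
    case (elim \<omega>)
    show ?case
    proof (intro allI impI)
      fix i t assume t: "0 \<le> (t :: real)"
      define I where "I = (LBINT u=0..t. (if has_rank (\<lambda>j. X j (b\<^sup>2 * u) \<omega>) i 1 then 1 else 0 :: real))"
      have "0 \<le> b\<^sup>2 * t" using t by simp
      then have "X i (b\<^sup>2 * t) \<omega> = X i 0 \<omega> + (LBINT u=0..b\<^sup>2 * t. (if has_rank (\<lambda>j. X j u \<omega>) i 1 then 1 else 0)) + W i (b\<^sup>2 * t) \<omega>"
        using elim by blast
      also have "(LBINT u=0..b\<^sup>2 * t. (if has_rank (\<lambda>j. X j u \<omega>) i 1 then 1 else 0 :: real)) = b\<^sup>2 * I"
        unfolding I_def using b t by (intro interval_integral_rescale) auto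
      finally have "X i (b\<^sup>2 * t) \<omega> = X i 0 \<omega> + b\<^sup>2 * I + W i (b\<^sup>2 * t) \<omega>" .
      then have "X i (b\<^sup>2 * t) \<omega> / b = X i 0 \<omega> / b + b * I + W i (b\<^sup>2 * t) \<omega> / b"
        using b by (simp add: add_divide_distrib power2_eq_square)
      then show "X i (b\<^sup>2 * t) \<omega> / b = X i (b\<^sup>2 * 0) \<omega> / b
        + b * (LBINT u=0..t. (if has_rank (\<lambda>j. X j (b\<^sup>2 * u) \<omega> / b) i 1 then 1 else 0)) + W i (b\<^sup>2 * t) \<omega> / b"
        by (simp only: has_rank_scale[OF b] I_def mult_zero_right)
    qed
  qed
next
  fix r :: real
  let ?mu = "density lborel (\<lambda>x. ennreal (lam * indicator {0..} x))"
  define m where "m = lam * b * max 0 r"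
  have m0: "0 \<le> m" using lam b by (simp add: m_def)
  have mu: "emeasure ?mu {..b * r} = ennreal m"
  proof -
    have "max 0 (b * r) = b * max 0 r" using b by (auto simp: max_def zero_le_mult_iff mult_le_0_iff)
    then show ?thesis using emeasure_half_line_intensity[of lam "b * r"] lam by (simp add: m_def mult.assoc)
  qed
  then have mu': "measure ?mu {..b * r} = m" using m0 by (simp add: measure_def)
  have pp: "poisson_points M ?mu (\<lambda>i. X i 0)" using init by (simp add: PPP_plus_def)
  have set: "{i. X i (b\<^sup>2 * 0) \<omega> / b \<le> r} = {i. X i 0 \<omega> \<in> {..b * r}}" for \<omega>
    using b by (auto simp: pos_divide_le_eq mult.commute)
  have "{..b * r} \<in> sets borel \<and> emeasure ?mu {..b * r} < \<infinity>" by (simp add: mu)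
  then have *: "AE \<omega> in M. finite {i. X i 0 \<omega> \<in> {..b * r}}"
      "\<And>n. measure M {\<omega> \<in> space M. card {i. X i 0 \<omega> \<in> {..b * r}} = n} = m ^ n / fact n * exp (- m)"
    using pp unfolding poisson_points_def mu'[symmetric] by blast+
  show "AE \<omega> in M. finite {i. X i (b\<^sup>2 * 0) \<omega> / b \<le> r}" unfolding set by (rule *)
  have Xm: "X i 0 \<in> borel_measurable M" for i using pp by (simp add: poisson_points_def)
  have K: "(\<lambda>\<omega>. card {i. X i 0 \<omega> \<in> {..b * r}}) \<in> M \<rightarrow>\<^sub>M count_space UNIV"
  proof (rule measurable_card)
    fix i
    note [measurable] = Xm[of i]
    have "{\<omega>\<in>space M. X i 0 \<omega> \<le> b * r} \<in> sets M" by measurable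
    then show "{\<omega>\<in>space M. i \<in> {i. X i 0 \<omega> \<in> {..b * r}}} \<in> sets M" by simp
  qed
  show "(\<integral>\<^sup>+\<omega>. ennreal (real (card {i. X i (b\<^sup>2 * 0) \<omega> / b \<le> r})) \<partial>M) = ennreal (lam * b * max 0 r)"
    unfolding set m_def[symmetric]
    by (rule nn_integral_discrete[OF K, of real, OF _ *(2) poisson_sums_mean[OF m0 refl]]) simp
  have "(\<integral>\<^sup>+\<omega>. ennreal ((real (card {i. X i 0 \<omega> \<in> {..b * r}}) - m)\<^sup>2) \<partial>M) = ennreal m"
    by (rule nn_integral_discrete[OF K, of "\<lambda>n. (real n - m)\<^sup>2", OF _ *(2) poisson_sums_variance[OF m0 refl]]) simp
  then show "(\<integral>\<^sup>+\<omega>. ennreal ((real (card {i. X i (b\<^sup>2 * 0) \<omega> / b \<le> r}) - lam * b * max 0 r)\<^sup>2) \<partial>M) \<le> ennreal (lam * b * max 0 r)"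
    unfolding set m_def[symmetric] by simp
qed

end

section \<open>Quantiles and ranks\<close>

context profile
begin

text \<open>The distribution function of \<open>Q_star\<close> at time 1, as
  \<open>emeasure_Q_star\<close> shows.\<close>

definition Fstar :: "real \<Rightarrow> real" where
  "Fstar z = (if \<kappa> < z then mass z else 0)"

lemma u_star_eq: "0 < t \<Longrightarrow> u_star lam t x = dens (x / sqrt t) * indicator {\<kappa> * sqrt t<..} x"
  by (simp add: u_star_def dens_def)

lemma emeasure_Q_star:
  assumes t: "0 < t" shows "emeasure (Q_star lam t) {..z} = ennreal (sqrt t * Fstar (z / sqrt t))"
proof -
  define r where "r = sqrt t"
  have r: "0 < r" using t by (simp add: r_def)
  have [measurable]: "u_star lam t \<in> borel_measurable borel"
    unfolding u_star_def[abs_def] by measurable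
  have "emeasure (Q_star lam t) {..z} = (\<integral>\<^sup>+x. ennreal (u_star lam t x) * indicator {..z} x \<partial>lborel)"
    unfolding Q_star_def by (rule emeasure_density) auto
  also have "\<dots> = ennreal (r * Fstar (z / r))"
  proof (cases "\<kappa> * r < z")
    case True
    have "(\<integral>\<^sup>+x. ennreal (u_star lam t x) * indicator {..z} x \<partial>lborel) = (\<integral>\<^sup>+x. ennreal (dens (x / r)) * indicator {\<kappa> * r..z} x \<partial>lborel)"
    proof (rule nn_integral_cong_AE)
      have "AE x in lborel. x \<noteq> \<kappa> * r" by (rule AE_lborel_singleton)
      then show "AE x in lborel. ennreal (u_star lam t x) * indicator {..z} x = ennreal (dens (x / r)) * indicator {\<kappa> * r..z} x"
        by eventually_elim (auto simp: u_star_eq[OF t] r_def[symmetric] indicator_def)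
    qed
    also have "\<dots> = ennreal (r * mass (z / r) - r * mass (\<kappa> * r / r))"
    proof (rule nn_integral_FTC_Icc)
      show "(\<lambda>x. dens (x / r)) \<in> borel_measurable borel" unfolding dens_def by measurable
      show "\<kappa> * r \<le> z" using True by simp
      fix x assume "x \<in> {\<kappa> * r..z}"
      then have "\<kappa> \<le> x / r" using r by (simp add: pos_le_divide_eq)
      then show "0 \<le> dens (x / r)" by (rule less_imp_le[OF dens_pos])
      have "DERIV (\<lambda>x. x / r) x :> 1 / r" using r by (auto intro!: derivative_eq_intros)
      from DERIV_cmult[OF DERIV_chain2[OF DERIV_mass this], of r]
      show "DERIV (\<lambda>x. r * mass (x / r)) x :> dens (x / r)" using r by simp
    qed
    finally show ?thesis using True r by (simp add: mass_kappa Fstar_def pos_less_divide_eq)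
  next
    case False
    then have "(\<integral>\<^sup>+x. ennreal (u_star lam t x) * indicator {..z} x \<partial>lborel) = (\<integral>\<^sup>+(x::real). 0 \<partial>lborel)"
      by (intro nn_integral_cong) (auto simp: u_star_eq[OF t] r_def[symmetric] indicator_def)
    then show ?thesis using False r by (simp add: Fstar_def pos_less_divide_eq)
  qed
  finally show ?thesis by (simp add: r_def)
qed

lemma mass_diff_ge:
  assumes "\<kappa> \<le> x" "x \<le> y" shows "min 2 lam * (y - x) \<le> mass y - mass x"
proof (cases "x = y")
  case False
  with assms have "x < y" by simp
  from MVT2[OF this DERIV_mass] obtain v where "x < v" "v < y" "mass y - mass x = (y - x) * dens v" by blast
  moreover have "(y - x) * min 2 lam \<le> (y - x) * dens v"
    using assms \<open>x < v\<close> by (intro mult_left_mono dens_ge) auto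
  ultimately show ?thesis by (simp add: mult.commute)
qed simp

text \<open>The density is bounded below by min 2 lam, so the first integral grows at least linearly
  and reaches q within distance q / min 2 lam of the front.\<close>

lemma mass_surj:
  assumes "0 \<le> q" obtains y where "\<kappa> \<le> y" "mass y = q"
proof -
  define l where "l = min 2 lam"
  have l: "0 < l" using lam_pos by (simp add: l_def)
  have "\<kappa> \<le> \<kappa> + q / l" using l assms by simp
  from mass_diff_ge[OF order_refl this] have "q \<le> mass (\<kappa> + q / l)" using l by (simp add: l_def[symmetric] mass_kappa)
  then have "\<exists>y\<ge>\<kappa>. y \<le> \<kappa> + q / l \<and> mass y = q"
    using assms l by (intro IVT) (auto simp: mass_kappa intro: DERIV_isCont[OF DERIV_mass])
  then show ?thesis using that by blast
qed

text \<open>To the right of the front the distribution function is strictly increasing, so it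
  exceeds the level exactly beyond y sqrt t. The strict inequality in the quantile makes this
  correct at q = 0 too, where the infimum is the front.\<close>

lemma y_star_eq:
  assumes y: "\<kappa> \<le> y" "mass y = q" and t: "0 < t" shows "y_star lam t q = y * sqrt t"
proof -
  have q: "0 \<le> q" using y mass_pos[of y] mass_kappa by (cases "y = \<kappa>") auto
  have "ennreal (q * sqrt t) < emeasure (Q_star lam t) {..r} \<longleftrightarrow> y * sqrt t < r" for r
  proof -
    have "ennreal (q * sqrt t) < emeasure (Q_star lam t) {..r} \<longleftrightarrow> q * sqrt t < sqrt t * Fstar (r / sqrt t)"
      unfolding emeasure_Q_star[OF t] using q t by (intro ennreal_less_iff) simp
    also have "\<dots> \<longleftrightarrow> q < Fstar (r / sqrt t)" using t by (simp add: mult.commute)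
    also have "\<dots> \<longleftrightarrow> y < r / sqrt t"
      using y q mass_mono[of y "r / sqrt t"] mass_mono[of "r / sqrt t" y]
      by (cases "r / sqrt t" y rule: linorder_cases) (auto simp: Fstar_def)
    also have "\<dots> \<longleftrightarrow> y * sqrt t < r" using t by (rule less_div_sqrt_iff)
    finally show ?thesis .
  qed
  then have "{r. ennreal (q * sqrt t) < emeasure (Q_star lam t) {..r}} = {y * sqrt t<..}" by auto
  then show ?thesis by (simp add: y_star_def quantile_def)
qed

lemma y_star_1: "0 \<le> q \<Longrightarrow> \<kappa> \<le> y_star lam 1 q \<and> mass (y_star lam 1 q) = q"
  using mass_surj[of q] y_star_eq[of _ q 1] by (metis mult_cancel_left2 real_sqrt_one mult_1_right zero_less_one)

lemma y_star_scaling: "0 \<le> q \<Longrightarrow> 0 < t \<Longrightarrow> y_star lam t q = y_star lam 1 q * sqrt t"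
  using y_star_1 y_star_eq by blast

lemma y_star_gt_kappa: "0 < q \<Longrightarrow> \<kappa> < y_star lam 1 q"
  using y_star_1[of q] mass_kappa by (cases "y_star lam 1 q = \<kappa>") auto

lemma integral_u_star:
  assumes "0 \<le> q" shows "(LBINT r=\<kappa>..y_star lam 1 q. u_star lam 1 r) = q"
proof -
  have y: "\<kappa> \<le> y_star lam 1 q" "mass (y_star lam 1 q) = q" using y_star_1[OF assms] by auto
  have "(LBINT r=\<kappa>..y_star lam 1 q. u_star lam 1 r) = (LBINT r=\<kappa>..y_star lam 1 q. dens r)"
    using y by (intro interval_integral_cong) (auto simp: u_star_eq einterval_iff min_def max_def)
  also have "\<dots> = mass (y_star lam 1 q) - mass \<kappa>"
  proof (rule interval_integral_FTC_finite)
    have "isCont dens r" for r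
      unfolding dens_def by (intro continuous_intros DERIV_isCont[OF DERIV_Phi])
    then show "continuous_on {min \<kappa> (y_star lam 1 q)..max \<kappa> (y_star lam 1 q)} dens"
      by (intro continuous_at_imp_continuous_on) auto
    show "(mass has_vector_derivative dens r) (at r within {min \<kappa> (y_star lam 1 q)..max \<kappa> (y_star lam 1 q)})" for r
      unfolding has_real_derivative_iff_has_vector_derivative[symmetric]
      by (rule has_field_derivative_at_within[OF DERIV_mass])
  qed
  finally show ?thesis by (simp add: y mass_kappa)
qed

lemma u_star_y_star: "0 < q \<Longrightarrow> u_star lam 1 (y_star lam 1 q) = dens (y_star lam 1 q)"
  using y_star_gt_kappa[of q] by (simp add: u_star_eq)

lemma Astar_1: "Astar 1 x = (if \<kappa> < x then area x else 0)"
  by (simp add: Astar_def ext_area_eq)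

text \<open>Convexity: an increment is at least its length times the slope at the left end. Together
  with the opposite bound below, this compares increments of the limit with counts of
  particles.\<close>

lemma Astar_diff_ge:
  assumes "\<kappa> \<le> x" "x < y" shows "(y - x) * mass x \<le> Astar 1 y - Astar 1 x"
proof -
  from MVT2[OF assms(2) DERIV_area] obtain v where v: "x < v" "v < y" "area y - area x = (y - x) * mass v" by blast
  have "(y - x) * mass x \<le> (y - x) * mass v"
    using assms v mass_mono[of x v] by (intro mult_left_mono) auto
  moreover have "Astar 1 y = area y" "Astar 1 x = area x" using assms area_kappa by (auto simp: Astar_1)
  ultimately show ?thesis using v by simp
qed

lemma Fstar_nonneg: "0 \<le> Fstar z"
  using mass_pos[of z] by (simp add: Fstar_def less_imp_le)

lemma Astar_diff_le:
  assumes "x < y" shows "Astar 1 y - Astar 1 x \<le> (y - x) * Fstar y"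
proof (cases "\<kappa> < y")
  case True
  define x' where "x' = max \<kappa> x"
  have x': "x' < y" "\<kappa> \<le> x'" "x \<le> x'" using True assms by (auto simp: x'_def)
  have As: "Astar 1 x = area x'" using area_kappa by (auto simp: Astar_1 x'_def)
  from MVT2[OF x'(1) DERIV_area] obtain v where v: "x' < v" "v < y" "area y - area x' = (y - x') * mass v" by blast
  have "(y - x') * mass v \<le> (y - x) * mass y"
    using x' v mass_mono[of v y] mass_pos[of v] by (intro mult_mono) auto
  then show ?thesis using v True As by (simp add: Astar_1 Fstar_def)
next
  case False
  then show ?thesis using assms Astar_nonneg[of 1 x] by (simp add: Astar_1 Fstar_def split: if_splits)
qed

text \<open>The mean value theorem for \<open>mass\<close> writes the quotient as 1 / dens v with v
  between the two quantiles. These are Lipschitz in q, since the density is bounded below, so v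
  tends to the quantile of q.\<close>

lemma y_star_quotient_tendsto:
  assumes q: "0 < q"
  shows "((\<lambda>\<epsilon>. (y_star lam 1 (q + \<epsilon>) - y_star lam 1 (q - \<epsilon>)) / (2 * \<epsilon>)) \<longlongrightarrow> 1 / dens (y_star lam 1 q)) (at_right 0)"
proof -
  define y where "y = y_star lam 1"
  define l where "l = min 2 lam"
  have l: "0 < l" using lam_pos by (simp add: l_def)
  have yk: "\<kappa> \<le> y p" "mass (y p) = p" if "0 \<le> p" for p using y_star_1[OF that] by (auto simp: y_def)
  have ymono: "y p < y p'" if "0 \<le> p" "p < p'" for p p'
    using yk[of p] yk[of p'] mass_mono[of "y p'" "y p"] that by (cases "y p" "y p'" rule: linorder_cases) auto
  have ylip: "y p' - y p \<le> (p' - p) / l" if "0 \<le> p" "p < p'" for p p'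
  proof -
    have "l * (y p' - y p) \<le> p' - p"
      using mass_diff_ge[of "y p" "y p'"] yk[of p] yk[of p'] ymono[OF that] that by (simp add: l_def)
    then show ?thesis using l by (simp add: pos_le_divide_eq mult.commute)
  qed
  have "\<exists>v. \<bar>v - y q\<bar> \<le> \<epsilon> / l \<and> (y (q + \<epsilon>) - y (q - \<epsilon>)) / (2 * \<epsilon>) = 1 / dens v" if e: "0 < \<epsilon>" "\<epsilon> < q" for \<epsilon>
  proof -
    have lt: "y (q - \<epsilon>) < y (q + \<epsilon>)" using e by (intro ymono) auto
    from MVT2[OF lt DERIV_mass] obtain v where v: "y (q - \<epsilon>) < v" "v < y (q + \<epsilon>)"
      "mass (y (q + \<epsilon>)) - mass (y (q - \<epsilon>)) = (y (q + \<epsilon>) - y (q - \<epsilon>)) * dens v" by blast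
    have "\<kappa> \<le> v" using v yk[of "q - \<epsilon>"] e by simp
    then have dv: "0 < dens v" by (rule dens_pos)
    have "2 * \<epsilon> = (y (q + \<epsilon>) - y (q - \<epsilon>)) * dens v" using v(3) yk[of "q - \<epsilon>"] yk[of "q + \<epsilon>"] e by simp
    then have "(y (q + \<epsilon>) - y (q - \<epsilon>)) / (2 * \<epsilon>) = 1 / dens v" using dv e lt by (simp add: field_simps)
    moreover have "\<bar>v - y q\<bar> \<le> \<epsilon> / l"
      using ylip[of q "q + \<epsilon>"] ylip[of "q - \<epsilon>" q] v e by (simp add: abs_le_iff)
    ultimately show ?thesis by blast
  qed
  then obtain v where v: "\<And>\<epsilon>. 0 < \<epsilon> \<Longrightarrow> \<epsilon> < q \<Longrightarrow> \<bar>v \<epsilon> - y q\<bar> \<le> \<epsilon> / l \<and> (y (q + \<epsilon>) - y (q - \<epsilon>)) / (2 * \<epsilon>) = 1 / dens (v \<epsilon>)"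
    by metis
  have ev: "eventually (\<lambda>\<epsilon>::real. 0 < \<epsilon> \<and> \<epsilon> < q) (at_right 0)"
    using q by (auto simp: eventually_at_right intro!: exI[of _ q])
  have "((\<lambda>\<epsilon>. v \<epsilon> - y q) \<longlongrightarrow> 0) (at_right 0)"
  proof (rule Lim_null_comparison)
    show "eventually (\<lambda>\<epsilon>. norm (v \<epsilon> - y q) \<le> \<epsilon> / l) (at_right 0)"
      using ev by eventually_elim (use v in auto)
    show "((\<lambda>\<epsilon>. \<epsilon> / l) \<longlongrightarrow> 0) (at_right 0)" by (auto intro!: tendsto_eq_intros simp: l less_imp_neq[OF l, symmetric])
  qed
  then have vt: "(v \<longlongrightarrow> y q) (at_right 0)" by (simp add: LIM_zero_iff)
  have "isCont dens (y q)"
    unfolding dens_def by (intro continuous_intros DERIV_isCont[OF DERIV_Phi])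
  from isCont_tendsto_compose[OF this vt]
  have "((\<lambda>\<epsilon>. 1 / dens (v \<epsilon>)) \<longlongrightarrow> 1 / dens (y q)) (at_right 0)"
    using dens_pos[OF yk(1)[of q]] q by (intro tendsto_divide tendsto_const) auto
  then have "((\<lambda>\<epsilon>. (y (q + \<epsilon>) - y (q - \<epsilon>)) / (2 * \<epsilon>)) \<longlongrightarrow> 1 / dens (y q)) (at_right 0)"
    by (rule Lim_transform_eventually) (use ev in eventually_elim, use v in auto)
  then show ?thesis by (simp add: y_def)
qed

end

section \<open>Ranks, counting functions and areas\<close>

lemma ranked_before_trichotomy: "i \<noteq> j \<Longrightarrow> ranked_before x i j \<or> ranked_before x j i"
  unfolding ranked_before_def by (metis linorder_neqE_nat linorder_neqE_linordered_idom)

lemma ranked_before_trans: "ranked_before x i j \<Longrightarrow> ranked_before x j k \<Longrightarrow> ranked_before x i k"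
  unfolding ranked_before_def by auto

lemma ranked_before_irrefl: "\<not> ranked_before x i i"
  unfolding ranked_before_def by simp

text \<open>The rank function R is injective and increasing along the order, so it maps the
  predecessors of a particle into as many numbers as there are predecessors, hence onto them: no
  rank is skipped.\<close>

lemma has_rank_existence:
  assumes fin: "\<And>r. finite {i. x i \<le> r}" and k: "0 < k"
  shows "\<exists>!i. has_rank x i k"
proof -
  define P where "P i = {j. ranked_before x j i}" for i
  define R where "R i = Suc (card (P i))" for i
  have finP: "finite (P i)" for i
    by (rule finite_subset[OF _ fin[of "x i"]]) (auto simp: P_def ranked_before_def)
  have rank: "has_rank x i m \<longleftrightarrow> R i = m" for i m
    using finP[of i] by (simp add: has_rank_def R_def P_def)
  have less: "R i < R j" if "ranked_before x i j" for i j
  proof -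
    have "P i \<subset> P j"
      using that ranked_before_trans ranked_before_irrefl unfolding P_def by blast
    then show ?thesis unfolding R_def using finP psubset_card_mono by blast
  qed
  have inj: "inj R"
    by (rule injI) (metis less less_irrefl ranked_before_trichotomy)
  have "\<exists>i. R i = k"
  proof -
    \<comment> \<open>Infinitely many particles have distinct ranks, so some rank is beyond k, and k
      is attained among the predecessors of that particle.\<close>
    have "infinite (range R)" using inj range_inj_infinite by blast
    then obtain i where i: "k < R i" unfolding infinite_nat_iff_unbounded by blast
    have "R ` P i = {1..card (P i)}"
    proof (rule card_subset_eq)
      show "R ` P i \<subseteq> {1..card (P i)}"
      proof
        fix m assume "m \<in> R ` P i"
        then obtain j where j: "m = R j" "ranked_before x j i" by (auto simp: P_def)
        have "R j < R i" using less[OF j(2)] .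
        then show "m \<in> {1..card (P i)}" unfolding j(1) by (simp add: R_def)
      qed
      show "card (R ` P i) = card {1..card (P i)}"
        using inj by (simp add: card_image inj_on_subset[OF inj subset_UNIV])
    qed simp
    moreover have "k \<in> {1..card (P i)}" using i k by (simp add: R_def)
    ultimately show ?thesis by (metis imageE)
  qed
  then show ?thesis unfolding rank using inj by (auto dest: injD)
qed

lemma ranked_value_le_iff:
  assumes fin: "\<And>r. finite {i. x i \<le> r}" and k: "0 < k"
  shows "ranked_value x k \<le> r \<longleftrightarrow> k \<le> card {i. x i \<le> r}"
proof -
  define i where "i = (THE i. has_rank x i k)"
  have "has_rank x i k" unfolding i_def by (rule theI'[OF has_rank_existence[OF fin k]])
  then have i: "finite {j. ranked_before x j i}" "Suc (card {j. ranked_before x j i}) = k"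
    by (auto simp: has_rank_def)
  have rv: "ranked_value x k = x i" by (simp add: ranked_value_def i_def)
  show ?thesis
  proof (cases "x i \<le> r")
    case True
    have "insert i {j. ranked_before x j i} \<subseteq> {j. x j \<le> r}" using True by (auto simp: ranked_before_def)
    then have "card (insert i {j. ranked_before x j i}) \<le> card {j. x j \<le> r}" by (rule card_mono[OF fin])
    then show ?thesis using True i rv by (simp add: ranked_before_irrefl)
  next
    case False
    then have "{j. x j \<le> r} \<subseteq> {j. ranked_before x j i}" by (auto simp: ranked_before_def)
    then have "card {j. x j \<le> r} \<le> card {j. ranked_before x j i}" by (rule card_mono[OF i(1)])
    then show ?thesis using False i rv by simp
  qed
qed

text \<open>Each particle contributes to the difference at least z - y if it lies at or left of y,
  and at most z - y if it lies at or left of z, and nothing otherwise. So a difference quotient of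
  areas lies between the counts at its two ends.\<close>

lemma
  fixes u :: "nat \<Rightarrow> real"
  assumes sm: "summable (\<lambda>i. exp (- u i))" and yz: "y < z"
  shows sum_pos_part_diff_ge: "(z - y) * real (card {i. u i \<le> y}) \<le> (\<Sum>i. pos_part (z - u i)) - (\<Sum>i. pos_part (y - u i))"
    and sum_pos_part_diff_le: "(\<Sum>i. pos_part (z - u i)) - (\<Sum>i. pos_part (y - u i)) \<le> (z - y) * real (card {i. u i \<le> z})"
proof -
  have S: "(\<lambda>i. pos_part (z - u i) - pos_part (y - u i)) sums ((\<Sum>i. pos_part (z - u i)) - (\<Sum>i. pos_part (y - u i)))"
    by (intro sums_diff summable_sums summable_pos_part sm)
  have C: "(\<lambda>i. (z - y) * indicator {i. u i \<le> v} i) sums ((z - y) * real (card {i. u i \<le> v}))" for v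
  proof -
    have "(\<lambda>i. indicator {i. u i \<le> v} i :: real) sums (\<Sum>i\<in>{i. u i \<le> v}. indicator {i. u i \<le> v} i)"
      by (rule sums_finite[OF finite_below_if_summable[OF sm]]) simp
    then have "(\<lambda>i. indicator {i. u i \<le> v} i :: real) sums real (card {i. u i \<le> v})" by simp
    then show ?thesis by (rule sums_mult)
  qed
  show "(z - y) * real (card {i. u i \<le> y}) \<le> (\<Sum>i. pos_part (z - u i)) - (\<Sum>i. pos_part (y - u i))"
    by (rule sums_le[OF _ C S]) (use yz in \<open>auto simp: indicator_def pos_part_def\<close>)
  show "(\<Sum>i. pos_part (z - u i)) - (\<Sum>i. pos_part (y - u i)) \<le> (z - y) * real (card {i. u i \<le> z})"
    by (rule sums_le[OF _ S C]) (use yz in \<open>auto simp: indicator_def pos_part_def\<close>)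
qed

section \<open>Convergence in probability\<close>

text \<open>The events of the final statement are not shown to be measurable. A set that is not an
  event has measure 0 by convention, so the bound holds in either case.\<close>

lemma (in prob_space) measure_le_if_AE_covered:
  assumes "B \<in> events" "AE \<omega> in M. \<omega> \<in> S \<longrightarrow> \<omega> \<in> B" shows "measure M S \<le> measure M B"
  using assms by (cases "S \<in> events") (auto intro: finite_measure_mono_AE simp: measure_notin_sets)

text \<open>The tolerance 2 covers rounding down, rounding up, and rounding followed by an
  additional index.\<close>

lemma tendsto_index_ratio:
  fixes k :: "real \<Rightarrow> nat"
  assumes "eventually (\<lambda>s. \<bar>real (k s) - q * sqrt s\<bar> \<le> 2) at_top"
  shows "((\<lambda>s. real (k s) / sqrt s) \<longlongrightarrow> q) at_top"
proof (rule LIM_zero_cancel, rule Lim_null_comparison)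
  show "eventually (\<lambda>s. norm (real (k s) / sqrt s - q) \<le> 2 / sqrt s) at_top"
    using assms eventually_gt_at_top[of 0]
  proof eventually_elim
    case (elim s)
    have "real (k s) / sqrt s - q = (real (k s) - q * sqrt s) / sqrt s" using elim by (simp add: field_simps)
    then show ?case using elim by (simp add: divide_right_mono)
  qed
  show "((\<lambda>s. 2 / sqrt s) \<longlongrightarrow> 0) at_top" by real_asymp
qed

definition scaled_area :: "(nat \<Rightarrow> real \<Rightarrow> 'a \<Rightarrow> real) \<Rightarrow> real \<Rightarrow> real \<Rightarrow> 'a \<Rightarrow> real" where
  "scaled_area X s z \<omega> = (\<Sum>i. pos_part (z - X i s \<omega> / sqrt s)) / sqrt s"

context profile
begin

text \<open>The errors that do not depend on b; they become small with h. \<open>dynamic_err\<close>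
  collects those that vanish as b tends to infinity for a fixed number of steps.\<close>

definition static_err :: "real \<Rightarrow> real \<Rightarrow> real \<Rightarrow> real" where
  "static_err h a e = h / a\<^sup>2 + lam * exp (1 / 2) * modulus h a / (e / 2) + lower_err * (2 * sqrt h)
    + 12 * dens_bound * h / a\<^sup>2 + (init_const + 1) * h"

definition dynamic_err :: "nat \<Rightarrow> real \<Rightarrow> real \<Rightarrow> real" where
  "dynamic_err n e b = 2 * (sqrt (lam / b) + real n * sqrt (2 * exp 1 * lam / b)) + sqrt (2 * exp 1 * lam / b) / (e / 2)"

text \<open>With h = r^2 and a = sqrt r, so that a is the fourth root of h, one has h / a^2 = r, and
  every term tends to 0 with r.\<close>

lemma static_err_tendsto:
  assumes "0 < e" shows "((\<lambda>r. static_err (r\<^sup>2) (sqrt r) e) \<longlongrightarrow> 0) (at_right 0)"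
proof (rule Lim_transform_eventually)
  show "((\<lambda>r. r + lam * exp (1 / 2) * (exp 2 * (r + sqrt r)) / (e / 2) + lower_err * (2 * r) + 12 * dens_bound * r + (init_const + 1) * r\<^sup>2) \<longlongrightarrow> 0) (at_right 0)"
    using assms by (auto intro!: tendsto_eq_intros)
  show "eventually (\<lambda>r. r + lam * exp (1 / 2) * (exp 2 * (r + sqrt r)) / (e / 2) + lower_err * (2 * r) + 12 * dens_bound * r + (init_const + 1) * r\<^sup>2
      = static_err (r\<^sup>2) (sqrt r) e) (at_right 0)"
    using eventually_at_right_less[of 0]
  proof eventually_elim
    case (elim r)
    have "r\<^sup>2 / r = r" "12 * dens_bound * r\<^sup>2 / r = 12 * dens_bound * r" using elim by (auto simp: power2_eq_square)
    then show ?case using elim by (simp add: static_err_def modulus_def)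
  qed
qed

lemma dynamic_err_tendsto:
  assumes "0 < e" shows "((\<lambda>s. dynamic_err n e (sqrt s)) \<longlongrightarrow> 0) at_top"
proof -
  have 1: "((\<lambda>s. c / sqrt s) \<longlongrightarrow> 0) at_top" for c by real_asymp
  have 2: "((\<lambda>s. sqrt (c / sqrt s)) \<longlongrightarrow> 0) at_top" for c
    using tendsto_real_sqrt[OF 1[of c]] by simp
  show ?thesis
  proof -
    have "((\<lambda>s. dynamic_err n e (sqrt s)) \<longlongrightarrow> 2 * (0 + real n * 0) + 0 / (e / 2)) at_top"
      unfolding dynamic_err_def using assms by (intro tendsto_add tendsto_mult tendsto_divide tendsto_const 2) simp
    then show ?thesis by simp
  qed
qed

end

section \<open>The limits for the Atlas system\<close>

context atlas_infinity
begin

context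
  fixes lam :: real
  assumes lam: "0 < lam" and init: "PPP_plus M lam (\<lambda>i. X i 0)"
begin

interpretation profile lam by unfold_locales (rule lam)

lemma scaled_area_facts:
  assumes s: "0 < s"
  shows "scaled_area X s z \<in> borel_measurable M" "AE \<omega> in M. summable (\<lambda>i. exp (- (X i s \<omega> / sqrt s)))"
proof -
  have b: "0 < sqrt s" using s by simp
  interpret f: fast_atlas M "\<lambda>t. F ((sqrt s)\<^sup>2 * t)" "\<lambda>i t \<omega>. W i ((sqrt s)\<^sup>2 * t) \<omega> / sqrt s" "\<lambda>i t \<omega>. X i ((sqrt s)\<^sup>2 * t) \<omega> / sqrt s" "sqrt s" lam
    by (rule fast_atlas_rescaled[OF lam init b])
  have A: "f.A 1 z = scaled_area X s z"
    unfolding f.A_def[abs_def] scaled_area_def[abs_def] using s by simp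
  have "f.A 1 z \<in> borel_measurable M" by (intro f.A_measurable') simp
  then show "scaled_area X s z \<in> borel_measurable M" by (simp add: A)
  show "AE \<omega> in M. summable (\<lambda>i. exp (- (X i s \<omega> / sqrt s)))"
    using f.AE_summable[of 1] s by simp
qed

lemma scaled_area_deviation:
  assumes s: "0 < s"
    and n: "0 < n" and h: "h = 1 / real n" and a: "0 < a" "2 * \<bar>kappa lam\<bar> * sqrt h \<le> a" "dens_bound * a\<^sup>2 \<le> e" and e: "0 < e" "h \<le> e / 2"
  shows "emeasure M {\<omega>\<in>space M. 2 * e \<le> \<bar>scaled_area X s z \<omega> - Astar 1 z\<bar>}
    \<le> ennreal (exp (1 / 2) * (1 + exp z) / e * (static_err h a e + dynamic_err n e (sqrt s)))"
proof -
  have b: "0 < sqrt s" using s by simp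
  interpret f: fast_atlas M "\<lambda>t. F ((sqrt s)\<^sup>2 * t)" "\<lambda>i t \<omega>. W i ((sqrt s)\<^sup>2 * t) \<omega> / sqrt s" "\<lambda>i t \<omega>. X i ((sqrt s)\<^sup>2 * t) \<omega> / sqrt s" "sqrt s" lam
    by (rule fast_atlas_rescaled[OF lam init b])
  have A: "f.A 1 z = scaled_area X s z"
    unfolding f.A_def[abs_def] scaled_area_def[abs_def] using s by simp
  have err: "2 * (sqrt (lam / sqrt s) + real n * f.nu) + f.bad_coeff h a e + lower_err * (2 * sqrt h)
        + 12 * dens_bound * h / a\<^sup>2 + (init_const + 1) * h = static_err h a e + dynamic_err n e (sqrt s)"
    unfolding static_err_def dynamic_err_def f.bad_coeff_def by (simp add: add_divide_distrib)
  show ?thesis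
    using f.deviation_bound[OF n h a e, of z] unfolding A err .
qed

text \<open>The order of the limits matters: the number n of steps is fixed so that the static error
  is small, and only afterwards does s tend to infinity, which removes the noise accumulated over n
  steps.\<close>

lemma hydrodynamic_limit:
  assumes \<theta>: "0 < \<theta>"
  shows "((\<lambda>s. measure M {\<omega>\<in>space M. \<theta> \<le> \<bar>scaled_area X s z \<omega> - Astar 1 z\<bar>}) \<longlongrightarrow> 0) at_top"
proof (rule tendstoI)
  fix \<delta> :: real assume \<delta>: "0 < \<delta>"
  \<comment> \<open>The deviation estimate is for 2 e.\<close>
  define e where "e = \<theta> / 2"
  define K where "K = exp (1 / 2) * (1 + exp z) / e"
  have e: "0 < e" using \<theta> by (simp add: e_def)
  have K: "0 < K" using e by (simp add: K_def add_pos_pos)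
  have st: "eventually (\<lambda>r. K * static_err (r\<^sup>2) (sqrt r) e < \<delta> / 2) (at_right 0)"
    using tendsto_mult_right_zero[OF static_err_tendsto[OF e], of K] \<delta> by (intro order_tendstoD(2)) auto
  have c1: "eventually (\<lambda>r. 2 * \<bar>kappa lam\<bar> * sqrt r < 1) (at_right 0)"
    by (rule order_tendstoD(2)[where y = 0]) (auto intro!: tendsto_eq_intros)
  have c2: "eventually (\<lambda>r. dens_bound * r < e) (at_right 0)"
    by (rule order_tendstoD(2)[where y = 0]) (use e in \<open>auto intro!: tendsto_eq_intros\<close>)
  have c3: "eventually (\<lambda>r. r\<^sup>2 < e / 2) (at_right 0)"
    by (rule order_tendstoD(2)[where y = 0]) (use e in \<open>auto intro!: tendsto_eq_intros\<close>)
  \<comment> \<open>The variable r of the smallness conditions is sqrt h, restricted to h = 1 /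
    n.\<close>
  have lim: "filterlim (\<lambda>n. sqrt (1 / real n)) (at_right 0) sequentially" by real_asymp
  have "eventually (\<lambda>r. K * static_err (r\<^sup>2) (sqrt r) e < \<delta> / 2 \<and> 2 * \<bar>kappa lam\<bar> * sqrt r < 1 \<and> dens_bound * r < e \<and> r\<^sup>2 < e / 2 \<and> 0 < r) (at_right 0)"
    using st c1 c2 c3 eventually_at_right_less[of 0] by eventually_elim auto
  from eventually_happens[OF eventually_conj[OF eventually_compose_filterlim[OF this lim] eventually_gt_at_top[of 0]]]
  obtain n where n: "0 < n" and *: "K * static_err ((sqrt (1 / real n))\<^sup>2) (sqrt (sqrt (1 / real n))) e < \<delta> / 2"
    "2 * \<bar>kappa lam\<bar> * sqrt (sqrt (1 / real n)) < 1" "dens_bound * sqrt (1 / real n) < e" "(sqrt (1 / real n))\<^sup>2 < e / 2" by auto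
  define h where "h = 1 / real n"
  define a where "a = sqrt (sqrt h)"
  have h0: "0 < h" using n by (simp add: h_def)
  have a0: "0 < a" using h0 by (simp add: a_def)
  have a2: "a\<^sup>2 = sqrt h" using h0 by (simp add: a_def)
  have ca: "2 * \<bar>kappa lam\<bar> * sqrt h \<le> a"
  proof -
    have "2 * \<bar>kappa lam\<bar> * a * a \<le> 1 * a" using *(2) a0 unfolding h_def[symmetric] a_def[symmetric] by (intro mult_right_mono) auto
    moreover have "a * a = sqrt h" using a2 by (simp add: power2_eq_square)
    ultimately show ?thesis by (simp add: mult.assoc)
  qed
  have cd: "dens_bound * a\<^sup>2 \<le> e" using *(3) by (simp add: a2 h_def)
  have ce: "h \<le> e / 2" using *(4) h0 by (simp add: h_def)
  have stat: "K * static_err h a e < \<delta> / 2" using *(1) h0 unfolding h_def[symmetric] a_def[symmetric] by simp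
  have "eventually (\<lambda>s. K * dynamic_err n e (sqrt s) < \<delta> / 2) at_top"
    using tendsto_mult_right_zero[OF dynamic_err_tendsto[OF e], of K] \<delta> by (intro order_tendstoD(2)) auto
  then show "eventually (\<lambda>s. dist (measure M {\<omega>\<in>space M. \<theta> \<le> \<bar>scaled_area X s z \<omega> - Astar 1 z\<bar>}) 0 < \<delta>) at_top"
    using eventually_gt_at_top[of 0]
  proof eventually_elim
    case (elim s)
    have "emeasure M {\<omega>\<in>space M. 2 * e \<le> \<bar>scaled_area X s z \<omega> - Astar 1 z\<bar>} \<le> ennreal (K * (static_err h a e + dynamic_err n e (sqrt s)))"
      unfolding K_def by (rule scaled_area_deviation[OF elim(2) n h_def a0 ca cd e ce])
    also have "\<dots> \<le> ennreal (max 0 (K * static_err h a e + K * dynamic_err n e (sqrt s)))"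
      by (intro ennreal_leI) (simp add: distrib_left)
    finally have "measure M {\<omega>\<in>space M. \<theta> \<le> \<bar>scaled_area X s z \<omega> - Astar 1 z\<bar>} \<le> max 0 (K * static_err h a e + K * dynamic_err n e (sqrt s))"
      by (simp add: emeasure_eq_measure e_def del: ennreal_max_0)
    then show ?case using stat elim(1) \<delta> by simp
  qed
qed

text \<open>If a ranked particle were far from its limit, the counting function would be off by a
  fixed amount at a point on the corresponding side; by convexity the increment of the area over an
  interval of length \<eta> / 2 would then differ from that of \<open>Astar\<close>, contrary to the
  hydrodynamic limit. The exceptional events B are part of the conclusion so that two ranks can be
  treated jointly.\<close>

lemma ranked_limit:
  fixes k :: "real \<Rightarrow> nat"
  assumes q: "0 < q" and k: "((\<lambda>s. real (k s) / sqrt s) \<longlongrightarrow> q) at_top" and \<eta>: "0 < \<eta>"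
  obtains B where "\<And>s. B s \<in> events" "((\<lambda>s. prob (B s)) \<longlongrightarrow> 0) at_top"
    "eventually (\<lambda>s. AE \<omega> in M. \<omega> \<notin> B s \<longrightarrow> \<bar>ranked_value (\<lambda>i. X i s \<omega>) (k s) / sqrt s - y_star lam 1 q\<bar> \<le> \<eta>) at_top"
proof -
  define y where "y = y_star lam 1 q"
  have y: "kappa lam < y" "mass y = q"
    using y_star_gt_kappa[OF q] y_star_1[of q] q by (auto simp: y_def)
  define z1 z2 z3 z4 where "z1 = y - \<eta>" and "z2 = y - \<eta> / 2" and "z3 = y + \<eta> / 2" and "z4 = y + \<eta>"
  note zs = z1_def z2_def z3_def z4_def
  have z3: "q < mass z3" using mass_mono[of y z3] y \<eta> by (simp add: zs)
  have z2: "Fstar z2 < q"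
    using mass_mono[of z2 y] y \<eta> q by (auto simp: Fstar_def zs)
  \<comment> \<open>The gap between q and the limiting distribution function at the two inner points
    z2 and z3, which lie on either side of the quantile.\<close>
  define c where "c = min (q - Fstar z2) (mass z3 - q)"
  have c: "0 < c" "c \<le> q" "Fstar z2 \<le> q - c" "q + c \<le> mass z3"
    using z2 z3 Fstar_nonneg[of z2] by (auto simp: c_def)
  \<comment> \<open>The slopes to be separated differ by at least 3 c / 4, so the increments over
    length \<eta> / 2 differ by 3 \<eta> c / 8, while two approximation errors amount to less than 2
    \<theta> = \<eta> c / 8.\<close>
  define \<theta> where "\<theta> = \<eta> * c / 16"
  have \<theta>: "0 < \<theta>" using c \<eta> by (simp add: \<theta>_def)
  define D where "D s z = {\<omega>\<in>space M. \<theta> \<le> \<bar>scaled_area X s z \<omega> - Astar 1 z\<bar>}" for s z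
  have D: "D s z \<in> events" if "0 < s" for s z
  proof -
    have [measurable]: "scaled_area X s z \<in> borel_measurable M" by (rule scaled_area_facts[OF that])
    show ?thesis unfolding D_def by measurable
  qed
  define B where "B s = (if 0 < s then D s z1 \<union> D s z2 \<union> D s z3 \<union> D s z4 else {})" for s
  have Bev: "B s \<in> events" for s using D by (auto simp: B_def)
  show ?thesis
  proof (rule that)
    show "B s \<in> events" for s by (rule Bev)
    show "((\<lambda>s. prob (B s)) \<longlongrightarrow> 0) at_top"
    proof (rule Lim_null_comparison)
      show "eventually (\<lambda>s. norm (prob (B s)) \<le> prob (D s z1) + prob (D s z2) + prob (D s z3) + prob (D s z4)) at_top"
        using eventually_gt_at_top[of 0]
      proof eventually_elim
        case (elim s)
        note Ds = D[OF elim]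
        have "prob (D s z1 \<union> D s z2 \<union> D s z3 \<union> D s z4) \<le> prob (D s z1 \<union> D s z2 \<union> D s z3) + prob (D s z4)"
          using Ds by (intro measure_Un_le) auto
        moreover have "prob (D s z1 \<union> D s z2 \<union> D s z3) \<le> prob (D s z1 \<union> D s z2) + prob (D s z3)"
          using Ds by (intro measure_Un_le) auto
        moreover have "prob (D s z1 \<union> D s z2) \<le> prob (D s z1) + prob (D s z2)"
          using Ds by (intro measure_Un_le) auto
        ultimately show ?case using elim by (simp add: B_def)
      qed
      have lim: "((\<lambda>s. prob (D s z)) \<longlongrightarrow> 0) at_top" for z
        unfolding D_def by (rule hydrodynamic_limit[OF \<theta>])
      show "((\<lambda>s. prob (D s z1) + prob (D s z2) + prob (D s z3) + prob (D s z4)) \<longlongrightarrow> 0) at_top"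
        using tendsto_add[OF tendsto_add[OF tendsto_add[OF lim[of z1] lim[of z2]] lim[of z3]] lim[of z4]] by simp
    qed
    have e1: "eventually (\<lambda>s. q - c / 4 < real (k s) / sqrt s) at_top"
      by (rule order_tendstoD(1)[OF k]) (use c in simp)
    have e2: "eventually (\<lambda>s. real (k s) / sqrt s < q + c / 4) at_top"
      by (rule order_tendstoD(2)[OF k]) (use c in simp)
    show "eventually (\<lambda>s. AE \<omega> in M. \<omega> \<notin> B s \<longrightarrow> \<bar>ranked_value (\<lambda>i. X i s \<omega>) (k s) / sqrt s - y_star lam 1 q\<bar> \<le> \<eta>) at_top"
      using e1 e2 eventually_gt_at_top[of 0]
    proof eventually_elim
      case (elim s)
      have r: "0 < sqrt s" using elim by simp
      \<comment> \<open>There is no particle of rank 0; c \<le> q keeps q - c / 4 positive.\<close>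
      have kpos: "0 < k s"
      proof (rule ccontr)
        assume "\<not> 0 < k s"
        then show False using elim(1) c by simp
      qed
      show ?case
        using scaled_area_facts(2)[OF elim(3)] AE_space
      proof eventually_elim
        case (elim \<omega>)
        note sm = elim(1)
        define u where "u i = X i s \<omega> / sqrt s" for i
        have smu: "summable (\<lambda>i. exp (- u i))" using sm by (simp add: u_def)
        have card: "{i. X i s \<omega> \<le> v * sqrt s} = {i. u i \<le> v}" for v
          using r by (auto simp: u_def pos_divide_le_eq)
        have fin: "finite {i. X i s \<omega> \<le> v}" for v
          using finite_below_if_summable[OF smu, of "v / sqrt s"] card[of "v / sqrt s"] r by simp
        define V where "V = ranked_value (\<lambda>i. X i s \<omega>) (k s)"
        have V: "V \<le> v * sqrt s \<longleftrightarrow> k s \<le> card {i. u i \<le> v}" for v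
          unfolding V_def card[symmetric] by (rule ranked_value_le_iff[OF fin kpos])
        have inc: "(z' - z) * (real (card {i. u i \<le> z}) / sqrt s) \<le> scaled_area X s z' \<omega> - scaled_area X s z \<omega>"
           "scaled_area X s z' \<omega> - scaled_area X s z \<omega> \<le> (z' - z) * (real (card {i. u i \<le> z'}) / sqrt s)" if "z < z'" for z z'
          using divide_right_mono[OF sum_pos_part_diff_ge[OF smu that], of "sqrt s"]
            divide_right_mono[OF sum_pos_part_diff_le[OF smu that], of "sqrt s"] r
          by (simp_all add: scaled_area_def u_def diff_divide_distrib)
        show ?case
        proof
          assume "\<omega> \<notin> B s"
          then have near: "\<bar>scaled_area X s z \<omega> - Astar 1 z\<bar> < \<theta>" if "z \<in> {z1, z2, z3, z4}" for z
            using that elim(2) \<open>0 < s\<close> by (auto simp: B_def D_def)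
          have up: "V / sqrt s \<le> z4"
          proof (rule ccontr)
            assume "\<not> V / sqrt s \<le> z4"
            then have "\<not> V \<le> z4 * sqrt s" using r by (simp add: pos_divide_le_eq)
            then have "card {i. u i \<le> z4} < k s" using V by simp
            then have "real (card {i. u i \<le> z4}) / sqrt s \<le> real (k s) / sqrt s" using r by (intro divide_right_mono) auto
            then have N: "real (card {i. u i \<le> z4}) / sqrt s \<le> q + c / 4" using \<open>real (k s) / sqrt s < q + c / 4\<close> by simp
            have d: "z4 - z3 = \<eta> / 2" "z3 < z4" using \<eta> by (auto simp: zs)
            have "scaled_area X s z4 \<omega> - scaled_area X s z3 \<omega> \<le> \<eta> / 2 * (real (card {i. u i \<le> z4}) / sqrt s)"
              using inc(2)[OF d(2)] d(1) by simp
            also have "\<dots> \<le> \<eta> / 2 * (q + c / 4)" using N \<eta> by (intro mult_left_mono) auto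
            finally have 1: "scaled_area X s z4 \<omega> - scaled_area X s z3 \<omega> \<le> \<eta> / 2 * (q + c / 4)" .
            have "\<eta> / 2 * (q + c) \<le> \<eta> / 2 * mass z3" using c \<eta> by (intro mult_left_mono) auto
            also have "\<dots> \<le> Astar 1 z4 - Astar 1 z3"
              using Astar_diff_ge[of z3 z4] d y \<eta> by (simp add: zs)
            finally have 2: "\<eta> / 2 * (q + c) \<le> Astar 1 z4 - Astar 1 z3" .
            have "\<eta> / 2 * (q + c) - \<eta> / 2 * (q + c / 4) < 2 * \<theta>"
            proof -
              have "\<bar>scaled_area X s z3 \<omega> - Astar 1 z3\<bar> < \<theta>" "\<bar>scaled_area X s z4 \<omega> - Astar 1 z4\<bar> < \<theta>"
                by (auto intro: near)
              then show ?thesis using 1 2 unfolding abs_less_iff by linarith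
            qed
            moreover have "\<eta> / 2 * (q + c) - \<eta> / 2 * (q + c / 4) = \<eta> * c * (3 / 8)" by (simp add: field_simps)
            ultimately have "\<eta> * c * (3 / 8) < \<eta> * c * (1 / 8)" by (simp add: \<theta>_def)
            then show False using c \<eta> mult_pos_pos[of \<eta> c] by linarith
          qed
          have low: "z1 \<le> V / sqrt s"
          proof (rule ccontr)
            assume "\<not> z1 \<le> V / sqrt s"
            then have "V \<le> z1 * sqrt s" using r by (simp add: pos_le_divide_eq)
            then have "k s \<le> card {i. u i \<le> z1}" using V by simp
            then have "real (k s) / sqrt s \<le> real (card {i. u i \<le> z1}) / sqrt s" using r by (intro divide_right_mono) auto
            then have N: "q - c / 4 \<le> real (card {i. u i \<le> z1}) / sqrt s" using \<open>q - c / 4 < real (k s) / sqrt s\<close> by simp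
            have d: "z2 - z1 = \<eta> / 2" "z1 < z2" using \<eta> by (auto simp: zs)
            have "\<eta> / 2 * (q - c / 4) \<le> \<eta> / 2 * (real (card {i. u i \<le> z1}) / sqrt s)" using N \<eta> by (intro mult_left_mono) auto
            also have "\<dots> \<le> scaled_area X s z2 \<omega> - scaled_area X s z1 \<omega>"
              using inc(1)[OF d(2)] d(1) by simp
            finally have 1: "\<eta> / 2 * (q - c / 4) \<le> scaled_area X s z2 \<omega> - scaled_area X s z1 \<omega>" .
            have "Astar 1 z2 - Astar 1 z1 \<le> \<eta> / 2 * Fstar z2" using Astar_diff_le[OF d(2)] d(1) by simp
            also have "\<dots> \<le> \<eta> / 2 * (q - c)" using c \<eta> by (intro mult_left_mono) auto
            finally have 2: "Astar 1 z2 - Astar 1 z1 \<le> \<eta> / 2 * (q - c)" .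
            have "\<eta> / 2 * (q - c / 4) - \<eta> / 2 * (q - c) < 2 * \<theta>"
            proof -
              have "\<bar>scaled_area X s z1 \<omega> - Astar 1 z1\<bar> < \<theta>" "\<bar>scaled_area X s z2 \<omega> - Astar 1 z2\<bar> < \<theta>"
                by (auto intro: near)
              then show ?thesis using 1 2 unfolding abs_less_iff by linarith
            qed
            moreover have "\<eta> / 2 * (q - c / 4) - \<eta> / 2 * (q - c) = \<eta> * c * (3 / 8)" by (simp add: field_simps)
            ultimately have "\<eta> * c * (3 / 8) < \<eta> * c * (1 / 8)" by (simp add: \<theta>_def)
            then show False using c \<eta> mult_pos_pos[of \<eta> c] by linarith
          qed
          show "\<bar>ranked_value (\<lambda>i. X i s \<omega>) (k s) / sqrt s - y_star lam 1 q\<bar> \<le> \<eta>"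
            using up low unfolding V_def[symmetric] y_def[symmetric] zs by (simp add: abs_le_iff)
        qed
      qed
    qed
  qed
qed

lemma ranked_in_probability:
  fixes k :: "real \<Rightarrow> nat"
  assumes q: "0 < q" and k: "((\<lambda>s. real (k s) / sqrt s) \<longlongrightarrow> q) at_top"
  shows "tendsto_in_probability M (\<lambda>s \<omega>. ranked_value (\<lambda>i. X i s \<omega>) (k s) / sqrt s) (y_star lam 1 q) at_top"
  unfolding tendsto_in_probability_def
proof (intro allI impI)
  fix \<eta> :: real assume "0 < \<eta>"
  from ranked_limit[OF q k this] obtain B where B: "\<And>s. B s \<in> events" "((\<lambda>s. prob (B s)) \<longlongrightarrow> 0) at_top"
    "eventually (\<lambda>s. AE \<omega> in M. \<omega> \<notin> B s \<longrightarrow> \<bar>ranked_value (\<lambda>i. X i s \<omega>) (k s) / sqrt s - y_star lam 1 q\<bar> \<le> \<eta>) at_top"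
    by blast
  show "((\<lambda>s. prob {\<omega> \<in> space M. \<eta> < \<bar>ranked_value (\<lambda>i. X i s \<omega>) (k s) / sqrt s - y_star lam 1 q\<bar>}) \<longlongrightarrow> 0) at_top"
  proof (rule Lim_null_comparison[OF _ B(2)])
    show "eventually (\<lambda>s. norm (prob {\<omega> \<in> space M. \<eta> < \<bar>ranked_value (\<lambda>i. X i s \<omega>) (k s) / sqrt s - y_star lam 1 q\<bar>}) \<le> prob (B s)) at_top"
      using B(3)
    proof eventually_elim
      case (elim s)
      have "prob {\<omega> \<in> space M. \<eta> < \<bar>ranked_value (\<lambda>i. X i s \<omega>) (k s) / sqrt s - y_star lam 1 q\<bar>} \<le> prob (B s)"
        by (rule measure_le_if_AE_covered[OF B(1)]) (use elim in eventually_elim, auto)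
      then show ?case by simp
    qed
  qed
qed

text \<open>The sum telescopes to a difference of two ranked positions, and after division by sqrt s
  these converge to the quantiles of q + \<epsilon> and q - \<epsilon>.\<close>

lemma spacing_sum_in_probability:
  assumes q: "0 < q" and \<delta>: "0 < \<delta>" and \<epsilon>: "0 < \<epsilon>" "\<epsilon> < q"
    and close: "\<bar>(y_star lam 1 (q + \<epsilon>) - y_star lam 1 (q - \<epsilon>)) / (2 * \<epsilon>) - L\<bar> < \<delta> / 2"
  shows "((\<lambda>s. prob {\<omega> \<in> space M. \<delta> \<le> \<bar>1 / (2 * \<epsilon> * sqrt s) *
      (\<Sum>i | 1 \<le> i \<and> (q - \<epsilon>) * sqrt s \<le> real i \<and> real i \<le> (q + \<epsilon>) * sqrt s. spacing (\<lambda>i. X i s \<omega>) i) - L\<bar>}) \<longlongrightarrow> 0) at_top"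
proof -
  define k1 where "k1 s = nat \<lceil>(q - \<epsilon>) * sqrt s\<rceil>" for s
  define k2 where "k2 s = nat \<lfloor>(q + \<epsilon>) * sqrt s\<rfloor>" for s
  have pos: "0 < (q - \<epsilon>) * sqrt s" "0 < (q + \<epsilon>) * sqrt s" if "0 < s" for s using \<epsilon> q that by auto
  have k1b: "(q - \<epsilon>) * sqrt s \<le> real (k1 s)" "real (k1 s) < (q - \<epsilon>) * sqrt s + 1" if "0 < s" for s
    using pos[OF that] unfolding k1_def by linarith+
  have k2b: "real (k2 s) \<le> (q + \<epsilon>) * sqrt s" "(q + \<epsilon>) * sqrt s < real (k2 s) + 1" if "0 < s" for s
    using pos[OF that] unfolding k2_def by linarith+
  have lim1: "((\<lambda>s. real (k1 s) / sqrt s) \<longlongrightarrow> q - \<epsilon>) at_top"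
  proof (rule tendsto_index_ratio)
    show "eventually (\<lambda>s. \<bar>real (k1 s) - (q - \<epsilon>) * sqrt s\<bar> \<le> 2) at_top"
      using eventually_gt_at_top[of 0] by eventually_elim (use k1b in \<open>fastforce simp: abs_le_iff\<close>)
  qed
  \<comment> \<open>The last spacing of the sum ends at the particle of the next rank, hence the
    successor.\<close>
  have lim2: "((\<lambda>s. real (Suc (k2 s)) / sqrt s) \<longlongrightarrow> q + \<epsilon>) at_top"
  proof (rule tendsto_index_ratio)
    show "eventually (\<lambda>s. \<bar>real (Suc (k2 s)) - (q + \<epsilon>) * sqrt s\<bar> \<le> 2) at_top"
      using eventually_gt_at_top[of 0] by eventually_elim (use k2b in \<open>fastforce simp: abs_le_iff\<close>)
  qed
  \<comment> \<open>Two errors of size \<eta> divided by 2 \<epsilon> amount to \<delta> / 4, which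
    together with the distance below \<delta> / 2 in \<open>close\<close> stays short of
    \<delta>.\<close>
  define \<eta> where "\<eta> = \<epsilon> * \<delta> / 4"
  have \<eta>: "0 < \<eta>" using \<epsilon> \<delta> by (simp add: \<eta>_def)
  define y1 y2 where "y1 = y_star lam 1 (q - \<epsilon>)" and "y2 = y_star lam 1 (q + \<epsilon>)"
  have q1: "0 < q - \<epsilon>" and q2: "0 < q + \<epsilon>" using \<epsilon> q by auto
  from ranked_limit[OF q1 lim1 \<eta>] obtain B1 where B1: "\<And>s. B1 s \<in> events" "((\<lambda>s. prob (B1 s)) \<longlongrightarrow> 0) at_top"
    "eventually (\<lambda>s. AE \<omega> in M. \<omega> \<notin> B1 s \<longrightarrow> \<bar>ranked_value (\<lambda>i. X i s \<omega>) (k1 s) / sqrt s - y1\<bar> \<le> \<eta>) at_top"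
    unfolding y1_def by blast
  from ranked_limit[OF q2 lim2 \<eta>] obtain B2 where B2: "\<And>s. B2 s \<in> events" "((\<lambda>s. prob (B2 s)) \<longlongrightarrow> 0) at_top"
    "eventually (\<lambda>s. AE \<omega> in M. \<omega> \<notin> B2 s \<longrightarrow> \<bar>ranked_value (\<lambda>i. X i s \<omega>) (Suc (k2 s)) / sqrt s - y2\<bar> \<le> \<eta>) at_top"
    unfolding y2_def by blast
  have tele: "(\<Sum>i | 1 \<le> i \<and> (q - \<epsilon>) * sqrt s \<le> real i \<and> real i \<le> (q + \<epsilon>) * sqrt s. spacing x i)
      = ranked_value x (Suc (k2 s)) - ranked_value x (k1 s)" if s: "0 < s" for s x
  proof -
    have "i \<in> {k1 s..k2 s} \<longleftrightarrow> 1 \<le> i \<and> (q - \<epsilon>) * sqrt s \<le> real i \<and> real i \<le> (q + \<epsilon>) * sqrt s" for i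
    proof
      assume "i \<in> {k1 s..k2 s}"
      then have i: "real (k1 s) \<le> real i" "real i \<le> real (k2 s)" by auto
      then have "0 < real i" using k1b[OF s] pos[OF s] by linarith
      then show "1 \<le> i \<and> (q - \<epsilon>) * sqrt s \<le> real i \<and> real i \<le> (q + \<epsilon>) * sqrt s"
        using i k1b[OF s] k2b[OF s] by auto
    next
      assume i: "1 \<le> i \<and> (q - \<epsilon>) * sqrt s \<le> real i \<and> real i \<le> (q + \<epsilon>) * sqrt s"
      then have "real (k1 s) < real i + 1" "real i < real (k2 s) + 1" using k1b[OF s] k2b[OF s] by auto
      then show "i \<in> {k1 s..k2 s}" by auto
    qed
    then have "{i. 1 \<le> i \<and> (q - \<epsilon>) * sqrt s \<le> real i \<and> real i \<le> (q + \<epsilon>) * sqrt s} = {k1 s..k2 s}" by blast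
    moreover have "k1 s \<le> Suc (k2 s)"
    proof -
      have "(q - \<epsilon>) * sqrt s \<le> (q + \<epsilon>) * sqrt s" using \<epsilon> s by (intro mult_right_mono) auto
      then have "real (k1 s) < real (k2 s) + 2" using k1b[OF s] k2b[OF s] by linarith
      then show ?thesis by linarith
    qed
    ultimately show ?thesis
      by (simp add: spacing_def sum_Suc_diff)
  qed
  show ?thesis
  proof (rule Lim_null_comparison)
    show "((\<lambda>s. prob (B1 s) + prob (B2 s)) \<longlongrightarrow> 0) at_top"
      using tendsto_add[OF B1(2) B2(2)] by simp
    show "eventually (\<lambda>s. norm (prob {\<omega> \<in> space M. \<delta> \<le> \<bar>1 / (2 * \<epsilon> * sqrt s) *
      (\<Sum>i | 1 \<le> i \<and> (q - \<epsilon>) * sqrt s \<le> real i \<and> real i \<le> (q + \<epsilon>) * sqrt s. spacing (\<lambda>i. X i s \<omega>) i) - L\<bar>}) \<le> prob (B1 s) + prob (B2 s)) at_top"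
      using B1(3) B2(3) eventually_gt_at_top[of 0]
    proof eventually_elim
      case (elim s)
      have r: "0 < sqrt s" using elim by simp
      let ?S = "{\<omega> \<in> space M. \<delta> \<le> \<bar>1 / (2 * \<epsilon> * sqrt s) *
        (\<Sum>i | 1 \<le> i \<and> (q - \<epsilon>) * sqrt s \<le> real i \<and> real i \<le> (q + \<epsilon>) * sqrt s. spacing (\<lambda>i. X i s \<omega>) i) - L\<bar>}"
      have "prob ?S \<le> prob (B1 s \<union> B2 s)"
      proof (rule measure_le_if_AE_covered)
        show "B1 s \<union> B2 s \<in> events" using B1(1) B2(1) by auto
        show "AE \<omega> in M. \<omega> \<in> ?S \<longrightarrow> \<omega> \<in> B1 s \<union> B2 s"
          using elim(1,2)
        proof eventually_elim
          case (elim \<omega>)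
          show ?case
          proof (intro impI, rule ccontr)
            assume "\<omega> \<in> ?S" and "\<omega> \<notin> B1 s \<union> B2 s"
            define v1 where "v1 = ranked_value (\<lambda>i. X i s \<omega>) (k1 s) / sqrt s"
            define v2 where "v2 = ranked_value (\<lambda>i. X i s \<omega>) (Suc (k2 s)) / sqrt s"
            have v: "\<bar>v1 - y1\<bar> \<le> \<eta>" "\<bar>v2 - y2\<bar> \<le> \<eta>"
              using elim \<open>\<omega> \<notin> B1 s \<union> B2 s\<close> by (auto simp: v1_def v2_def)
            have "1 / (2 * \<epsilon> * sqrt s) * (\<Sum>i | 1 \<le> i \<and> (q - \<epsilon>) * sqrt s \<le> real i \<and> real i \<le> (q + \<epsilon>) * sqrt s. spacing (\<lambda>i. X i s \<omega>) i)
              = (v2 - v1) / (2 * \<epsilon>)"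
              unfolding tele[OF \<open>0 < s\<close>] v1_def v2_def using r \<epsilon> by (simp add: field_simps)
            then have d: "\<delta> \<le> \<bar>(v2 - v1) / (2 * \<epsilon>) - L\<bar>" using \<open>\<omega> \<in> ?S\<close> by simp
            have "(v2 - v1) / (2 * \<epsilon>) - (y2 - y1) / (2 * \<epsilon>) = ((v2 - y2) - (v1 - y1)) / (2 * \<epsilon>)"
              by (simp add: diff_divide_distrib)
            also have "\<bar>\<dots>\<bar> \<le> (2 * \<eta>) / (2 * \<epsilon>)"
              unfolding abs_divide using v \<epsilon> by (intro frac_le) auto
            also have "(2 * \<eta>) / (2 * \<epsilon>) = \<delta> / 4" using \<epsilon> by (simp add: \<eta>_def)
            finally show False using d close \<delta> unfolding y1_def[symmetric] y2_def[symmetric] by linarith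
          qed
        qed
      qed
      also have "\<dots> \<le> prob (B1 s) + prob (B2 s)" using B1(1) B2(1) by (intro measure_Un_le)
      finally show ?case by simp
    qed
  qed
qed

text \<open>For all small \<epsilon> the quotient of quantiles is within \<delta> / 2 of its limit,
  so the probability itself tends to 0 and the inner limsup is exactly 0; the outer limit is that of
  an eventually constant function.\<close>

lemma spacing_sum_limit:
  assumes q: "0 < q" and \<delta>: "0 < \<delta>"
  shows "((\<lambda>\<epsilon>. Limsup at_top (\<lambda>s. ereal (prob {\<omega> \<in> space M. \<delta> \<le> \<bar>1 / (2 * \<epsilon> * sqrt s) *
      (\<Sum>i | 1 \<le> i \<and> (q - \<epsilon>) * sqrt s \<le> real i \<and> real i \<le> (q + \<epsilon>) * sqrt s. spacing (\<lambda>i. X i s \<omega>) i)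
        - 1 / dens (y_star lam 1 q)\<bar>}))) \<longlongrightarrow> 0) (at_right 0)"
proof (rule tendsto_eventually)
  have "eventually (\<lambda>\<epsilon>::real. 0 < \<epsilon> \<and> \<epsilon> < q) (at_right 0)"
    using q by (auto simp: eventually_at_right intro!: exI[of _ q])
  moreover have "eventually (\<lambda>\<epsilon>. \<bar>(y_star lam 1 (q + \<epsilon>) - y_star lam 1 (q - \<epsilon>)) / (2 * \<epsilon>) - 1 / dens (y_star lam 1 q)\<bar> < \<delta> / 2) (at_right 0)"
    using tendstoD[OF y_star_quotient_tendsto[OF q], of "\<delta> / 2"] \<delta> by (simp add: dist_real_def)
  ultimately show "eventually (\<lambda>\<epsilon>. Limsup at_top (\<lambda>s. ereal (prob {\<omega> \<in> space M. \<delta> \<le> \<bar>1 / (2 * \<epsilon> * sqrt s) *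
      (\<Sum>i | 1 \<le> i \<and> (q - \<epsilon>) * sqrt s \<le> real i \<and> real i \<le> (q + \<epsilon>) * sqrt s. spacing (\<lambda>i. X i s \<omega>) i)
        - 1 / dens (y_star lam 1 q)\<bar>})) = 0) (at_right 0)"
  proof eventually_elim
    case (elim \<epsilon>)
    have "((\<lambda>s. prob {\<omega> \<in> space M. \<delta> \<le> \<bar>1 / (2 * \<epsilon> * sqrt s) *
      (\<Sum>i | 1 \<le> i \<and> (q - \<epsilon>) * sqrt s \<le> real i \<and> real i \<le> (q + \<epsilon>) * sqrt s. spacing (\<lambda>i. X i s \<omega>) i)
        - 1 / dens (y_star lam 1 q)\<bar>}) \<longlongrightarrow> 0) at_top"
      using elim by (intro spacing_sum_in_probability[OF q \<delta>]) auto
    from tendsto_ereal[OF this] show ?case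
      by (intro lim_imp_Limsup) (auto simp: zero_ereal_def)
  qed
qed

end

end

theorem corollary1p5:
  fixes M :: "'a measure" and F :: "real \<Rightarrow> 'a measure"
    and W X :: "nat \<Rightarrow> real \<Rightarrow> 'a \<Rightarrow> real"
    and Y Z :: "nat \<Rightarrow> real \<Rightarrow> 'a \<Rightarrow> real"
    and lam :: real
  assumes lam: "lam > 0"
    and atlas: "atlas_infinity M F W X"
    and init: "PPP_plus M lam (\<lambda>i. X i 0)"
    and Y_def: "\<And>k t \<omega>. Y k t \<omega> = ranked_value (\<lambda>i. X i t \<omega>) k"
    and Z_def: "\<And>k t \<omega>. Z k t \<omega> = spacing (\<lambda>i. X i t \<omega>) k"
  shows "(\<forall>t>0. \<forall>q\<ge>0. y_star lam t q = y_star lam 1 q * sqrt t)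
    \<and> (\<forall>q\<ge>0. q = (LBINT r=kappa lam..y_star lam 1 q. u_star lam 1 r))
    \<and> (\<forall>q>0. u_star lam 1 (y_star lam 1 q) = c1 lam + c2 lam * Phi (y_star lam 1 q))
    \<and> (\<forall>q>0. tendsto_in_probability M
          (\<lambda>s \<omega>. Y (nat \<lfloor>q * sqrt s\<rfloor>) s \<omega> / sqrt s) (y_star lam 1 q) at_top)
    \<and> (\<forall>q>0. \<forall>\<delta>>0.
          ((\<lambda>\<epsilon>. Limsup at_top (\<lambda>s. ereal (measure M {\<omega> \<in> space M.
              \<bar>1 / (2 * \<epsilon> * sqrt s) *
                  (\<Sum>i | 1 \<le> i \<and> (q - \<epsilon>) * sqrt s \<le> real i \<and> real i \<le> (q + \<epsilon>) * sqrt s. Z i s \<omega>)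
                - 1 / u_star lam 1 (y_star lam 1 q)\<bar> \<ge> \<delta>})))
            \<longlongrightarrow> 0) (at_right 0))"
proof -
  interpret atlas_infinity M F W X by (rule atlas)
  interpret profile lam by unfold_locales (rule lam)
  have "tendsto_in_probability M (\<lambda>s \<omega>. ranked_value (\<lambda>i. X i s \<omega>) (nat \<lfloor>q * sqrt s\<rfloor>) / sqrt s) (y_star lam 1 q) at_top"
    if q: "0 < q" for q
  proof (rule ranked_in_probability[OF lam init q], rule tendsto_index_ratio)
    show "eventually (\<lambda>s. \<bar>real (nat \<lfloor>q * sqrt s\<rfloor>) - q * sqrt s\<bar> \<le> 2) at_top"
      using eventually_gt_at_top[of 0]
    proof eventually_elim
      case (elim s)
      then have "0 \<le> q * sqrt s" using q by simp
      then show ?case by linarith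
    qed
  qed
  note ranked = this
  show ?thesis
    unfolding Y_def Z_def
  proof (intro conjI allI impI)
    fix q :: real
    show "y_star lam t q = y_star lam 1 q * sqrt t" if "0 < t" "0 \<le> q" for t
      using that by (intro y_star_scaling)
    show "q = (LBINT r=kappa lam..y_star lam 1 q. u_star lam 1 r)" if "0 \<le> q"
      using that by (rule integral_u_star[symmetric])
    assume q: "0 < q"
    show "u_star lam 1 (y_star lam 1 q) = c1 lam + c2 lam * Phi (y_star lam 1 q)"
      unfolding u_star_y_star[OF q] by (rule dens_def)
    show "tendsto_in_probability M (\<lambda>s \<omega>. ranked_value (\<lambda>i. X i s \<omega>) (nat \<lfloor>q * sqrt s\<rfloor>) / sqrt s) (y_star lam 1 q) at_top"
      by (rule ranked[OF q])
    show "((\<lambda>\<epsilon>. Limsup at_top (\<lambda>s. ereal (measure M {\<omega> \<in> space M.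
              \<bar>1 / (2 * \<epsilon> * sqrt s) *
                  (\<Sum>i | 1 \<le> i \<and> (q - \<epsilon>) * sqrt s \<le> real i \<and> real i \<le> (q + \<epsilon>) * sqrt s. spacing (\<lambda>i. X i s \<omega>) i)
                - 1 / u_star lam 1 (y_star lam 1 q)\<bar> \<ge> \<delta>})))
            \<longlongrightarrow> 0) (at_right 0)" if "0 < \<delta>" for \<delta>
      unfolding u_star_y_star[OF q] by (rule spacing_sum_limit[OF lam init q that])
  qed
qed

end
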